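(* Let $N\ge 1$, $\Lambda=\operatorname{diag}(\lambda_1,\dots,\lambda_N)$ with $\lambda_i>0$, let $Q$ be a formal parameter, and let $\tau_Q$ be the large-$\Lambda$ asymptotic expansion of the Kontsevich–Penner matrix model. Then $$\tau_Q=\sum_{(\Gamma,c)}\frac{2^{|e(\Gamma)|-|v(\Gamma)|}\,Q^{|b(\Gamma)|}}{|\operatorname{Aut}(\Gamma,c)|}\prod_{e\in e(\Gamma)}\tilde\lambda_e^{-1},$$ where the sum is over (isomorphism classes of) all trivalent $N$-colored ribbon graphs $(\Gamma,c)$, both open and closed, connected and disconnected, and $$\tilde\lambda_e=\begin{cases}\lambda_{c(e_+)}+\lambda_{c(e_-)} & \text{if } e \text{ is an internal edge},\\ \lambda_{c(e)} & \text{if } e\text{ is a boundary edge}.\end{cases}$$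
   Context: **Ribbon graphs.** A ribbon graph is a collection of data $\Gamma=(\mathfrak h,\sigma_0,\sigma_1,\sigma_2,B)$ where: (1) $\mathfrak h$ is a finite set (of half-edges, equivalently directed edges); (2) $\sigma_0,\sigma_1,\sigma_2$ are permutations of $\mathfrak h$; (3) $\sigma_1$ is a fixed-point-free involution; (4) $\sigma_2=\sigma_0^{-1}\circ\sigma_1$; (5) $B\subset\mathfrak h$ (the boundary half-edges) satisfies: $x\in B\Rightarrow\sigma_2(x)\in B$, and $x\in B\Rightarrow\sigma_1(x)\notin B$; (6) no cycle of $\sigma_0$ has length 1 or 2. The vertices $v(\Gamma)$ are the cycles of $\sigma_0$, and the edges $e(\Gamma)$ are the cycles of $\sigma_1$. The cycles of $\sigma_2$ contained in $B$ are the boundaries $b(\Gamma)$, and the cycles of $\sigma_2$ contained in $F=\mathfrak h\setminus B$ are the faces. $\Gamma$ is open if $b(\Gamma)\neq\emptyset$ and closed otherwise. It is connected if $\langle\sigma_0,\sigma_1\rangle$ acts transitively on $\mathfrak h$, and trivalent if all cycles of $\sigma_0$ have length 3. Disconnected graphs include the empty graph, which contributes $1$. An $N$-coloring of $\Gamma$ is a map $c:F\to\{1,\dots,N\}$ with $c\circ\sigma_2=c$, i.e. a map from the set of faces to $\{1,\dots,N\}$ (not necessarily injective or surjective). Isomorphisms of $N$-colored ribbon graphs are bijections of half-edges commuting with $\sigma_0,\sigma_1$ and preserving $B$ and the coloring; $\operatorname{Aut}(\Gamma,c)$ is the group of self-isomorphisms. An edge is a boundary edge if one of its two half-edges is in $B$;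 then exactly one of its half-edges lies in $F$, and $c(e)$ is the color of that half-edge. Otherwise the edge is internal, and $c(e_\pm)$ are the colors of its two half-edges. **Kontsevich–Penner model.** Let $\mathcal H_N$ be the space of $N\times N$ Hermitian matrices. The model is $$\tau_Q=\det(\Lambda)^Q\,\mathcal C_\Lambda^{-1}\int_{\mathcal H_N}d\Phi\,\exp\Bigl(-\operatorname{Tr}\bigl(\tfrac{\Phi^3}{3!}-\tfrac{\Lambda^2\Phi}{2}+Q\log\Phi\bigr)\Bigr),\qquad \mathcal C_\Lambda=e^{\operatorname{Tr}\Lambda^3/3}\int_{\mathcal H_N}dX\,e^{-\operatorname{Tr}(X^2\Lambda)/2}.$$ It is understood as an asymptotic (perturbative) expansion for $\Lambda\to(\infty,\dots,\infty)$: substituting $\Phi=X+\Lambda$, and writing $$\langle f\rangle_\Lambda=\frac{\int_{\mathcal H_N}f(X)\,e^{-\operatorname{Tr}(X^2\Lambda)/2}dX}{\int_{\mathcal H_N}e^{-\operatorname{Tr}(X^2\Lambda)/2}dX},$$ one has $$\tau_Q=\Bigl\langle\exp\operatorname{Tr}\Bigl(-\frac{X^3}{3!}+\sum_{k\ge1}\frac{Q}{k}(-\Lambda^{-1}X)^k\Bigr)\Bigr\rangle_\Lambda,$$ where the exponential is expanded as a power series in $\operatorname{Tr}X^3$ and the $\operatorname{Tr}(-\Lambda^{-1}X)^k$ and the expectation is taken term by term. Each term is a homogeneous rational function of $\lambda_1,\dots,\lambda_N$ times a power of $Q$, and only finitely many terms have any given degree in $\lambda$. The claimed equality is an equality of such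 formal series, i.e. it holds in each degree of homogeneity in $\lambda_1,\dots,\lambda_N$. *)

theory Defs
  imports
    "HOL-Analysis.Analysis"
    "HOL-Combinatorics.Orbits"
    "HOL-Computational_Algebra.Formal_Power_Series"
begin

section \<open>Coloured ribbon graphs\<close>

record 'h ribbon_graph =
  half_edges :: "'h set"
  sigma0 :: "'h \<Rightarrow> 'h"
  sigma1 :: "'h \<Rightarrow> 'h"
  sigma2 :: "'h \<Rightarrow> 'h"
  bdry :: "'h set"

definition cycles_on :: "('h \<Rightarrow> 'h) \<Rightarrow> 'h set \<Rightarrow> 'h set set" where
  "cycles_on f H = orbit f ` H"

definition is_ribbon_graph :: "'h ribbon_graph \<Rightarrow> bool" where
  "is_ribbon_graph G \<longleftrightarrow>
     finite (half_edges G) \<and>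
     sigma0 G permutes half_edges G \<and>
     sigma1 G permutes half_edges G \<and>
     sigma2 G permutes half_edges G \<and>
     (\<forall>x\<in>half_edges G. sigma1 G (sigma1 G x) = x \<and> sigma1 G x \<noteq> x) \<and>
     sigma2 G = inv (sigma0 G) \<circ> sigma1 G \<and>
     bdry G \<subseteq> half_edges G \<and>
     (\<forall>x\<in>bdry G. sigma2 G x \<in> bdry G \<and> sigma1 G x \<notin> bdry G) \<and>
     (\<forall>C\<in>cycles_on (sigma0 G) (half_edges G). card C \<noteq> 1 \<and> card C \<noteq> 2)"

definition vertices :: "'h ribbon_graph \<Rightarrow> 'h set set" where
  "vertices G = cycles_on (sigma0 G) (half_edges G)"

definition edges :: "'h ribbon_graph \<Rightarrow> 'h set set" where
  "edges G = cycles_on (sigma1 G) (half_edges G)"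

definition boundaries :: "'h ribbon_graph \<Rightarrow> 'h set set" where
  "boundaries G = {C \<in> cycles_on (sigma2 G) (half_edges G). C \<subseteq> bdry G}"

definition face_half_edges :: "'h ribbon_graph \<Rightarrow> 'h set" where
  "face_half_edges G = half_edges G - bdry G"

definition trivalent :: "'h ribbon_graph \<Rightarrow> bool" where
  "trivalent G \<longleftrightarrow> (\<forall>C\<in>vertices G. card C = 3)"

text \<open>Colours are the elements of the finite type \<open>'n\<close> that also indexes the rows and columns of the
  matrices, so \<open>N = CARD('n)\<close>.  Colourings are extensional, hence determined by their values
  on the faces.\<close>

definition is_coloring :: "'h ribbon_graph \<Rightarrow> ('h \<Rightarrow> 'n) \<Rightarrow> bool" where
  "is_coloring G c \<longleftrightarrow>
     c \<in> extensional (face_half_edges G) \<and> (\<forall>x\<in>face_half_edges G. c (sigma2 G x) = c x)"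

type_synonym ('h, 'n) colored_graph = "'h ribbon_graph \<times> ('h \<Rightarrow> 'n)"

definition is_colored_iso ::
  "('h \<Rightarrow> 'k) \<Rightarrow> ('h, 'n) colored_graph \<Rightarrow> ('k, 'n) colored_graph \<Rightarrow> bool" where
  "is_colored_iso f = (\<lambda>(G, c) (G', c').
     bij_betw f (half_edges G) (half_edges G') \<and>
     (\<forall>x\<in>half_edges G. f (sigma0 G x) = sigma0 G' (f x) \<and> f (sigma1 G x) = sigma1 G' (f x)) \<and>
     f ` bdry G = bdry G' \<and>
     (\<forall>x\<in>face_half_edges G. c' (f x) = c x))"

definition colored_Aut :: "('h, 'n) colored_graph \<Rightarrow> ('h \<Rightarrow> 'h) set" where
  "colored_Aut g = {f. f permutes half_edges (fst g) \<and> is_colored_iso f g g}"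

text \<open>Every finite ribbon graph is isomorphic to one whose half-edges are natural numbers, so the
  isomorphism classes are taken within \<open>nat\<close>.\<close>

definition trivalent_colored_graphs :: "(nat, 'n) colored_graph set" where
  "trivalent_colored_graphs = {(G, c). is_ribbon_graph G \<and> trivalent G \<and> is_coloring G c}"

definition colored_iso_rel :: "((nat, 'n) colored_graph \<times> (nat, 'n) colored_graph) set" where
  "colored_iso_rel = {(g, g'). g \<in> trivalent_colored_graphs \<and> g' \<in> trivalent_colored_graphs \<and>
     (\<exists>f. is_colored_iso f g g')}"

text \<open>An edge is a two-element set of half-edges \<open>{e\<^sub>+, e\<^sub>-}\<close>, so for an internal edge the sum has
  exactly the two summands \<open>\<lambda>\<^bsub>c(e\<^sub>+)\<^esub>\<close> and \<open>\<lambda>\<^bsub>c(e\<^sub>-)\<^esub>\<close>, also if the two colours coincide.\<close>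

definition edge_lambda :: "real^'n \<Rightarrow> ('h, 'n) colored_graph \<Rightarrow> 'h set \<Rightarrow> real" where
  "edge_lambda lam = (\<lambda>(G, c) e.
     if e \<inter> bdry G = {} then (\<Sum>x\<in>e. lam $ c x)
     else lam $ c (THE x. x \<in> e \<inter> face_half_edges G))"

text \<open>The contribution of one graph, as an element of \<open>\<complex>[[Q]]\<close>.\<close>

definition graph_weight :: "real^'n \<Rightarrow> ('h, 'n) colored_graph \<Rightarrow> complex fps" where
  "graph_weight lam g =
     fps_const (of_real
       (2 powi (int (card (edges (fst g))) - int (card (vertices (fst g))))
        / real (card (colored_Aut g))
        * (\<Prod>e\<in>edges (fst g). inverse (edge_lambda lam g e))))
     * fps_X ^ card (boundaries (fst g))"


section \<open>Gaussian expectations over Hermitian matrices\<close>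

text \<open>The product and power of type class \<open>times\<close> on \<open>complex^'n^'n\<close> are entrywise.\<close>

primrec matpow :: "'a::semiring_1^'n^'n \<Rightarrow> nat \<Rightarrow> 'a^'n^'n" where
  "matpow A 0 = mat 1"
| "matpow A (Suc k) = A ** matpow A k"

definition Lam :: "real^'n \<Rightarrow> complex^'n^'n" where
  "Lam lam = (\<chi> i j. if i = j then of_real (lam $ i) else 0)"

definition hermitian :: "complex^'n^'n \<Rightarrow> bool" where
  "hermitian X \<longleftrightarrow> (\<forall>i j. X $ j $ i = cnj (X $ i $ j))"

text \<open>\<open>M \<mapsto> (M + M\<^sup>T)/2 + \<i>(M - M\<^sup>T)/2\<close> is a real-linear isometry of the real matrices onto the Hermitian
  ones.  Transporting Lebesgue measure along it gives the Lebesgue measure \<open>dX\<close> on the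
  Hermitian matrices without ordering the index type.\<close>

definition herm :: "real^'n^'n \<Rightarrow> complex^'n^'n" where
  "herm M = (\<chi> i j. Complex ((M $ i $ j + M $ j $ i) / 2) ((M $ i $ j - M $ j $ i) / 2))"

lemma linear_herm: "linear herm"
  by (rule linearI) (simp_all add: herm_def vec_eq_iff complex_eq_iff field_simps)

lemma norm_herm: "norm (herm M) = norm M"
proof -
  have sq: "(norm (X::complex^'n^'n))\<^sup>2 = (\<Sum>i\<in>UNIV. \<Sum>j\<in>UNIV. (norm (X $ i $ j))\<^sup>2)" for X
    by (simp add: norm_vec_def L2_set_def sum_nonneg)
  have sq': "(norm M)\<^sup>2 = (\<Sum>i\<in>UNIV. \<Sum>j\<in>UNIV. (M $ i $ j)\<^sup>2)"
    by (simp add: norm_vec_def L2_set_def sum_nonneg)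
  have "(norm (herm M))\<^sup>2 = (\<Sum>i\<in>UNIV. \<Sum>j\<in>UNIV. ((M $ i $ j)\<^sup>2 + (M $ j $ i)\<^sup>2) / 2)"
    unfolding sq by (intro sum.cong refl) (simp only: herm_def vec_lambda_beta cmod_power2 complex.sel, simp add: power2_eq_square field_simps)
  also have "\<dots> = ((\<Sum>i\<in>UNIV. \<Sum>j\<in>UNIV. (M $ i $ j)\<^sup>2) + (\<Sum>i\<in>UNIV. \<Sum>j\<in>UNIV. (M $ j $ i)\<^sup>2)) / 2"
    by (simp only: sum_divide_distrib[symmetric] sum.distrib)
  also have "(\<Sum>i\<in>UNIV. \<Sum>j\<in>UNIV. (M $ j $ i)\<^sup>2) = (\<Sum>i\<in>UNIV. \<Sum>j\<in>UNIV. (M $ i $ j)\<^sup>2)"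
    by (rule sum.swap)
  finally have "(norm (herm M))\<^sup>2 = (norm M)\<^sup>2" by (simp add: sq')
  thus ?thesis by simp
qed

lemma range_herm: "range herm = {X. hermitian X}"
proof (intro equalityI subsetI)
  fix X :: "complex^'n^'n" assume "X \<in> {X. hermitian X}"
  hence h: "X $ j $ i = cnj (X $ i $ j)" for i j unfolding hermitian_def by blast
  have "herm (\<chi> i j. Re (X $ i $ j) + Im (X $ i $ j)) $ i $ j = X $ i $ j" for i j
  proof -
    have "Re (X $ j $ i) = Re (X $ i $ j)" "Im (X $ j $ i) = - Im (X $ i $ j)"
      by (subst h[of j i], simp)+
    thus ?thesis by (intro complex_eqI) (simp_all add: herm_def)
  qed
  hence "herm (\<chi> i j. Re (X $ i $ j) + Im (X $ i $ j)) = X"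
    unfolding vec_eq_iff by blast
  thus "X \<in> range herm" by (rule range_eqI[OF sym])
next
  fix X :: "complex^'n^'n" assume "X \<in> range herm"
  then obtain M where "X = herm M" by blast
  thus "X \<in> {X. hermitian X}"
    by (simp add: hermitian_def herm_def complex_eq_iff add.commute minus_divide_left)
qed

definition hermitian_lborel :: "(complex^'n^'n) measure" where
  "hermitian_lborel = distr lborel borel herm"

definition gauss_density :: "real^'n \<Rightarrow> complex^'n^'n \<Rightarrow> complex" where
  "gauss_density lam X = exp (- trace (matpow X 2 ** Lam lam) / 2)"

definition gauss_mean :: "real^'n \<Rightarrow> (complex^'n^'n \<Rightarrow> complex) \<Rightarrow> complex" where
  "gauss_mean lam f =
     (\<integral>X. f X * gauss_density lam X \<partial>hermitian_lborel)
     / (\<integral>X. gauss_density lam X \<partial>hermitian_lborel)"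


section \<open>The perturbative Kontsevich--Penner series\<close>

text \<open>Formal series in \<open>Q\<close> and in the entries of \<open>\<Lambda>\<close> are represented by \<open>complex fps fps\<close>: the
  inner variable is \<open>Q\<close>, and the outer variable \<open>z\<close> records homogeneity, the coefficient of \<open>z\<^sup>n\<close>
  being the component of degree \<open>-n/2\<close> in \<open>\<lambda>\<close>.  As \<open>X\<close> scales like \<open>\<lambda>\<^sup>-\<^sup>1\<^sup>/\<^sup>2\<close> under the Gaussian
  measure, \<open>Tr X\<^sup>3\<close> carries \<open>z\<^sup>3\<close> and \<open>Tr (-\<Lambda>\<^sup>-\<^sup>1 X)\<^sup>k\<close> carries \<open>z\<^sup>3\<^sup>k\<close>; see \<open>kp_tau_homogeneous\<close>.\<close>

definition kp_interaction :: "real^'n \<Rightarrow> complex^'n^'n \<Rightarrow> complex fps fps" where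
  "kp_interaction lam X =
     fps_const (fps_const (- trace (matpow X 3) / fact 3)) * fps_X ^ 3
     + Abs_fps (\<lambda>n. if 3 dvd n \<and> n > 0
         then (let k = n div 3 in
           fps_const (trace (matpow (- (matrix_inv (Lam lam) ** X)) k) / of_nat k) * fps_X)
         else 0)"

definition exp_series :: "complex fps fps" where
  "exp_series = Abs_fps (\<lambda>n. fps_const (1 / fact n))"

definition kp_tau :: "real^'n \<Rightarrow> complex fps fps" where
  "kp_tau lam = Abs_fps (\<lambda>n. Abs_fps (\<lambda>q.
     gauss_mean lam (\<lambda>X. fps_nth (fps_nth (exp_series oo kp_interaction lam X) n) q)))"

text \<open>The origin of the interaction: at \<open>\<Phi> = X + \<Lambda>\<close> the polynomial part of the action of the matrix
  model is the quadratic form of the Gaussian measure, the constant cancelled by \<open>\<C>\<^sub>\<Lambda>\<close>, and a cubic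
  term, while \<open>Q (Tr log \<Lambda> - Tr log \<Phi>) = - Q Tr log (1 + \<Lambda>\<^sup>-\<^sup>1 X)\<close> is expanded in powers of \<open>\<Lambda>\<^sup>-\<^sup>1 X\<close>.\<close>

lemma kp_action_shift:
  fixes X L :: "complex^'n^'n"
  shows "trace (matpow (X + L) 3) / fact 3 - trace (matpow L 2 ** (X + L)) / 2 =
    trace (matpow X 3) / fact 3 + trace (matpow X 2 ** L) / 2 - trace (matpow L 3) / 3"
proof -
  have cyc: "trace (A ** (B ** C)) = trace (B ** (C ** A))" for A B C :: "complex^'n^'n"
    by (metis matrix_mul_assoc trace_mul_sym)
  have e: "trace (X ** (X ** L)) = trace (L ** (X ** X))" "trace (X ** (L ** X)) = trace (L ** (X ** X))"
    "trace (X ** (L ** L)) = trace (L ** (L ** X))" "trace (L ** (X ** L)) = trace (L ** (L ** X))"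
    by (metis cyc)+
  have add_r: "(A + B) ** C = A ** C + B ** C" for A B C :: "complex^'n^'n"
    by (simp add: matrix_matrix_mult_def vec_eq_iff sum.distrib distrib_right)
  show ?thesis
    by (simp add: eval_nat_numeral matrix_add_ldistrib add_r trace_add e
      matrix_mul_assoc[symmetric] field_simps)
qed

lemma integral_hermitian_lborel:
  fixes f :: "complex^'n^'n \<Rightarrow> complex"
  assumes "continuous_on UNIV f"
  shows "(\<integral>X. f X \<partial>hermitian_lborel) = (\<integral>M. f (herm M) \<partial>lborel)"
  unfolding hermitian_lborel_def
proof (rule integral_distr)
  show "herm \<in> lborel \<rightarrow>\<^sub>M borel"
    using borel_measurable_continuous_onI[OF linear_continuous_on[OF
      linear_conv_bounded_linear[THEN iffD1, OF linear_herm]]] by simp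
  show "f \<in> borel_measurable borel"
    using assms by (rule borel_measurable_continuous_onI)
qed

lemma continuous_matpow:
  "continuous_on UNIV (\<lambda>X::complex^'n^'n. trace (matpow (A ** X) k))"
proof -
  have ax: "continuous_on UNIV (\<lambda>X::complex^'n^'n. (A ** X) $ i $ j)" for i j
    unfolding matrix_matrix_mult_def by (simp, intro continuous_intros)
  have "continuous_on UNIV (\<lambda>X::complex^'n^'n. matpow (A ** X) k $ i $ j)" for i j
  proof (induction k arbitrary: i j)
    case (Suc k)
    have "(\<lambda>X. matpow (A ** X) (Suc k) $ i $ j) =
        (\<lambda>X. \<Sum>l\<in>UNIV. (A ** X) $ i $ l * matpow (A ** X) k $ l $ j)"
      by (simp add: matrix_matrix_mult_def[where m = "A ** _"])
    thus ?case by (simp only:) (intro continuous_intros ax Suc)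
  qed simp
  thus ?thesis unfolding trace_def by (intro continuous_on_sum)
qed

lemma matrix_mult_scaleR_left: "(r *\<^sub>R A) ** B = r *\<^sub>R (A ** B)" for A B :: "complex^'n^'n"
  by (simp add: matrix_matrix_mult_def vec_eq_iff scaleR_sum_right)

lemma matrix_mult_scaleR_right: "A ** (r *\<^sub>R B) = r *\<^sub>R (A ** B)" for A B :: "complex^'n^'n"
  by (simp add: matrix_matrix_mult_def vec_eq_iff scaleR_sum_right)

lemma matpow_scaleR: "matpow (r *\<^sub>R A) k = r ^ k *\<^sub>R matpow A k" for A :: "complex^'n^'n"
  by (induction k) (simp_all add: matrix_mult_scaleR_left matrix_mult_scaleR_right)

lemma trace_scaleR: "trace (r *\<^sub>R A) = of_real r * trace A" for A :: "complex^'n^'n"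
  by (simp add: trace_def scaleR_conv_of_real[where 'a=complex] sum_distrib_left)

lemma Lam_scaleR: "Lam (r *\<^sub>R lam) = r *\<^sub>R Lam lam"
  by (simp add: Lam_def vec_eq_iff scaleR_conv_of_real[where 'a=complex])

lemma if_zero_mult:
  "(\<Sum>k\<in>(UNIV::'n::finite set). (if i = k then a k else 0) * (if k = j then b k else 0)) =
    (if i = j then a i * b i else (0::complex))"
proof -
  have "(\<Sum>k\<in>(UNIV::'n set). (if i = k then a k else 0) * (if k = j then b k else 0)) =
    (\<Sum>k\<in>UNIV. if i = k then (if i = j then a i * b i else 0) else 0)"
    by (intro sum.cong) auto
  thus ?thesis by simp
qed

lemma matrix_inv_Lam:
  assumes "\<And>i. lam $ i \<noteq> 0"
  shows "matrix_inv (Lam lam) = Lam (\<chi> i. inverse (lam $ i))"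
proof -
  let ?L' = "Lam (\<chi> i. inverse (lam $ i))"
  have LL': "Lam lam ** ?L' = mat 1" and L'L: "?L' ** Lam lam = mat 1"
    using assms by (simp_all add: Lam_def matrix_matrix_mult_def vec_eq_iff mat_def if_zero_mult)
  hence "Lam lam ** matrix_inv (Lam lam) = mat 1 \<and> matrix_inv (Lam lam) ** Lam lam = mat 1"
    unfolding matrix_inv_def
    by (rule someI[where P = "\<lambda>A'. Lam lam ** A' = mat 1 \<and> A' ** Lam lam = mat 1", OF conjI])
  thus ?thesis
  proof -
    let ?L = "Lam lam" and ?M = "matrix_inv (Lam lam)"
    assume "?L ** ?M = mat 1 \<and> ?M ** ?L = mat 1"
    hence "?L' ** (?L ** ?M) = ?L'" by simp
    thus ?thesis unfolding matrix_mul_assoc L'L by simp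
  qed
qed

lemma kp_interaction_nth:
  "fps_nth (kp_interaction lam X) n =
     (if n = 3 then fps_const (- trace (matpow X 3) / fact 3) else 0)
     + (if 3 dvd n \<and> n > 0 then
          fps_const (trace (matpow (- (matrix_inv (Lam lam) ** X)) (n div 3)) / of_nat (n div 3)) * fps_X
        else 0)"
  by (simp add: kp_interaction_def Let_def fps_X_power_mult_right_nth)

lemma kp_interaction_scale:
  assumes "\<And>i. lam $ i > 0" "s > 0"
  shows "fps_nth (kp_interaction (s\<^sup>2 *\<^sub>R lam) (inverse s *\<^sub>R X)) n =
    fps_const (of_real (inverse s) ^ n) * fps_nth (kp_interaction lam X) n"
proof -
  have inv: "matrix_inv (Lam (s\<^sup>2 *\<^sub>R lam)) = (inverse s)\<^sup>2 *\<^sub>R matrix_inv (Lam lam)"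
  proof -
    have "matrix_inv (Lam lam) = Lam (\<chi> i. inverse (lam $ i))"
      using assms(1) by (intro matrix_inv_Lam) (metis less_irrefl)
    moreover have "matrix_inv (Lam (s\<^sup>2 *\<^sub>R lam)) = Lam (\<chi> i. inverse ((s\<^sup>2 *\<^sub>R lam) $ i))"
      using assms by (intro matrix_inv_Lam) (simp add: less_imp_neq[symmetric])
    moreover have "(\<chi> i. inverse ((s\<^sup>2 *\<^sub>R lam) $ i)) = (inverse s)\<^sup>2 *\<^sub>R (\<chi> i. inverse (lam $ i))"
      by (simp add: vec_eq_iff field_simps)
    ultimately show ?thesis by (simp only: Lam_scaleR)
  qed
  have p: "- (matrix_inv (Lam (s\<^sup>2 *\<^sub>R lam)) ** (inverse s *\<^sub>R X)) =
      inverse s ^ 3 *\<^sub>R (- (matrix_inv (Lam lam) ** X))"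
    unfolding inv matrix_mult_scaleR_left matrix_mult_scaleR_right
    by (simp add: power2_eq_square power3_eq_cube)
  have q: "fps_const (of_real (inverse s) ^ 3 * x / y) = fps_const (of_real (inverse s) ^ 3) * fps_const (x / y)"
    "fps_const (of_real ((inverse s ^ 3) ^ k) * x / y) * F =
       fps_const (of_real (inverse s) ^ (3 * k)) * (fps_const (x / y) * F)" for x y :: complex and F k
    by (simp_all add: power_mult mult.assoc[symmetric])
  have m: "- (of_real (inverse s ^ 3) * x) = of_real (inverse s) ^ 3 * (- x)" for x :: complex
    by simp
  show ?thesis
  proof (cases "3 dvd n")
    case True
    then obtain k where k: "n = 3 * k" by blast
    show ?thesis
      unfolding kp_interaction_nth p matpow_scaleR trace_scaleR m unfolding k q
      by (cases "k = 1"; cases "k = 0") (simp_all add: distrib_left)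
  next
    case False
    thus ?thesis by (auto simp: kp_interaction_nth)
  qed
qed

text \<open>The coefficients of \<open>z\<^sup>n\<close> are indeed homogeneous of degree \<open>-n/2\<close>.\<close>

lemma kp_tau_homogeneous:
  fixes lam :: "real^'n"
  assumes lam: "\<And>i. lam $ i > 0" and s: "s > 0"
  shows "fps_nth (kp_tau (s\<^sup>2 *\<^sub>R lam)) n = fps_const (of_real (inverse s ^ n)) * fps_nth (kp_tau lam) n"
proof -
  define F where "F = (\<lambda>(lam::real^'n) X n q. fps_nth (fps_nth (exp_series oo kp_interaction lam X) n) q)"
  define r where "r = (of_real (inverse s) :: complex)"
  have pow: "fps_nth (kp_interaction (s\<^sup>2 *\<^sub>R lam) (inverse s *\<^sub>R X) ^ k) n =
      fps_const (r ^ n) * fps_nth (kp_interaction lam X ^ k) n" for X k n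
  proof (induction k arbitrary: n)
    case 0 thus ?case by (cases n) auto
  next
    case (Suc k)
    have ki: "fps_nth (kp_interaction (s\<^sup>2 *\<^sub>R lam) (inverse s *\<^sub>R X)) i =
        fps_const (r ^ i) * fps_nth (kp_interaction lam X) i" for i
      unfolding r_def by (rule kp_interaction_scale[OF lam s])
    have rn: "fps_const (r ^ i) * a * (fps_const (r ^ (n - i)) * b) = fps_const (r ^ n) * (a * b)"
      if "i \<in> {0..n}" for i and a b :: "complex fps"
    proof -
      have "r ^ n = r ^ i * r ^ (n - i)"
        using that by (simp add: power_add[symmetric])
      hence "fps_const (r ^ n) = fps_const (r ^ i) * fps_const (r ^ (n - i))" by simp
      thus ?thesis by (simp only: mult_ac)
    qed
    show ?case
      unfolding power_Suc fps_mult_nth[of "kp_interaction _ _"] ki Suc sum_distrib_left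
      by (intro sum.cong refl rn)
  qed
  have F: "F (s\<^sup>2 *\<^sub>R lam) (inverse s *\<^sub>R X) n q = r ^ n * F lam X n q" for X n q
    by (simp add: F_def fps_compose_nth pow mult.left_commute[of _ "fps_const _"] sum_distrib_left[symmetric])
  have cont_mult: "continuous_on UNIV (\<lambda>X. fps_nth (fps_nth (G X * H X) n) q)"
    if "\<And>n q. continuous_on UNIV (\<lambda>X. fps_nth (fps_nth (G X) n) q)"
       "\<And>n q. continuous_on UNIV (\<lambda>X. fps_nth (fps_nth (H X) n) q)"
    for G H :: "complex^'n^'n \<Rightarrow> complex fps fps" and n q
    unfolding fps_mult_nth fps_sum_nth by (intro continuous_intros that)
  have cont_int: "continuous_on UNIV (\<lambda>X. fps_nth (fps_nth (kp_interaction l X) n) q)" for l :: "real^'n" and n q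
  proof -
    have neg: "- (A ** X) = (- A) ** X" for A X :: "complex^'n^'n"
      using matrix_mult_scaleR_left[of "-1" A X] by simp
    have cont_if: "continuous_on UNIV (\<lambda>X. if P then f X else 0)" if "continuous_on UNIV f"
      for P and f :: "complex^'n^'n \<Rightarrow> complex"
      using that by (cases P) simp_all
    have e: "fps_nth (fps_nth (kp_interaction l X) n) q =
        (if n = 3 \<and> q = 0 then - trace (matpow X 3) / fact 3 else 0)
        + (if 3 dvd n \<and> n > 0 \<and> q = 1 then
            trace (matpow ((- matrix_inv (Lam l)) ** X) (n div 3)) / of_nat (n div 3) else 0)" for X
      by (simp add: kp_interaction_nth neg)
    have c3: "continuous_on UNIV (\<lambda>X::complex^'n^'n. trace (matpow X 3))"
      using continuous_matpow[of "mat 1" 3] by simp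
    show ?thesis
      unfolding e divide_inverse
      by (intro cont_if continuous_on_add continuous_on_mult continuous_on_minus continuous_on_const
            continuous_matpow c3)
  qed
  have cont_pow: "continuous_on UNIV (\<lambda>X. fps_nth (fps_nth (kp_interaction l X ^ k) n) q)"
    for l :: "real^'n" and k n q
  proof (induction k arbitrary: n q)
    case (Suc k)
    thus ?case unfolding power_Suc by (intro cont_mult cont_int)
  qed simp
  have cont_F: "continuous_on UNIV (\<lambda>X. F l X n q)" for l n q
    unfolding F_def fps_compose_nth fps_sum_nth fps_mult_nth
    by (intro continuous_intros cont_pow)
  have cont_g: "continuous_on UNIV (gauss_density l)" for l :: "real^'n"
  proof -
    have "continuous_on UNIV (\<lambda>X::complex^'n^'n. trace (matpow X 2 ** Lam l))"
      unfolding trace_def matrix_matrix_mult_def by (simp add: numeral_2_eq_2 matrix_matrix_mult_def mat_def)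
        (intro continuous_intros)
    thus ?thesis unfolding gauss_density_def by (intro continuous_intros) auto
  qed
  have dens: "gauss_density (s\<^sup>2 *\<^sub>R lam) (inverse s *\<^sub>R X) = gauss_density lam X" for X
    using s by (simp add: gauss_density_def matpow_scaleR Lam_scaleR matrix_mult_scaleR_left
      matrix_mult_scaleR_right power_mult_distrib[symmetric])
  define D where "D = inverse s ^ DIM(real^'n^'n)"
  have D: "D > 0" using s by (simp add: D_def)
  have change: "(\<integral>X. f X \<partial>hermitian_lborel) = of_real D * (\<integral>X. f (inverse s *\<^sub>R X) \<partial>hermitian_lborel)"
    if f: "continuous_on UNIV f" for f :: "complex^'n^'n \<Rightarrow> complex"
  proof -
    have fs: "continuous_on UNIV (\<lambda>X. f (inverse s *\<^sub>R X))"
      by (intro continuous_on_compose2[OF f] continuous_intros) auto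
    have ch: "continuous_on UNIV (herm :: real^'n^'n \<Rightarrow> _)"
      using linear_herm by (rule linear_continuous_on[OF linear_conv_bounded_linear[THEN iffD1]])
    have fh: "(\<lambda>M. f (herm M)) \<in> borel_measurable borel"
      by (intro borel_measurable_continuous_onI continuous_on_compose2[OF f] ch) auto
    have "(\<integral>M. f (herm M) \<partial>lborel) = of_real D * (\<integral>M. f (herm (inverse s *\<^sub>R M)) \<partial>lborel)"
      using s fh
      by (subst lborel_affine[of "inverse s" 0])
        (simp_all add: integral_density integral_distr D_def scaleR_conv_of_real[where 'a=complex])
    thus ?thesis
      by (simp add: integral_hermitian_lborel f fs linear_scale[OF linear_herm])
  qed
  have "gauss_mean (s\<^sup>2 *\<^sub>R lam) (\<lambda>X. F (s\<^sup>2 *\<^sub>R lam) X n q) = r ^ n * gauss_mean lam (\<lambda>X. F lam X n q)" for q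
    unfolding gauss_mean_def
    by (subst change, (intro continuous_intros cont_F cont_g), subst change, (intro cont_g))
      (use D in \<open>simp add: F dens mult.assoc\<close>)
  thus ?thesis
    by (simp add: fps_eq_iff kp_tau_def F_def r_def)
qed

end

theory Submission
  imports Defs "HOL-Probability.Probability"
begin

text \<open>By orbit counting, the sum over isomorphism classes of graphs with \<open>n = 3m\<close> half-edges is \<open>1/n!\<close>
  times a sum over graphs with half-edges \<open>{0, \<dots>, n - 1}\<close>.  In a trivalent graph every vertex carries at
  most one boundary half-edge, and contracting the boundaries turns a boundary of length \<open>k\<close> into a
  vertex of the kind produced by \<open>Tr (-\<Lambda>\<^sup>-\<^sup>1 X)\<^sup>k\<close>, the edges around it accounting for the factors
  \<open>\<Lambda>\<^sup>-\<^sup>1\<close>.  Hence for fixed \<open>\<sigma>\<^sub>0\<close> and fixed boundary half-edges \<open>B\<close> the sum over the pairings of the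
  remaining half-edges is, by Wick's theorem, the expectation of a product of matrix entries; the sum
  over colourings multiplies these to traces; and the sum over the permutations that \<open>\<sigma>\<^sub>2\<close> induces on \<open>B\<close>
  is a coefficient of \<open>exp (\<Sum>\<^sub>k Q/k Tr (-\<Lambda>\<^sup>-\<^sup>1 X)\<^sup>k)\<close> by the exponential formula.  There are
  \<open>n!/(3\<^sup>m m!)\<close> choices of \<open>\<sigma>\<^sub>0\<close> and \<open>3\<^sup>a (m choose a)\<close> sets \<open>B\<close> of size \<open>a\<close>, which
  yields the coefficients of \<open>exp (- Tr X\<^sup>3/6)\<close>.  The signs cancel because the number of half-edges is even.\<close>

section \<open>Cycles of permutations\<close>

text \<open>The grading aligns the two sides. A cubic trace carries \<open>z\<close> to the power 3,
  one for each half-edge of a vertex; a trace of length k carries \<open>z\<close> to the power 3k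
  because it absorbs the k vertices around a boundary. So the coefficient of \<open>z\<close> to the
  n collects the graphs with n half-edges, a finite sum. The powers of 2 match as follows. With m
  vertices, a of them on boundaries, and r internal edges there are r + a edges, and 2^(r + a - m)
  is 2^r (1/2)^(m - a). The covariances 2/(lambda_i + lambda_j) supply 2^r; the 1/2 left over at
  each vertex off the boundary joins the 1/3 of the count of 3-cycles to give the 1/6 of the cubic
  term. Both the exponential formula and Wick's theorem are proved as uniqueness statements for
  recursions: one point is removed from a cycle, or one pair from a pairing. The entries of a
  Hermitian matrix are dependent, so Wick's theorem is first shown for independent real coordinates
  and then carried over by bilinearity.\<close>

text \<open>The composite splices \<open>a\<close> into the cycle of \<open>b\<close>, just before
  \<open>b\<close>: the point that \<open>q\<close> sends to \<open>b\<close> now goes to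
  \<open>a\<close>, and \<open>a\<close> goes to \<open>b\<close>.\<close>

lemma orbit_transpose_insert:
  assumes q: "q permutes S" and fin: "finite S" and a: "a \<notin> S" and b: "b \<in> S"
  shows "orbit (Transposition.transpose a b \<circ> q) a = insert a (orbit q b)"
proof -
  let ?q = "Transposition.transpose a b \<circ> q"
  have qa: "q a = a" using q a by (simp add: permutes_not_in)
  have perm: "permutation q" using q fin by (auto simp: permutation_permutes)
  have perm': "permutation ?q"
    using perm by (simp add: permutation_compose permutation_swap_id)
  have ab: "?q a = b" by (simp add: qa)
  have bin: "b \<in> orbit q b" using perm by (rule permutation_self_in_orbit)
  have S: "orbit q b \<subseteq> S" using q b by (rule permutes_orbit_subset)
  show ?thesis
  proof (intro equalityI subsetI)
    fix x assume "x \<in> orbit ?q a"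
    thus "x \<in> insert a (orbit q b)"
    proof induction
      case base
      show ?case using ab bin by simp
    next
      case (step y)
      show ?case
      proof (cases "y = a")
        case True thus ?thesis using ab bin by simp
      next
        case False
        hence y: "y \<in> orbit q b" using step by simp
        hence "q y \<in> orbit q b" by (rule orbit.step)
        thus ?thesis using S a by (auto simp: Transposition.transpose_def)
      qed
    qed
  next
    fix x assume x: "x \<in> insert a (orbit q b)"
    have aa: "a \<in> orbit ?q a" using perm' by (rule permutation_self_in_orbit)
    have bb: "b \<in> orbit ?q a" using ab by (metis orbit.base)
    have step: "q y \<in> orbit ?q a" if "y \<in> orbit ?q a" for y
    proof (cases "q y = b \<or> q y = a")
      case True thus ?thesis using aa bb by auto
    next
      case False
      hence "?q y = q y" by (simp add: Transposition.transpose_def)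
      thus ?thesis using that by (metis orbit.step)
    qed
    have "x \<in> orbit ?q a" if "x \<in> orbit q b"
      using that
    proof induction
      case base
      show ?case by (rule step[OF bb])
    next
      case (step y)
      show ?case by (rule \<open>\<And>y. y \<in> orbit ?q a \<Longrightarrow> q y \<in> orbit ?q a\<close>[OF step(2)])
    qed
    thus "x \<in> orbit ?q a" using x aa by auto
  qed
qed

lemma orbit_cong_on:
  assumes "x \<in> A" "\<And>y. y \<in> A \<Longrightarrow> f y = g y" "\<And>y. y \<in> A \<Longrightarrow> f y \<in> A"
  shows "orbit f x = orbit g x"
proof -
  have 1: "y \<in> orbit g x \<and> y \<in> A" if "y \<in> orbit f x" for y
    using that
  proof induction
    case base
    show ?case using assms orbit.base[of g x] by auto
  next
    case (step y)
    thus ?case using assms orbit.step[of y g x] by auto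
  qed
  have 2: "y \<in> orbit f x \<and> y \<in> A" if "y \<in> orbit g x" for y
    using that
  proof induction
    case base
    show ?case using assms orbit.base[of f x] by auto
  next
    case (step y)
    thus ?case using assms orbit.step[of y f x] by auto
  qed
  show ?thesis using 1 2 by blast
qed

lemma orbit_transpose_other:
  assumes q: "q permutes S" and fin: "finite S" and a: "a \<notin> S" and x: "x \<in> S" "x \<notin> orbit q b"
  shows "orbit (Transposition.transpose a b \<circ> q) x = orbit q x"
proof (rule orbit_cong_on[where A = "orbit q x", symmetric])
  have perm: "permutation q" using q fin by (auto simp: permutation_permutes)
  show "x \<in> orbit q x" using perm by (rule permutation_self_in_orbit)
  have S: "orbit q x \<subseteq> S" using q x(1) by (rule permutes_orbit_subset)
  have nb: "b \<notin> orbit q x"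
    using x(2) perm by (metis orbit_swap permutation_self_in_orbit)
  fix y assume y: "y \<in> orbit q x"
  show qy: "q y \<in> orbit q x" using y by (rule orbit.step)
  show "q y = (Transposition.transpose a b \<circ> q) y" using qy nb S a by (auto simp: Transposition.transpose_def)
qed

lemma permutation_orbit_eq:
  assumes "permutation q" "y \<in> orbit q x"
  shows "orbit q y = orbit q x"
  by (rule orbit_cyclic_eq3[OF cyclic_on_orbit'[OF assms(1)] assms(2)])

lemma cycles_on_partition:
  assumes "q permutes S" "finite S"
  shows "\<Union>(cycles_on q S) = S" "C \<in> cycles_on q S \<Longrightarrow> x \<in> C \<Longrightarrow> C = orbit q x"
    "finite (cycles_on q S)"
proof -
  have perm: "permutation q" using assms by (auto simp: permutation_permutes)
  show "\<Union>(cycles_on q S) = S"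
    unfolding cycles_on_def
    using permutes_orbit_subset[OF assms(1)] permutation_self_in_orbit[OF perm] by blast
  show "C = orbit q x" if "C \<in> cycles_on q S" "x \<in> C"
  proof -
    obtain y where "C = orbit q y" using \<open>C \<in> cycles_on q S\<close> unfolding cycles_on_def by blast
    thus ?thesis using that(2) permutation_orbit_eq[OF perm] by simp
  qed
  show "finite (cycles_on q S)" using assms(2) by (simp add: cycles_on_def)
qed

text \<open>Every permutation of \<open>insert a S\<close> is uniquely of the form
  \<open>transpose a b \<circ> q\<close> with \<open>b\<close> in \<open>insert a S\<close> and
  \<open>q\<close> a permutation of \<open>S\<close>. Together with the case \<open>b = a\<close>,
  where \<open>a\<close> is a cycle of its own, this drives all inductions over permutations
  below.\<close>

lemma cycles_on_transpose_insert:
  assumes q: "q permutes S" and fin: "finite S" and a: "a \<notin> S" and b: "b \<in> S"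
  shows "cycles_on (Transposition.transpose a b \<circ> q) (insert a S)
    = insert (insert a (orbit q b)) (cycles_on q S - {orbit q b})"
proof -
  let ?q = "Transposition.transpose a b \<circ> q"
  have perm: "permutation q" using q fin by (auto simp: permutation_permutes)
  have perm': "permutation ?q"
    using perm by (simp add: permutation_compose permutation_swap_id)
  have oa: "orbit ?q a = insert a (orbit q b)" by (rule orbit_transpose_insert[OF assms])
  have ob: "orbit ?q x = insert a (orbit q b)" if "x \<in> orbit q b" for x
    using that oa permutation_orbit_eq[OF perm', of x a] by simp
  have oc: "orbit ?q x = orbit q x" if "x \<in> S" "x \<notin> orbit q b" for x
    by (rule orbit_transpose_other[OF q fin a that])
  have od: "orbit q x = orbit q b \<longleftrightarrow> x \<in> orbit q b" for x
    using permutation_orbit_eq[OF perm, of x b] permutation_self_in_orbit[OF perm, of x] by auto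
  have "orbit ?q ` S - {insert a (orbit q b)} = orbit q ` S - {orbit q b}"
  proof (intro equalityI subsetI)
    fix C assume "C \<in> orbit ?q ` S - {insert a (orbit q b)}"
    then obtain x where x: "x \<in> S" "C = orbit ?q x" "C \<noteq> insert a (orbit q b)" by blast
    hence n: "x \<notin> orbit q b" using ob by blast
    thus "C \<in> orbit q ` S - {orbit q b}" using x oc[OF x(1) n] od by auto
  next
    fix C assume "C \<in> orbit q ` S - {orbit q b}"
    then obtain x where x: "x \<in> S" "C = orbit q x" "C \<noteq> orbit q b" by blast
    hence n: "x \<notin> orbit q b" using od by blast
    have "a \<notin> orbit q x" using permutes_orbit_subset[OF q x(1)] a by blast
    thus "C \<in> orbit ?q ` S - {insert a (orbit q b)}" using x oc[OF x(1) n] by auto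
  qed
  thus ?thesis unfolding cycles_on_def image_insert oa by blast
qed

lemma cycles_on_insert_fixed:
  assumes "q permutes S" "a \<notin> S"
  shows "cycles_on q (insert a S) = insert {a} (cycles_on q S)"
proof -
  have "q a = a" using assms by (simp add: permutes_not_in)
  hence "orbit q a = {a}" by (simp add: orbit_eq_singleton_iff)
  thus ?thesis by (simp add: cycles_on_def)
qed

lemma prod_cycles_transpose_insert:
  fixes w :: "'h set \<Rightarrow> 'r::comm_monoid_mult"
  assumes q: "q permutes S" and fin: "finite S" and a: "a \<notin> S" and b: "b \<in> S"
  shows "(\<Prod>C\<in>cycles_on (Transposition.transpose a b \<circ> q) (insert a S). w C)
    = w (insert a (orbit q b)) * (\<Prod>C\<in>cycles_on q S - {orbit q b}. w C)"
proof -
  have "insert a (orbit q b) \<notin> cycles_on q S - {orbit q b}"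
    using cycles_on_partition(1)[OF q fin] a by blast
  thus ?thesis
    unfolding cycles_on_transpose_insert[OF assms]
    by (simp add: cycles_on_partition(3)[OF q fin])
qed

lemma prod_cycles_insert_fixed:
  fixes w :: "'h set \<Rightarrow> 'r::comm_monoid_mult"
  assumes q: "q permutes S" and fin: "finite S" and a: "a \<notin> S"
  shows "(\<Prod>C\<in>cycles_on q (insert a S). w C) = w {a} * (\<Prod>C\<in>cycles_on q S. w C)"
proof -
  have "{a} \<notin> cycles_on q S"
    using cycles_on_partition(1)[OF q fin] a by blast
  thus ?thesis
    unfolding cycles_on_insert_fixed[OF q a]
    by (simp add: cycles_on_partition(3)[OF q fin])
qed

lemma prod_cycles_remove:
  fixes w :: "'h set \<Rightarrow> 'r::comm_monoid_mult"
  assumes "q permutes S" "finite S" "b \<in> S"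
  shows "(\<Prod>C\<in>cycles_on q S. w C) = w (orbit q b) * (\<Prod>C\<in>cycles_on q S - {orbit q b}. w C)"
  using assms cycles_on_partition(3) by (intro prod.remove) (auto simp: cycles_on_def)

section \<open>The exponential formula\<close>

text \<open>This is \<open>fact (card S)\<close> times the cycle index of the symmetric group on
  \<open>S\<close>, with \<open>f k\<close> substituted for the variable of the k-cycles.\<close>

definition cycle_sum :: "(nat \<Rightarrow> 'r::comm_ring_1) \<Rightarrow> 'h set \<Rightarrow> 'r" where
  "cycle_sum f S = (\<Sum>p | p permutes S. \<Prod>C\<in>cycles_on p S. f (card C))"

lemma card_orbit_insert:
  assumes "q permutes S" "finite S" "a \<notin> S" "b \<in> S"
  shows "card (insert a (orbit q b)) = Suc (card (orbit q b))"
proof -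
  have "orbit q b \<subseteq> S" using assms permutes_orbit_subset by metis
  thus ?thesis using assms by (metis card_insert_disjoint finite_subset subsetD)
qed

text \<open>The shift \<open>j\<close> remembers how many points have been removed from the marked cycle, which turns
  the removal of the marked point into a recursion.\<close>

definition marked_cycle_sum :: "(nat \<Rightarrow> 'r::comm_ring_1) \<Rightarrow> nat \<Rightarrow> 'h \<Rightarrow> 'h set \<Rightarrow> 'r" where
  "marked_cycle_sum f j a S =
     (\<Sum>p | p permutes S. f (card (orbit p a) + j) * (\<Prod>C\<in>cycles_on p S - {orbit p a}. f (card C)))"

lemma marked_cycle_sum_0:
  assumes "finite S" "a \<in> S"
  shows "marked_cycle_sum f 0 a S = cycle_sum f S"
  unfolding marked_cycle_sum_def cycle_sum_def
  by (intro sum.cong refl) (use assms in \<open>simp add: prod_cycles_remove[of _ S a]\<close>)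

text \<open>Either \<open>a\<close> is a fixed point, or deleting it shortens its cycle by one and
  passes the mark to its image \<open>b\<close>; the raised shift keeps the weight that of the
  original cycle.\<close>

lemma marked_cycle_sum_insert:
  assumes fin: "finite S" and a: "a \<notin> S"
  shows "marked_cycle_sum f j a (insert a S)
    = f (Suc j) * cycle_sum f S + (\<Sum>b\<in>S. marked_cycle_sum f (Suc j) b S)"
proof -
  let ?g = "\<lambda>p. f (card (orbit p a) + j) * (\<Prod>C\<in>cycles_on p (insert a S) - {orbit p a}. f (card C))"
  have 1: "?g (Transposition.transpose a a \<circ> q) = f (Suc j) * (\<Prod>C\<in>cycles_on q S. f (card C))" if q: "q permutes S" for q
  proof -
    have "q a = a" using q a by (simp add: permutes_not_in)
    hence o: "orbit q a = {a}" by (simp add: orbit_eq_singleton_iff)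
    have "{a} \<notin> cycles_on q S" using cycles_on_partition(1)[OF q fin] a by blast
    thus ?thesis by (simp add: cycles_on_insert_fixed[OF q a] o)
  qed
  have 2: "?g (Transposition.transpose a b \<circ> q)
      = f (card (orbit q b) + Suc j) * (\<Prod>C\<in>cycles_on q S - {orbit q b}. f (card C))"
    if q: "q permutes S" and b: "b \<in> S" for q b
  proof -
    have "insert a (orbit q b) \<notin> cycles_on q S - {orbit q b}"
      using cycles_on_partition(1)[OF q fin] a by blast
    thus ?thesis
      by (simp add: cycles_on_transpose_insert[OF q fin a b] orbit_transpose_insert[OF q fin a b]
          card_orbit_insert[OF q fin a b] del: o_apply)
  qed
  have "marked_cycle_sum f j a (insert a S) = (\<Sum>b\<in>insert a S. \<Sum>q | q permutes S. ?g (Transposition.transpose a b \<circ> q))"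
    unfolding marked_cycle_sum_def by (rule sum_over_permutations_insert[OF fin a])
  also have "\<dots> = (\<Sum>q | q permutes S. ?g (Transposition.transpose a a \<circ> q)) + (\<Sum>b\<in>S. \<Sum>q | q permutes S. ?g (Transposition.transpose a b \<circ> q))"
    using fin a by (rule sum.insert)
  also have "(\<Sum>q | q permutes S. ?g (Transposition.transpose a a \<circ> q)) = f (Suc j) * cycle_sum f S"
    unfolding cycle_sum_def sum_distrib_left by (intro sum.cong refl 1) simp
  also have "(\<Sum>b\<in>S. \<Sum>q | q permutes S. ?g (Transposition.transpose a b \<circ> q)) = (\<Sum>b\<in>S. marked_cycle_sum f (Suc j) b S)"
    unfolding marked_cycle_sum_def by (intro sum.cong refl 2) auto
  finally show ?thesis .
qed

lemma cycle_sum_empty [simp]: "cycle_sum f {} = 1"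
  by (simp add: cycle_sum_def cycles_on_def)

text \<open>The recursion for the marked sum involves both kinds of sum on the smaller set, so both
  statements are carried through one induction on the size. All marked points of a set contribute
  equally by the induction hypothesis, which reduces each sum over them to a multiple of one
  term.\<close>

lemma marked_cycle_sum_card:
  fixes S :: "'h set" and T :: "'k set"
  assumes "finite S" "finite T" "card S = card T" "a \<in> S" "b \<in> T"
  shows "marked_cycle_sum f j a S = marked_cycle_sum f j b T \<and> cycle_sum f S = cycle_sum f T"
  using assms
proof (induction "card S" arbitrary: S T a b j)
  case 0 thus ?case by auto
next
  case (Suc n)
  have rec: "cycle_sum f (S - {a}) = cycle_sum f (T - {b}) \<and>
    (\<forall>x\<in>S - {a}. \<forall>y\<in>T - {b}. \<forall>j. marked_cycle_sum f j x (S - {a}) = marked_cycle_sum f j y (T - {b}))"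
  proof (cases "n = 0")
    case True
    hence e: "S - {a} = {}" "T - {b} = {}"
      using Suc.hyps(2) Suc.prems by (metis One_nat_def card_1_singletonE Diff_cancel singletonD)+
    show ?thesis unfolding e by simp
  next
    case False
    have c: "n = card (S - {a})" "card (S - {a}) = card (T - {b})"
      using Suc.hyps(2) Suc.prems by auto
    with False obtain x0 y0 where xy: "x0 \<in> S - {a}" "y0 \<in> T - {b}" by (metis card.empty equals0I)
    show ?thesis
      using Suc.hyps(1)[OF c(1) _ _ c(2)] Suc.prems(1,2) xy by blast
  qed
  have eq: "marked_cycle_sum f j a S = marked_cycle_sum f j b T" for j
  proof -
    have "(\<Sum>x\<in>S - {a}. marked_cycle_sum f (Suc j) x (S - {a}))
        = (\<Sum>y\<in>T - {b}. marked_cycle_sum f (Suc j) y (T - {b}))"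
    proof (cases "S - {a} = {}")
      case True
      hence T: "T - {b} = {}" using Suc.prems by (metis card_Diff_singleton card_0_eq finite_Diff)
      show ?thesis unfolding True T by simp
    next
      case False
      then obtain x0 where x0: "x0 \<in> S - {a}" by blast
      have c: "card (S - {a}) = card (T - {b})" using Suc.prems by simp
      then obtain y0 where y0: "y0 \<in> T - {b}" using x0 Suc.prems
        by (metis card_0_eq emptyE equals0I finite_Diff)
      define w where "w = marked_cycle_sum f (Suc j) x0 (S - {a})"
      have w: "marked_cycle_sum f (Suc j) y (T - {b}) = w" if "y \<in> T - {b}" for y
        using rec x0 that unfolding w_def by simp
      have w': "marked_cycle_sum f (Suc j) x (S - {a}) = w" if "x \<in> S - {a}" for x
        using rec y0 that w[OF y0] by simp
      have "(\<Sum>x\<in>S - {a}. marked_cycle_sum f (Suc j) x (S - {a})) = of_nat (card (S - {a})) * w"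
        by (subst sum.cong[OF refl w']) simp_all
      also have "\<dots> = (\<Sum>y\<in>T - {b}. marked_cycle_sum f (Suc j) y (T - {b}))"
        by (subst sum.cong[OF refl w]) (simp_all add: c)
      finally show ?thesis .
    qed
    thus ?thesis
      using marked_cycle_sum_insert[of "S - {a}" a f j] marked_cycle_sum_insert[of "T - {b}" b f j]
        Suc.prems rec by (simp add: insert_absorb)
  qed
  show ?case using eq[of j] eq[of 0] Suc.prems by (simp add: marked_cycle_sum_0)
qed

lemma cycle_sum_card:
  assumes "finite S" "finite T" "card S = card T"
  shows "cycle_sum f S = cycle_sum f T"
proof (cases "S = {}")
  case True thus ?thesis using assms by auto
next
  case False
  then obtain a b where "a \<in> S" "b \<in> T" using assms by (metis card_0_eq equals0I)
  thus ?thesis using marked_cycle_sum_card[OF assms] by blast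
qed


text \<open>The index \<open>i\<close> is the number of points other than \<open>a\<close> in the
  cycle of \<open>a\<close>. With n = \<open>card S\<close> there are n!/(n - i)! ways to arrange
  them after \<open>a\<close>, and (n - i)! \<open>D (n - i)\<close> sums over the permutations of
  the rest; the factorials of n - i cancel.\<close>

lemma marked_cycle_sum_eq:
  fixes f :: "nat \<Rightarrow> 'r::{comm_ring_1,semiring_char_0}"
  assumes D: "\<And>k. fact k * D k = cycle_sum f {..<k}"
  assumes "finite S" "a \<notin> S"
  shows "marked_cycle_sum f j a (insert a S) = fact (card S) * (\<Sum>i\<le>card S. f (Suc (i + j)) * D (card S - i))"
  using assms(2,3)
proof (induction "card S" arbitrary: S a j)
  case 0
  hence "S = {}" by simp
  thus ?case using D[of 0] by (simp add: marked_cycle_sum_insert)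
next
  case (Suc n)
  have m: "marked_cycle_sum f (Suc j) b S = fact n * (\<Sum>i\<le>n. f (Suc (i + Suc j)) * D (n - i))" if "b \<in> S" for b
  proof -
    have "n = card (S - {b})" using Suc that by simp
    from Suc.hyps(1)[OF this, of b] that Suc.prems show ?thesis
      using \<open>n = card (S - {b})\<close>[symmetric] by (simp add: insert_absorb)
  qed
  have c: "cycle_sum f S = fact (Suc n) * D (Suc n)"
    unfolding D using Suc by (intro cycle_sum_card) auto
  have "marked_cycle_sum f j a (insert a S)
      = f (Suc j) * (fact (Suc n) * D (Suc n)) + of_nat (Suc n) * (fact n * (\<Sum>i\<le>n. f (Suc (i + Suc j)) * D (n - i)))"
    using Suc.prems Suc.hyps(2) by (simp add: marked_cycle_sum_insert m c)
  also have "\<dots> = fact (Suc n) * (f (Suc j) * D (Suc n) + (\<Sum>i\<le>n. f (Suc (i + Suc j)) * D (n - i)))"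
    by (simp only: fact_Suc of_nat_mult algebra_simps)
  also have "f (Suc j) * D (Suc n) + (\<Sum>i\<le>n. f (Suc (i + Suc j)) * D (n - i))
      = (\<Sum>i\<le>Suc n. f (Suc (i + j)) * D (Suc n - i))"
    by (subst sum.atMost_Suc_shift) simp
  finally show ?case using Suc.hyps(2) by simp
qed

section \<open>The exponential of a power series as the solution of a linear differential
  equation\<close>

lemma fps_const_div_mult: "n > 0 \<Longrightarrow> of_nat n * fps_const (1 / of_nat n :: complex) = 1"
  by (simp add: fps_of_nat[symmetric] fps_const_mult del: fps_of_nat)

definition cycle_exp :: "(nat \<Rightarrow> complex fps) \<Rightarrow> complex fps fps" where
  "cycle_exp f = Abs_fps (\<lambda>n. fps_const (1 / fact n) * cycle_sum f {..<n})"

lemma fact_mult_cycle_exp: "fact n * fps_nth (cycle_exp f) n = cycle_sum f {..<n}"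
proof -
  have "fact n * fps_const (1 / fact n :: complex) = 1"
    using fps_const_div_mult[of "fact n"] by simp
  thus ?thesis by (simp add: cycle_exp_def mult.assoc[symmetric])
qed

text \<open>Read as an identity of coefficients, this is D' = S' D for S with coefficients
  \<open>f k\<close> / k, since differentiation cancels the 1/k. Combinatorially it sorts
  permutations by the cycle through one point.\<close>

lemma cycle_exp_Suc:
  "of_nat (Suc n) * fps_nth (cycle_exp f) (Suc n) = (\<Sum>i\<le>n. f (Suc i) * fps_nth (cycle_exp f) (n - i))"
proof -
  have "fact n * (of_nat (Suc n) * fps_nth (cycle_exp f) (Suc n)) = cycle_sum f {..<Suc n}"
    unfolding fact_mult_cycle_exp[symmetric] by (simp add: mult_ac)
  also have "\<dots> = marked_cycle_sum f 0 n {..<Suc n}"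
    by (simp add: marked_cycle_sum_0)
  also have "\<dots> = fact n * (\<Sum>i\<le>n. f (Suc i) * fps_nth (cycle_exp f) (n - i))"
    using marked_cycle_sum_eq[OF fact_mult_cycle_exp, of "{..<n}" n f 0] by (simp add: lessThan_Suc)
  finally show ?thesis by (metis fact_nonzero mult_left_cancel)
qed

text \<open>The equation determines (n + 1) times each coefficient from the earlier ones. The
  coefficients will themselves be power series in Q, which do not form a field, so n + 1 is
  cancelled in an integral domain of characteristic zero instead of being inverted.\<close>

lemma fps_exp_ode_unique:
  fixes D E S :: "'a::{idom,semiring_char_0} fps"
  assumes "fps_nth D 0 = fps_nth E 0" "fps_deriv D = fps_deriv S * D" "fps_deriv E = fps_deriv S * E"
  shows "D = E"
proof (rule fps_ext)
  fix n show "fps_nth D n = fps_nth E n"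
  proof (induction n rule: less_induct)
    case (less n)
    show ?case
    proof (cases n)
      case 0 thus ?thesis using assms(1) by simp
    next
      case (Suc m)
      have r: "of_nat (m + 1) * fps_nth F (m + 1) = (\<Sum>i=0..m. fps_nth (fps_deriv S) i * fps_nth F (m - i))"
        if "fps_deriv F = fps_deriv S * F" for F
        using arg_cong[OF that, of "\<lambda>G. fps_nth G m"] by (simp add: fps_mult_nth)
      have "of_nat (m + 1) * fps_nth D (m + 1) = of_nat (m + 1) * fps_nth E (m + 1)"
        unfolding r[OF assms(2)] r[OF assms(3)] by (intro sum.cong refl) (simp add: less Suc)
      hence "fps_nth D (m + 1) = fps_nth E (m + 1)"
        by (metis mult_left_cancel of_nat_neq_0 Suc_eq_plus1)
      thus ?thesis by (simp add: Suc)
    qed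
  qed
qed

lemma exp_series_compose_deriv:
  assumes "fps_nth S 0 = 0"
  shows "fps_deriv (exp_series oo S) = fps_deriv S * (exp_series oo S)"
proof -
  have "fps_deriv exp_series = exp_series"
  proof (rule fps_ext)
    fix n
    have "of_nat (Suc n) * fps_const (1 / fact (Suc n) :: complex) = fps_const (1 / fact n)"
      by (simp add: fps_of_nat[symmetric] fps_const_mult del: fps_of_nat of_nat_Suc)
    thus "fps_nth (fps_deriv exp_series) n = fps_nth exp_series n" by (simp add: exp_series_def)
  qed
  thus ?thesis using fps_compose_deriv[OF assms, of exp_series] by (simp add: mult.commute)
qed

text \<open>Both sides have constant term 1 and logarithmic derivative S' + T'.\<close>

lemma exp_series_compose_add:
  assumes "fps_nth S 0 = 0" "fps_nth T 0 = 0"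
  shows "exp_series oo (S + T) = (exp_series oo S) * (exp_series oo T)"
proof (rule fps_exp_ode_unique[where S = "S + T"])
  show "fps_deriv ((exp_series oo S) * (exp_series oo T))
      = fps_deriv (S + T) * ((exp_series oo S) * (exp_series oo T))"
    by (simp add: exp_series_compose_deriv assms algebra_simps)
  show "fps_deriv (exp_series oo (S + T)) = fps_deriv (S + T) * (exp_series oo (S + T))"
    by (rule exp_series_compose_deriv) (simp add: assms)
qed (simp add: exp_series_def)

lemma exponential_formula:
  "exp_series oo Abs_fps (\<lambda>k. f k * fps_const (1 / of_nat k)) = cycle_exp f"
proof -
  let ?S = "Abs_fps (\<lambda>k. f k * fps_const (1 / of_nat k))"
  \<comment> \<open>Division by \<open>of_nat 0\<close> yields 0, so the constant term vanishes
    whatever \<open>f 0\<close> is.\<close>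
  have S0: "fps_nth ?S 0 = 0" by simp
  have dS: "fps_nth (fps_deriv ?S) i = f (Suc i)" for i
    using fps_const_div_mult[of "Suc i"] by (simp add: mult.left_commute)
  have "fps_deriv (cycle_exp f) = fps_deriv ?S * cycle_exp f"
  proof (rule fps_ext)
    fix n
    show "fps_nth (fps_deriv (cycle_exp f)) n = fps_nth (fps_deriv ?S * cycle_exp f) n"
      unfolding fps_mult_nth dS using cycle_exp_Suc[of n f] by (simp add: atLeast0AtMost)
  qed
  thus ?thesis
    by (intro fps_exp_ode_unique[OF _ exp_series_compose_deriv[OF S0]])
      (simp_all add: exp_series_def cycle_exp_def)
qed

lemma fps_nth_compose_X_power:
  fixes a :: "'a::comm_ring_1 fps"
  assumes "k > 0"
  shows "fps_nth (a oo fps_X ^ k) n = (if k dvd n then fps_nth a (n div k) else 0)"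
proof -
  have "fps_nth (a oo fps_X ^ k) n = (\<Sum>i=0..n. if n = k * i then fps_nth a i else 0)"
    unfolding fps_compose_nth power_mult[symmetric] fps_X_power_nth by (intro sum.cong) auto
  also have "\<dots> = (if k dvd n then fps_nth a (n div k) else 0)"
  proof (cases "k dvd n")
    case True
    then obtain l where l: "n = k * l" by blast
    have "(\<Sum>i=0..n. if n = k * i then fps_nth a i else 0) = (\<Sum>i=0..n. if i = l then fps_nth a i else 0)"
      using l assms by (intro sum.cong) auto
    thus ?thesis using l assms by simp
  next
    case False
    hence "n \<noteq> k * i" for i by auto
    thus ?thesis using False by simp
  qed
  finally show ?thesis .
qed

lemma exp_series_compose_monomial:
  "exp_series oo (fps_const c * fps_X) = Abs_fps (\<lambda>n. fps_const (1 / fact n) * c ^ n)"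
  unfolding fps_compose_linear by (simp add: exp_series_def mult.commute)

lemma exp_series_compose_assoc:
  assumes "fps_nth S 0 = 0"
  shows "exp_series oo (S oo fps_X ^ 3) = (exp_series oo S) oo fps_X ^ 3"
  by (rule fps_compose_assoc) (use assms in auto)

section \<open>Counting permutations whose cycles all have length three\<close>

definition three_perms :: "'h set \<Rightarrow> ('h \<Rightarrow> 'h) set" where
  "three_perms S = {p. p permutes S \<and> (\<forall>C\<in>cycles_on p S. card C = 3)}"

text \<open>The exponential formula does the counting: with weight 1 on cycles of length 3 and 0 on
  all others, the cycle sum is the number of these permutations, and the series is exp(x^3/3), whose
  coefficient at x^(3m) is 1/(3^m m!).\<close>

lemma card_three_perms:
  assumes "finite S" "card S = 3 * m"
  shows "of_nat (card (three_perms S)) * 3 ^ m * fact m = (fact (3 * m) :: complex)"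
proof -
  define f :: "nat \<Rightarrow> complex fps" where "f = (\<lambda>k. if k = 3 then 1 else 0)"
  have "(\<Prod>C\<in>cycles_on p S. f (card C)) = (if p \<in> three_perms S then 1 else 0)" if "p permutes S" for p
    using that assms cycles_on_partition(3)[OF that assms(1)]
    by (auto simp: f_def three_perms_def intro: prod.neutral)
  hence "cycle_sum f S = (\<Sum>p | p permutes S. if p \<in> three_perms S then 1 else 0)"
    unfolding cycle_sum_def by (intro sum.cong) auto
  also have "\<dots> = of_nat (card (three_perms S))"
    using finite_permutations[OF assms(1)]
    by (subst sum.inter_filter[symmetric]) (auto simp: three_perms_def intro!: arg_cong[where f = card])
  finally have 1: "cycle_sum f {..<3 * m} = of_nat (card (three_perms S))"
    using cycle_sum_card[OF assms(1), of "{..<3 * m}" f] assms(2) by simp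
  have e: "Abs_fps (\<lambda>k. f k * fps_const (1 / of_nat k)) = (fps_const (fps_const (1 / 3)) * fps_X) oo fps_X ^ 3"
  proof (rule fps_ext)
    fix k :: nat
    have "(3 dvd k \<and> k div 3 = 1) \<longleftrightarrow> k = 3" by auto
    thus "fps_nth (Abs_fps (\<lambda>k. f k * fps_const (1 / of_nat k))) k
        = fps_nth ((fps_const (fps_const (1 / 3)) * fps_X) oo fps_X ^ 3) k"
      by (auto simp: f_def fps_nth_compose_X_power)
  qed
  have "cycle_exp f = (exp_series oo (fps_const (fps_const (1 / 3)) * fps_X)) oo fps_X ^ 3"
    unfolding exponential_formula[symmetric] e by (rule exp_series_compose_assoc) simp
  hence "fps_nth (cycle_exp f) (3 * m) = fps_const (1 / fact m) * fps_const (1 / 3) ^ m"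
    by (simp add: exp_series_compose_monomial fps_nth_compose_X_power)
  hence "fact (3 * m) * (fps_const (1 / fact m) * fps_const (1 / 3 :: complex) ^ m) = of_nat (card (three_perms S))"
    using fact_mult_cycle_exp[of "3 * m" f] 1 by simp
  hence "fps_nth (fact (3 * m) * (fps_const (1 / fact m) * fps_const (1 / 3 :: complex) ^ m)) 0
    = fps_nth (of_nat (card (three_perms S)) :: complex fps) 0" by (rule arg_cong)
  moreover have "(fact (3 * m) :: complex fps) = fps_const (fact (3 * m))"
    by (metis of_nat_fact fps_of_nat)
  ultimately have "fact (3 * m) * (1 / fact m * (1 / 3) ^ m) = (of_nat (card (three_perms S)) :: complex)"
    by (simp add: fps_mult_nth fps_nth_power_0 del: fps_const_power)
  thus ?thesis by (simp add: field_simps)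
qed

section \<open>Traces of matrix powers as sums over colourings\<close>

lemma matpow_add: "matpow A (j + k) = matpow A j ** matpow A k"
  by (induction j) (simp_all add: matrix_mul_assoc)

lemma sum_PiE_insert:
  fixes F :: "('a \<Rightarrow> 'b) \<Rightarrow> 'r::comm_monoid_add"
  assumes "a \<notin> S"
  shows "(\<Sum>c\<in>insert a S \<rightarrow>\<^sub>E T. F c) = (\<Sum>c\<in>S \<rightarrow>\<^sub>E T. \<Sum>y\<in>T. F (c(a := y)))"
proof -
  have "(\<Sum>c\<in>insert a S \<rightarrow>\<^sub>E T. F c) = (\<Sum>(y, c)\<in>T \<times> (S \<rightarrow>\<^sub>E T). F (c(a := y)))"
    unfolding PiE_insert_eq
    by (subst sum.reindex) (use inj_combinator[OF assms, of "\<lambda>_. T"] in \<open>auto simp: case_prod_beta o_def\<close>)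
  also have "\<dots> = (\<Sum>y\<in>T. \<Sum>c\<in>S \<rightarrow>\<^sub>E T. F (c(a := y)))"
    by (simp add: sum.cartesian_product)
  also have "\<dots> = (\<Sum>c\<in>S \<rightarrow>\<^sub>E T. \<Sum>y\<in>T. F (c(a := y)))" by (rule sum.swap)
  finally show ?thesis .
qed

text \<open>The exponents \<open>k h\<close> make the statement inductive: removing a point from a cycle merges two
  neighbouring factors \<open>A\<^sup>k\<close>.\<close>

lemma sum_colorings_trace:
  fixes A :: "'a::comm_semiring_1^'n^'n"
  assumes "finite S" "p permutes S"
  shows "(\<Sum>c\<in>S \<rightarrow>\<^sub>E UNIV. \<Prod>h\<in>S. matpow A (k h) $ c (p h) $ c h)
    = (\<Prod>C\<in>cycles_on p S. trace (matpow A (\<Sum>h\<in>C. k h)))"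
  using assms
proof (induction S arbitrary: p k rule: finite_induct)
  case empty
  thus ?case by (simp add: cycles_on_def)
next
  case (insert a S)
  note fin = \<open>finite S\<close> and a = \<open>a \<notin> S\<close>
  obtain b q where b: "b \<in> insert a S" and q: "q permutes S" and p: "p = Transposition.transpose a b \<circ> q"
  proof -
    have "p \<in> {p. p permutes insert a S}" using insert.prems by simp
    thus thesis unfolding permutes_insert using that by auto
  qed
  have qa: "q a = a" using q a by (simp add: permutes_not_in)
  have qS: "q h \<in> S" if "h \<in> S" for h using q that by (simp add: permutes_in_image)
  show ?case
  proof (cases "b = a")
    case True
    hence pq: "p = q" by (simp add: p)
    have "(\<Sum>c\<in>insert a S \<rightarrow>\<^sub>E UNIV. \<Prod>h\<in>insert a S. matpow A (k h) $ c (p h) $ c h)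
      = (\<Sum>c\<in>S \<rightarrow>\<^sub>E UNIV. \<Sum>y\<in>UNIV. matpow A (k a) $ y $ y * (\<Prod>h\<in>S. matpow A (k h) $ c (q h) $ c h))"
      unfolding sum_PiE_insert[OF a] pq
    proof (intro sum.cong refl)
      fix c :: "_ \<Rightarrow> 'n" and y
      have "(\<Prod>h\<in>S. matpow A (k h) $ (c(a := y)) (q h) $ (c(a := y)) h)
          = (\<Prod>h\<in>S. matpow A (k h) $ c (q h) $ c h)"
        using a qS by (intro prod.cong refl) auto
      thus "(\<Prod>h\<in>insert a S. matpow A (k h) $ (c(a := y)) (q h) $ (c(a := y)) h)
          = matpow A (k a) $ y $ y * (\<Prod>h\<in>S. matpow A (k h) $ c (q h) $ c h)"
        using fin a qa by simp
    qed
    also have "\<dots> = trace (matpow A (k a)) * (\<Sum>c\<in>S \<rightarrow>\<^sub>E UNIV. \<Prod>h\<in>S. matpow A (k h) $ c (q h) $ c h)"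
      by (simp add: trace_def sum_distrib_left sum_distrib_right sum.swap[of _ UNIV])
    also have "\<dots> = (\<Prod>C\<in>cycles_on p (insert a S). trace (matpow A (\<Sum>h\<in>C. k h)))"
      unfolding insert.IH[OF q] pq prod_cycles_insert_fixed[OF q fin a] by simp
    finally show ?thesis .
  next
    case False
    hence bS: "b \<in> S" using b by simp
    define h0 where "h0 = inv q b"
    have qh0: "q h0 = b" using q by (simp add: h0_def permutes_inverses)
    have h0S: "h0 \<in> S" using bS q by (metis h0_def permutes_in_image permutes_inv)
    have h0: "h0 \<in> orbit q b"
      using qh0 q fin by (metis h0_def orbit_inv_eq orbit.base permutation_permutes)
    have ph0: "p h0 = a" using qh0 by (simp add: p)
    have pa: "p a = b" using qa by (simp add: p)
    have ph: "p h = q h" if "h \<in> S" "h \<noteq> h0" for h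
    proof -
      have "q h \<noteq> b" using that qh0 q by (metis permutes_inj injD)
      moreover have "q h \<noteq> a" using that qS a by blast
      ultimately show ?thesis by (simp add: p Transposition.transpose_def)
    qed
    \<comment> \<open>In \<open>p\<close> the point \<open>a\<close> sits between \<open>h0\<close>
      and \<open>b\<close>. Summing over its colour \<open>y\<close> is the matrix product of the
      two factors that meet there, so \<open>h0\<close> takes over both exponents and
      \<open>a\<close> disappears.\<close>
    define k' where "k' = k(h0 := k a + k h0)"
    have "(\<Sum>c\<in>insert a S \<rightarrow>\<^sub>E UNIV. \<Prod>h\<in>insert a S. matpow A (k h) $ c (p h) $ c h)
      = (\<Sum>c\<in>S \<rightarrow>\<^sub>E UNIV. \<Sum>y\<in>UNIV. matpow A (k a) $ c b $ y * matpow A (k h0) $ y $ c h0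
            * (\<Prod>h\<in>S - {h0}. matpow A (k h) $ c (q h) $ c h))"
      unfolding sum_PiE_insert[OF a]
    proof (intro sum.cong refl)
      fix c :: "_ \<Rightarrow> 'n" and y
      have "(\<Prod>h\<in>S - {h0}. matpow A (k h) $ (c(a := y)) (p h) $ (c(a := y)) h)
          = (\<Prod>h\<in>S - {h0}. matpow A (k h) $ c (q h) $ c h)"
      proof (intro prod.cong refl)
        fix h assume "h \<in> S - {h0}"
        hence "p h = q h" "q h \<noteq> a" "h \<noteq> a" using ph qS a by auto
        thus "matpow A (k h) $ (c(a := y)) (p h) $ (c(a := y)) h = matpow A (k h) $ c (q h) $ c h" by simp
      qed
      moreover have "h0 \<noteq> a" "b \<noteq> a" using h0S bS a by auto
      ultimately show "(\<Prod>h\<in>insert a S. matpow A (k h) $ (c(a := y)) (p h) $ (c(a := y)) h)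
          = matpow A (k a) $ c b $ y * matpow A (k h0) $ y $ c h0
            * (\<Prod>h\<in>S - {h0}. matpow A (k h) $ c (q h) $ c h)"
        using fin a pa ph0 by (simp add: prod.remove[OF fin h0S] mult.assoc)
    qed
    also have "\<dots> = (\<Sum>c\<in>S \<rightarrow>\<^sub>E UNIV. matpow A (k a + k h0) $ c b $ c h0
            * (\<Prod>h\<in>S - {h0}. matpow A (k h) $ c (q h) $ c h))"
      by (simp add: matpow_add matrix_matrix_mult_def sum_distrib_right)
    also have "\<dots> = (\<Sum>c\<in>S \<rightarrow>\<^sub>E UNIV. \<Prod>h\<in>S. matpow A (k' h) $ c (q h) $ c h)"
    proof (intro sum.cong refl)
      fix c :: "_ \<Rightarrow> 'n"
      have "(\<Prod>h\<in>S - {h0}. matpow A (k' h) $ c (q h) $ c h) = (\<Prod>h\<in>S - {h0}. matpow A (k h) $ c (q h) $ c h)"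
        by (intro prod.cong refl) (simp add: k'_def)
      thus "matpow A (k a + k h0) $ c b $ c h0 * (\<Prod>h\<in>S - {h0}. matpow A (k h) $ c (q h) $ c h)
          = (\<Prod>h\<in>S. matpow A (k' h) $ c (q h) $ c h)"
        by (simp add: prod.remove[OF fin h0S] qh0 k'_def)
    qed
    also have "\<dots> = (\<Prod>C\<in>cycles_on q S. trace (matpow A (\<Sum>h\<in>C. k' h)))" by (rule insert.IH[OF q])
    also have "\<dots> = trace (matpow A (\<Sum>h\<in>orbit q b. k' h))
        * (\<Prod>C\<in>cycles_on q S - {orbit q b}. trace (matpow A (\<Sum>h\<in>C. k' h)))"
      by (rule prod_cycles_remove[OF q fin bS])
    also have "(\<Prod>C\<in>cycles_on q S - {orbit q b}. trace (matpow A (\<Sum>h\<in>C. k' h)))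
        = (\<Prod>C\<in>cycles_on q S - {orbit q b}. trace (matpow A (\<Sum>h\<in>C. k h)))"
    proof (intro prod.cong refl)
      fix C assume C: "C \<in> cycles_on q S - {orbit q b}"
      have "h0 \<notin> C"
      proof
        assume "h0 \<in> C"
        hence "C = orbit q h0" using C cycles_on_partition(2)[OF q fin] by blast
        moreover have "orbit q h0 = orbit q b"
          using permutation_orbit_eq[OF _ h0] q fin by (auto simp: permutation_permutes)
        ultimately show False using C by simp
      qed
      hence "(\<Sum>h\<in>C. k' h) = (\<Sum>h\<in>C. k h)" by (intro sum.cong) (auto simp: k'_def)
      thus "trace (matpow A (\<Sum>h\<in>C. k' h)) = trace (matpow A (\<Sum>h\<in>C. k h))" by simp
    qed
    also have "(\<Sum>h\<in>orbit q b. k' h) = (\<Sum>h\<in>insert a (orbit q b). k h)"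
    proof -
      have sub: "orbit q b \<subseteq> S" using q bS by (rule permutes_orbit_subset)
      hence f: "finite (orbit q b)" using fin finite_subset by blast
      have "(\<Sum>h\<in>orbit q b - {h0}. k' h) = (\<Sum>h\<in>orbit q b - {h0}. k h)"
        by (intro sum.cong) (auto simp: k'_def)
      moreover have "a \<notin> orbit q b" using sub a by blast
      ultimately show ?thesis using f h0 by (simp add: sum.remove[OF f h0] k'_def)
    qed
    finally show ?thesis
      unfolding p prod_cycles_transpose_insert[OF q fin a bS] .
  qed
qed

lemma sum_colorings_trace':
  fixes A :: "'a::comm_semiring_1^'n^'n"
  assumes "finite S" "p permutes S"
  shows "(\<Sum>c\<in>S \<rightarrow>\<^sub>E UNIV. \<Prod>h\<in>S. A $ c (p h) $ c h)
    = (\<Prod>C\<in>cycles_on p S. trace (matpow A (card C)))"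
  using sum_colorings_trace[OF assms, of A "\<lambda>_. 1"] by simp

section \<open>Pairings and Wick sums\<close>

definition pairings :: "'h set \<Rightarrow> ('h \<Rightarrow> 'h) set" where
  "pairings S = {t. t permutes S \<and> (\<forall>x\<in>S. t (t x) = x \<and> t x \<noteq> x)}"

text \<open>For symmetric \<open>K\<close> this is the hafnian of \<open>K\<close> on
  \<open>S\<close>. The linear order picks one element out of each pair.\<close>

definition wick_sum :: "('h::linorder \<Rightarrow> 'h \<Rightarrow> 'r::comm_semiring_1) \<Rightarrow> 'h set \<Rightarrow> 'r" where
  "wick_sum K S = (\<Sum>t\<in>pairings S. \<Prod>x\<in>{x \<in> S. x < t x}. K x (t x))"

lemma finite_pairings: "finite S \<Longrightarrow> finite (pairings S)"
  by (rule finite_subset[OF _ finite_permutations[of S]]) (auto simp: pairings_def)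

lemma pairings_card:
  fixes S :: "'h::linorder set"
  assumes "t \<in> pairings S" "finite S"
  shows "card S = 2 * card {x \<in> S. x < t x}"
proof -
  have t: "t permutes S" "t (t x) = x" "t x \<noteq> x" if "x \<in> S" for x using assms that by (auto simp: pairings_def)
  have tS: "t x \<in> S" if "x \<in> S" for x using t(1)[OF that] that by (simp add: permutes_in_image)
  have "{x \<in> S. t x < x} = t ` {x \<in> S. x < t x}"
    using t tS by (force simp: image_iff)
  moreover have "inj_on t {x \<in> S. x < t x}" using t(2) by (intro inj_onI) (metis mem_Collect_eq)
  ultimately have "card {x \<in> S. t x < x} = card {x \<in> S. x < t x}" by (simp add: card_image)
  moreover have "S = {x \<in> S. x < t x} \<union> {x \<in> S. t x < x}" using t(3) by force
  moreover have "card ({x \<in> S. x < t x} \<union> {x \<in> S. t x < x}) = card {x \<in> S. x < t x} + card {x \<in> S. t x < x}"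
    using assms(2) by (intro card_Un_disjoint) auto
  ultimately show ?thesis by simp
qed

text \<open>A pairing of \<open>insert a S\<close> is determined by the partner \<open>b\<close> of
  \<open>a\<close> and by the pairing of what remains. The latter fixes \<open>a\<close> and
  \<open>b\<close>, so composing it with their transposition joins these two points and changes
  nothing else.\<close>

lemma pairings_insert_bij:
  assumes a: "a \<notin> S"
  shows "bij_betw (\<lambda>(b, t). Transposition.transpose a b \<circ> t) (SIGMA b:S. pairings (S - {b})) (pairings (insert a S))"
proof (rule bij_betwI[where g = "\<lambda>t. (t a, Transposition.transpose a (t a) \<circ> t)"])
  show "(\<lambda>(b, t). Transposition.transpose a b \<circ> t) \<in> (SIGMA b:S. pairings (S - {b})) \<rightarrow> pairings (insert a S)"
  proof safe
    fix b t assume b: "b \<in> S" and t: "t \<in> pairings (S - {b})"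
    have tp: "t permutes (S - {b})" and tt: "\<And>x. x \<in> S - {b} \<Longrightarrow> t (t x) = x \<and> t x \<noteq> x"
      using t by (auto simp: pairings_def)
    have tab: "t a = a" "t b = b" using tp a by (auto simp: permutes_not_in)
    have tS: "t x \<in> S - {b}" if "x \<in> S - {b}" for x using tp that by (simp only: permutes_in_image)
    have "t permutes insert a S" using tp by (rule permutes_subset) auto
    hence "Transposition.transpose a b \<circ> t permutes insert a S"
      using b by (intro permutes_compose permutes_swap_id) auto
    moreover have "(Transposition.transpose a b \<circ> t) ((Transposition.transpose a b \<circ> t) x) = x
       \<and> (Transposition.transpose a b \<circ> t) x \<noteq> x" if x: "x \<in> insert a S" for x
    proof (cases "x = a \<or> x = b")
      case True thus ?thesis using tab a b by auto
    next
      case False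
      hence xS: "x \<in> S - {b}" using x by auto
      have "t x \<noteq> a" "t x \<noteq> b" using tS[OF xS] a by auto
      hence "Transposition.transpose a b (t x) = t x" by (simp add: Transposition.transpose_def)
      moreover have "Transposition.transpose a b x = x" using False by (simp add: Transposition.transpose_def)
      ultimately show ?thesis using tt[OF xS] by simp
    qed
    ultimately show "Transposition.transpose a b \<circ> t \<in> pairings (insert a S)"
      unfolding pairings_def by blast
  qed
  show "(\<lambda>t. (t a, Transposition.transpose a (t a) \<circ> t)) \<in> pairings (insert a S) \<rightarrow> (SIGMA b:S. pairings (S - {b}))"
  proof
    fix t assume t: "t \<in> pairings (insert a S)"
    have tp: "t permutes (insert a S)" and tt: "\<And>x. x \<in> insert a S \<Longrightarrow> t (t x) = x \<and> t x \<noteq> x"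
      using t by (auto simp: pairings_def)
    define b where "b = t a"
    have b: "b \<in> S" using tt[of a] permutes_in_image[OF tp, of a] by (auto simp: b_def)
    have tb: "t b = a" using tt[of a] by (simp add: b_def)
    have ab: "a \<noteq> b" using a b by auto
    let ?s = "Transposition.transpose a b \<circ> t"
    have tx: "t x \<noteq> a \<and> t x \<noteq> b" if "x \<noteq> a" "x \<noteq> b" for x
      using that tb b_def tp by (metis permutes_inj injD)
    have sx: "?s x = t x" if "x \<noteq> a" "x \<noteq> b" for x
      using tx[OF that] by (simp add: Transposition.transpose_def)
    have sa: "?s a = a" and sb: "?s b = b" using tb by (auto simp: b_def[symmetric])
    have "?s permutes insert a S" using tp b by (intro permutes_compose permutes_swap_id) auto
    hence "?s permutes (S - {b})"
      by (rule permutes_superset) (use sa sb in auto)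
    moreover have "?s (?s x) = x \<and> ?s x \<noteq> x" if "x \<in> S - {b}" for x
    proof -
      have n: "x \<noteq> a" "x \<noteq> b" using that a by auto
      show ?thesis using sx[OF n] sx[of "t x"] tx[OF n] tt[of x] that by simp
    qed
    ultimately show "(t a, Transposition.transpose a (t a) \<circ> t) \<in> (SIGMA b:S. pairings (S - {b}))"
      using b unfolding b_def pairings_def by blast
  qed
  fix y assume y: "y \<in> (SIGMA b:S. pairings (S - {b}))"
  then obtain b t where bt: "y = (b, t)" "b \<in> S" "t \<in> pairings (S - {b})" by blast
  have "t a = a" using bt a by (auto simp: pairings_def permutes_not_in)
  thus "((case y of (b, t) \<Rightarrow> Transposition.transpose a b \<circ> t) a,
      Transposition.transpose a ((case y of (b, t) \<Rightarrow> Transposition.transpose a b \<circ> t) a)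
      \<circ> (case y of (b, t) \<Rightarrow> Transposition.transpose a b \<circ> t)) = y"
    using bt by (simp add: fun_eq_iff)
next
  fix t :: "'a \<Rightarrow> 'a"
  show "(case (t a, Transposition.transpose a (t a) \<circ> t) of (b, t) \<Rightarrow> Transposition.transpose a b \<circ> t) = t"
    by (simp add: fun_eq_iff)
qed

lemma wick_sum_empty [simp]:
  fixes K :: "'h::linorder \<Rightarrow> 'h \<Rightarrow> 'r::comm_semiring_1"
  shows "wick_sum K {} = 1"
proof -
  have "pairings ({} :: 'h set) = {id}" by (auto simp: pairings_def)
  thus ?thesis by (simp add: wick_sum_def)
qed

lemma wick_sum_insert:
  assumes fin: "finite S" and a: "a \<notin> S" and sym: "\<And>b. b \<in> S \<Longrightarrow> K a b = K b a"
  shows "wick_sum K (insert a S) = (\<Sum>b\<in>S. K a b * wick_sum K (S - {b}))"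
proof -
  let ?w = "\<lambda>S t. \<Prod>x\<in>{x \<in> S. x < t x}. K x (t x)"
  have *: "?w (insert a S) (Transposition.transpose a b \<circ> t) = K a b * ?w (S - {b}) t"
    if b: "b \<in> S" and t: "t \<in> pairings (S - {b})" for b t
  proof -
    let ?t = "Transposition.transpose a b \<circ> t"
    have tp: "t permutes (S - {b})" using t by (auto simp: pairings_def)
    have "t a = a" "t b = b" using tp a by (auto simp: permutes_not_in)
    hence ta: "?t a = b" "?t b = a" by auto
    have ab: "a \<noteq> b" using a b by auto
    have tx: "?t x = t x" if "x \<in> S - {b}" for x
    proof -
      have "t x \<in> S - {b}" using tp that by (simp only: permutes_in_image)
      thus ?thesis using a by (auto simp: Transposition.transpose_def)
    qed
    \<comment> \<open>The order decides which end of the new pair is recorded, hence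
      \<open>min a b\<close>; the symmetry of \<open>K\<close> then makes both cases give the factor
      \<open>K a b\<close>.\<close>
    have "{x \<in> insert a S. x < ?t x} = insert (min a b) {x \<in> S - {b}. x < t x}"
    proof (rule set_eqI)
      fix x
      consider "x = a" | "x = b" | "x \<noteq> a" "x \<noteq> b" by blast
      thus "x \<in> {x \<in> insert a S. x < ?t x} \<longleftrightarrow> x \<in> insert (min a b) {x \<in> S - {b}. x < t x}"
      proof cases
        case 1 thus ?thesis using ta(1) a ab by (auto simp: min_def)
      next
        case 2 thus ?thesis using ta(2) b ab by (auto simp: min_def)
      next
        case 3
        hence "x \<noteq> min a b" by (auto simp: min_def)
        thus ?thesis using 3 tx[of x] by (cases "x \<in> S") (simp_all del: o_apply)
      qed
    qed
    moreover have "min a b \<notin> {x \<in> S - {b}. x < t x}" using a by (auto simp: min_def)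
    moreover have "(\<Prod>x\<in>{x \<in> S - {b}. x < t x}. K x (?t x)) = ?w (S - {b}) t"
      using tx by (intro prod.cong) auto
    moreover have "K (min a b) (?t (min a b)) = K a b" using ta sym[OF b] by (auto simp: min_def)
    ultimately show ?thesis using fin by simp
  qed
  have "wick_sum K (insert a S)
      = (\<Sum>(b, t)\<in>(SIGMA b:S. pairings (S - {b})). ?w (insert a S) (Transposition.transpose a b \<circ> t))"
    unfolding wick_sum_def sum.reindex_bij_betw[OF pairings_insert_bij[OF a], symmetric]
    by (simp add: case_prod_beta)
  also have "\<dots> = (\<Sum>(b, t)\<in>(SIGMA b:S. pairings (S - {b})). K a b * ?w (S - {b}) t)"
    by (intro sum.cong refl) (use * in auto)
  also have "\<dots> = (\<Sum>b\<in>S. \<Sum>t\<in>pairings (S - {b}). K a b * ?w (S - {b}) t)"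
    using fin by (subst sum.Sigma) (auto intro: finite_pairings)
  finally show ?thesis by (simp add: wick_sum_def sum_distrib_left)
qed

text \<open>Reduces Wick's theorem to a single contraction: \<open>E S\<close> will be the
  expectation of the product of the entries labelled by \<open>S\<close>, and contracting one label
  with each of the others is the only property to be verified.\<close>

lemma wick_sum_unique:
  fixes E :: "'h::linorder set \<Rightarrow> 'r::comm_semiring_1"
  assumes "finite S" and sym: "\<And>a b. K a b = K b a" and E0: "E {} = 1"
    and E: "\<And>S a. finite S \<Longrightarrow> a \<notin> S \<Longrightarrow> E (insert a S) = (\<Sum>b\<in>S. K a b * E (S - {b}))"
  shows "E S = wick_sum K S"
  using assms(1)
proof (induction "card S" arbitrary: S rule: less_induct)
  case less
  show ?case
  proof (cases "S = {}")
    case False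
    then obtain a where a: "a \<in> S" by blast
    have IH: "E (S - {a} - {b}) = wick_sum K (S - {a} - {b})" for b
      using less.prems a less.hyps[of "S - {a} - {b}"]
      by (metis Diff_subset card_Diff1_le card_Diff1_less finite_Diff order_le_less_trans)
    have "E (insert a (S - {a})) = (\<Sum>b\<in>S - {a}. K a b * E (S - {a} - {b}))"
      using less.prems by (intro E) auto
    also have "\<dots> = (\<Sum>b\<in>S - {a}. K a b * wick_sum K (S - {a} - {b}))" by (simp only: IH)
    also have "\<dots> = wick_sum K (insert a (S - {a}))"
      using less.prems sym by (intro wick_sum_insert[symmetric]) auto
    finally have "E (insert a (S - {a})) = wick_sum K (insert a (S - {a}))" .
    thus ?thesis using a by (simp add: insert_absorb)
  qed (simp add: E0)
qed

section \<open>Wick's theorem for the Hermitian Gaussian measure\<close>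

lemma lborel_integral_prod_Basis:
  fixes f :: "'a::euclidean_space \<Rightarrow> real \<Rightarrow> real"
  assumes f: "\<And>b. b \<in> Basis \<Longrightarrow> integrable lborel (f b)"
  shows "integrable lborel (\<lambda>x. \<Prod>b\<in>Basis. f b (x \<bullet> b))"
    and "(\<integral>x. (\<Prod>b\<in>Basis. f b (x \<bullet> b)) \<partial>lborel) = (\<Prod>b\<in>Basis. \<integral>x. f b x \<partial>lborel)"
proof -
  interpret product_sigma_finite "\<lambda>b::'a. lborel :: real measure"
    by (simp add: product_sigma_finite_def lborel.sigma_finite_measure_axioms)
  have [measurable]: "f b \<in> borel_measurable borel" if "b \<in> Basis" for b
    using borel_measurable_integrable[OF f[OF that]] by simp
  have m: "(\<lambda>g. \<Sum>b\<in>Basis. g b *\<^sub>R b) \<in> (\<Pi>\<^sub>M b\<in>(Basis::'a set). (lborel::real measure)) \<rightarrow>\<^sub>M borel"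
    by measurable
  have m': "(\<lambda>x::'a. \<Prod>b\<in>Basis. f b (x \<bullet> b)) \<in> borel_measurable borel"
    by measurable
  have e: "(\<Prod>b\<in>Basis. f b ((\<Sum>b\<in>Basis. g b *\<^sub>R b) \<bullet> b)) = (\<Prod>b\<in>Basis. f b (g b))" for g
    by (intro prod.cong refl) simp
  show "integrable lborel (\<lambda>x. \<Prod>b\<in>Basis. f b (x \<bullet> b))"
    unfolding lborel_eq[where 'a='a]
    by (subst integrable_distr_eq[OF m m'], subst e) (auto intro: product_integrable_prod f)
  show "(\<integral>x. (\<Prod>b\<in>Basis. f b (x \<bullet> b)) \<partial>lborel) = (\<Prod>b\<in>Basis. \<integral>x. f b x \<partial>lborel)"
    unfolding lborel_eq[where 'a='a]
    by (subst integral_distr[OF m m'], subst e, rule product_integral_prod) (auto intro: f)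
qed

text \<open>The basis vectors of the space of matrices are the matrix units, so \<open>u\<close>
  turns a product over \<open>Basis\<close> into one over index pairs.\<close>

lemma lborel_integral_prod_matrix:
  fixes f :: "'n::finite \<times> 'n \<Rightarrow> real \<Rightarrow> real"
  assumes f: "\<And>q. integrable lborel (f q)"
  shows "integrable lborel (\<lambda>M::real^'n^'n. \<Prod>q\<in>UNIV. f q (M $ fst q $ snd q))"
    and "(\<integral>M. (\<Prod>q\<in>UNIV. f q (M $ fst q $ snd q)) \<partial>(lborel :: (real^'n^'n) measure))
      = (\<Prod>q\<in>UNIV. \<integral>x. f q x \<partial>lborel)"
proof -
  define u where "u = (\<lambda>q. axis (fst q) (axis (snd q) 1) :: real^'n^'n)"
  have bij: "bij_betw u UNIV Basis"
    unfolding bij_betw_def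
  proof
    show "inj u" by (rule injI) (auto simp: u_def axis_eq_axis prod_eq_iff)
    show "range u = Basis" by (auto simp: u_def Basis_vec_def image_def)
  qed
  define g where "g = (\<lambda>b. f (the_inv_into UNIV u b))"
  have g: "g (u q) = f q" for q
    using bij by (simp add: g_def the_inv_into_f_f bij_betw_def)
  have in_g: "integrable lborel (g b)" for b by (simp add: g_def f)
  have p: "(\<Prod>b\<in>Basis. g b (M \<bullet> b)) = (\<Prod>q\<in>UNIV. f q (M $ fst q $ snd q))" for M
    by (subst prod.reindex_bij_betw[OF bij, symmetric]) (simp add: g, simp add: u_def inner_axis)
  show "integrable lborel (\<lambda>M::real^'n^'n. \<Prod>q\<in>UNIV. f q (M $ fst q $ snd q))"
    using lborel_integral_prod_Basis(1)[of g] in_g by (simp add: p)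
  have "(\<Prod>b\<in>Basis. \<integral>x. g b x \<partial>lborel) = (\<Prod>q\<in>UNIV. \<integral>x. f q x \<partial>lborel)"
    by (subst prod.reindex_bij_betw[OF bij, symmetric]) (simp add: g)
  thus "(\<integral>M. (\<Prod>q\<in>UNIV. f q (M $ fst q $ snd q)) \<partial>(lborel :: (real^'n^'n) measure))
      = (\<Prod>q\<in>UNIV. \<integral>x. f q x \<partial>lborel)"
    using lborel_integral_prod_Basis(2)[of g] in_g by (simp add: p)
qed

definition normal_moment :: "real \<Rightarrow> nat \<Rightarrow> real" where
  "normal_moment s k = (\<integral>x. normal_density 0 s x * x ^ k \<partial>lborel)"

lemma normal_moment_0 [simp]: "s > 0 \<Longrightarrow> normal_moment s 0 = 1"
  by (simp add: normal_moment_def)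

text \<open>The one-variable Wick recursion, otherwise obtained by integration by parts; here it is
  read off from the known even and odd moments. For \<open>k = 0\<close> the factor
  \<open>of_nat k\<close> kills the term with the truncated index \<open>k - 1\<close>.\<close>

lemma normal_moment_Suc:
  assumes "s > 0"
  shows "normal_moment s (Suc k) = of_nat k * s\<^sup>2 * normal_moment s (k - 1)"
proof (cases "even k")
  case True
  have odd: "normal_moment s j = 0" if o: "odd j" for j
  proof -
    obtain l where "j = 2 * l + 1" using o by (rule oddE)
    thus ?thesis using has_bochner_integral_integral_eq[OF normal_moment_odd[OF assms, of 0 l]]
      by (simp add: normal_moment_def)
  qed
  show ?thesis
    using True by (cases "k = 0") (simp_all add: odd)
next
  case False
  then obtain l where k: "k = 2 * l + 1" by (auto elim: oddE)
  have ev: "normal_moment s (2 * l) = fact (2 * l) / ((2 / s\<^sup>2) ^ l * fact l)" for l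
    using integral_normal_moment_even[OF assms, of 0 l] by (simp add: normal_moment_def)
  have "normal_moment s (Suc k) = normal_moment s (2 * Suc l)" by (simp add: k)
  also have "\<dots> = of_nat k * s\<^sup>2 * normal_moment s (2 * l)"
  proof -
    define A B C n where "A = (2 / s\<^sup>2) ^ l" and "B = (fact (2 * l) :: real)" and "C = (fact l :: real)" and "n = real (Suc l)"
    have "fact (2 * Suc l) = 2 * n * real k * B" by (simp add: n_def B_def k algebra_simps)
    moreover have "fact (Suc l) = n * C" by (simp add: n_def C_def)
    moreover have "(2 / s\<^sup>2) ^ Suc l = 2 / s\<^sup>2 * A" by (simp add: A_def)
    moreover have "A \<noteq> 0" "C \<noteq> 0" "n \<noteq> 0" using assms by (simp_all add: A_def C_def n_def)
    ultimately show ?thesis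
      unfolding ev using assms by (simp add: A_def[symmetric] B_def[symmetric] C_def[symmetric] del: fact_Suc)
  qed
  finally show ?thesis by (simp add: k)
qed

context
  fixes lam :: "real^'n"
  assumes lam: "\<And>i. lam $ i > 0"
begin

text \<open>The standard deviations of the Gaussian measure in the coordinates of
  \<open>herm\<close>: there Tr(X^2 Lambda)/2 is diagonal and contains the square of the entry (i,
  j) with coefficient (lambda_i + lambda_j)/4.\<close>

definition sd :: "'n \<times> 'n \<Rightarrow> real" where
  "sd q = sqrt (2 / (lam $ fst q + lam $ snd q))"

definition gweight :: "real^'n^'n \<Rightarrow> real" where
  "gweight M = (\<Prod>q\<in>UNIV. normal_density 0 (sd q) (M $ fst q $ snd q))"

lemma sd_pos: "sd q > 0"
  using lam[of "fst q"] lam[of "snd q"] by (simp add: sd_def)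

lemma sd_sq: "(sd q)\<^sup>2 = 2 / (lam $ fst q + lam $ snd q)"
  using lam[of "fst q"] lam[of "snd q"] by (simp add: sd_def)

lemma monomial_gweight:
  assumes "finite S"
  shows "(\<Prod>l\<in>S. M $ fst (p l) $ snd (p l)) * gweight M
    = (\<Prod>q\<in>UNIV. normal_density 0 (sd q) (M $ fst q $ snd q) * (M $ fst q $ snd q) ^ card {l \<in> S. p l = q})"
proof -
  have "(\<Prod>l\<in>S. M $ fst (p l) $ snd (p l)) = (\<Prod>q\<in>UNIV. \<Prod>l\<in>{l \<in> S. p l = q}. M $ fst (p l) $ snd (p l))"
    using assms by (intro prod.group[symmetric]) auto
  also have "\<dots> = (\<Prod>q\<in>UNIV. (M $ fst q $ snd q) ^ card {l \<in> S. p l = q})"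
    by (intro prod.cong refl) simp
  finally show ?thesis by (simp add: gweight_def prod.distrib mult.commute)
qed

lemma monomial_integrable:
  assumes "finite S"
  shows "integrable lborel (\<lambda>M. (\<Prod>l\<in>S. M $ fst (p l) $ snd (p l)) * gweight M)"
  unfolding monomial_gweight[OF assms]
  by (intro lborel_integral_prod_matrix(1)) (use integrable_normal_moment[OF sd_pos, of 0] in simp)

lemma monomial_integral:
  assumes "finite S"
  shows "(\<integral>M. (\<Prod>l\<in>S. M $ fst (p l) $ snd (p l)) * gweight M \<partial>lborel)
    = (\<Prod>q\<in>UNIV. normal_moment (sd q) (card {l \<in> S. p l = q}))"
  unfolding monomial_gweight[OF assms] normal_moment_def
  by (intro lborel_integral_prod_matrix(2)) (use integrable_normal_moment[OF sd_pos, of 0] in simp)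

text \<open>Distinct entries are independent, so \<open>a\<close> can only be contracted with labels
  \<open>b\<close> that carry the same entry. Their number is the factor \<open>of_nat k\<close> of
  \<open>normal_moment_Suc\<close>, written out as a sum over \<open>b\<close>.\<close>

lemma monomial_wick:
  assumes fin: "finite S" and a: "a \<notin> S"
  shows "(\<integral>M. (\<Prod>l\<in>insert a S. M $ fst (p l) $ snd (p l)) * gweight M \<partial>lborel)
    = (\<Sum>b\<in>S. if p a = p b then (sd (p a))\<^sup>2 * (\<integral>M. (\<Prod>l\<in>S - {b}. M $ fst (p l) $ snd (p l)) * gweight M \<partial>lborel) else 0)"
proof -
  let ?N = "\<lambda>S q. card {l \<in> S. p l = q}"
  let ?R = "\<Prod>q\<in>UNIV - {p a}. normal_moment (sd q) (?N S q)"
  have c1: "?N (insert a S) (p a) = Suc (?N S (p a))"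
  proof -
    have "{l \<in> insert a S. p l = p a} = insert a {l \<in> S. p l = p a}" by auto
    thus ?thesis using fin a by simp
  qed
  have c2: "?N (insert a S) q = ?N S q" if "q \<noteq> p a" for q
    by (rule arg_cong[where f = card]) (use that in auto)
  have d1: "?N (S - {b}) (p a) = ?N S (p a) - 1" if "b \<in> S" "p a = p b" for b
  proof -
    have "{l \<in> S - {b}. p l = p a} = {l \<in> S. p l = p a} - {b}" by auto
    thus ?thesis using fin that by simp
  qed
  have d2: "?N (S - {b}) q = ?N S q" if "p a = p b" "q \<noteq> p a" for q b
    by (rule arg_cong[where f = card]) (use that in auto)
  have R: "(\<Prod>q\<in>UNIV. normal_moment (sd q) (?N (S - {b}) q)) = normal_moment (sd (p a)) (?N S (p a) - 1) * ?R"
    if "b \<in> S" "p a = p b" for b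
  proof -
    have "(\<Prod>q\<in>UNIV - {p a}. normal_moment (sd q) (?N (S - {b}) q)) = ?R"
      by (intro prod.cong refl) (subst d2[OF that(2)], auto)
    thus ?thesis by (subst prod.remove[of _ "p a"]) (simp_all only: d1[OF that] finite UNIV_I)
  qed
  have "(\<Prod>q\<in>UNIV. normal_moment (sd q) (?N (insert a S) q))
      = normal_moment (sd (p a)) (Suc (?N S (p a))) * ?R"
  proof -
    have "(\<Prod>q\<in>UNIV - {p a}. normal_moment (sd q) (?N (insert a S) q)) = ?R"
      by (intro prod.cong refl) (subst c2, auto)
    thus ?thesis by (subst prod.remove[of _ "p a"]) (simp_all only: c1 finite UNIV_I)
  qed
  also have "\<dots> = of_nat (?N S (p a)) * ((sd (p a))\<^sup>2 * (normal_moment (sd (p a)) (?N S (p a) - 1) * ?R))"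
    by (simp add: normal_moment_Suc sd_pos)
  also have "\<dots> = (\<Sum>b\<in>{b \<in> S. p b = p a}. (sd (p a))\<^sup>2 * (normal_moment (sd (p a)) (?N S (p a) - 1) * ?R))"
    by simp
  also have "\<dots> = (\<Sum>b\<in>{b \<in> S. p b = p a}. (sd (p a))\<^sup>2 * (\<Prod>q\<in>UNIV. normal_moment (sd q) (?N (S - {b}) q)))"
    by (intro sum.cong refl) (subst R, auto)
  also have "\<dots> = (\<Sum>b\<in>S. if p a = p b then (sd (p a))\<^sup>2 * (\<Prod>q\<in>UNIV. normal_moment (sd q) (?N (S - {b}) q)) else 0)"
    using fin by (subst sum.inter_filter) (auto intro: sum.cong)
  finally show ?thesis using fin by (simp add: monomial_integral cong: if_cong)
qed

section \<open>From real coordinates to Hermitian entries\<close>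

lemma herm_nth: "herm M $ i $ j = (1 + \<i>) / 2 * of_real (M $ i $ j) + (1 - \<i>) / 2 * of_real (M $ j $ i)"
  by (simp add: herm_def complex_eq_iff field_simps)

lemma gauss_density_herm:
  "gauss_density lam (herm M) = of_real (\<Prod>q\<in>UNIV. exp (- (M $ fst q $ snd q)\<^sup>2 / (2 * (sd q)\<^sup>2)))"
proof -
  have hh: "herm M $ i $ k * herm M $ k $ i = of_real (((M $ i $ k)\<^sup>2 + (M $ k $ i)\<^sup>2) / 2)" for i k
    by (simp add: herm_def complex_eq_iff power2_eq_square field_simps)
  have "trace (matpow (herm M) 2 ** Lam lam) = (\<Sum>i\<in>UNIV. \<Sum>k\<in>UNIV. herm M $ i $ k * herm M $ k $ i * of_real (lam $ i))"
    by (simp add: trace_def numeral_2_eq_2 matrix_matrix_mult_def Lam_def sum_distrib_right mat_def if_distrib cong: if_cong)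
  also have "\<dots> = of_real (\<Sum>i\<in>UNIV. \<Sum>k\<in>UNIV. ((M $ i $ k)\<^sup>2 + (M $ k $ i)\<^sup>2) / 2 * lam $ i)"
    by (simp add: hh)
  also have "(\<Sum>i\<in>UNIV. \<Sum>k\<in>UNIV. ((M $ i $ k)\<^sup>2 + (M $ k $ i)\<^sup>2) / 2 * lam $ i)
    = (\<Sum>i\<in>UNIV. \<Sum>k\<in>UNIV. (M $ i $ k)\<^sup>2 / 2 * lam $ i) + (\<Sum>i\<in>UNIV. \<Sum>k\<in>UNIV. (M $ k $ i)\<^sup>2 / 2 * lam $ i)"
    by (simp add: add_divide_distrib distrib_right sum.distrib)
  \<comment> \<open>Renaming the indices attaches both halves of the sum to the same square, which
    thereby acquires the symmetric coefficient \<open>lam $ i + lam $ k\<close>.\<close>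
  also have "(\<Sum>i\<in>UNIV. \<Sum>k\<in>UNIV. (M $ k $ i)\<^sup>2 / 2 * lam $ i) = (\<Sum>i\<in>UNIV. \<Sum>k\<in>UNIV. (M $ i $ k)\<^sup>2 / 2 * lam $ k)"
    by (rule sum.swap)
  also have "(\<Sum>i\<in>UNIV. \<Sum>k\<in>UNIV. (M $ i $ k)\<^sup>2 / 2 * lam $ i) + (\<Sum>i\<in>UNIV. \<Sum>k\<in>UNIV. (M $ i $ k)\<^sup>2 / 2 * lam $ k)
    = (\<Sum>i\<in>UNIV. \<Sum>k\<in>UNIV. 2 * ((M $ i $ k)\<^sup>2 / (2 * (sd (i, k))\<^sup>2)))"
    unfolding sum.distrib[symmetric] by (intro sum.cong refl) (simp add: sd_sq field_simps)
  also have "\<dots> = 2 * (\<Sum>q\<in>UNIV. (M $ fst q $ snd q)\<^sup>2 / (2 * (sd q)\<^sup>2))"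
    by (simp add: sum_distrib_left sum.cartesian_product case_prod_beta)
  finally have t: "trace (matpow (herm M) 2 ** Lam lam)
      = of_real (2 * (\<Sum>q\<in>UNIV. (M $ fst q $ snd q)\<^sup>2 / (2 * (sd q)\<^sup>2)))" .
  have "gauss_density lam (herm M) = of_real (exp (\<Sum>q\<in>UNIV. - (M $ fst q $ snd q)\<^sup>2 / (2 * (sd q)\<^sup>2)))"
    unfolding gauss_density_def t exp_of_real[symmetric] by (simp add: sum_negf)
  thus ?thesis by (simp add: exp_sum)
qed

text \<open>Proportionality suffices: the constant \<open>Z\<close> cancels in the quotient that
  defines \<open>gauss_mean\<close>.\<close>

lemma gweight_gauss_density:
  obtains Z where "Z > 0" "\<And>M. gauss_density lam (herm M) = of_real (Z * gweight M)"
proof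
  let ?Z = "\<Prod>q\<in>UNIV. sqrt (2 * pi * (sd q)\<^sup>2)"
  show "?Z > 0" by (intro prod_pos) (simp add: sd_pos less_imp_neq[OF sd_pos, symmetric])
  fix M
  have "sqrt (2 * pi * (sd q)\<^sup>2) \<noteq> 0" for q using sd_pos[of q] by simp
  thus "gauss_density lam (herm M) = of_real (?Z * gweight M)"
    unfolding gauss_density_herm gweight_def prod.distrib[symmetric]
    by (intro arg_cong[where f = of_real] prod.cong refl) (simp add: normal_density_def)
qed


abbreviation gexp :: "(real^'n^'n \<Rightarrow> complex) \<Rightarrow> complex" where
  "gexp f \<equiv> (\<integral>M. f M * of_real (gweight M) \<partial>lborel)"

lemma gweight_integral: "integrable lborel gweight" "(\<integral>M. gweight M \<partial>lborel) = 1"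
  using monomial_integrable[of "{}"] monomial_integral[of "{}"] by (simp_all add: sd_pos)

lemma gauss_mean_gexp:
  assumes "continuous_on UNIV f"
  shows "gauss_mean lam f = gexp (\<lambda>M. f (herm M))"
proof -
  obtain Z where Z: "Z > 0" "\<And>M. gauss_density lam (herm M) = of_real (Z * gweight M)"
    using gweight_gauss_density by metis
  have cg: "continuous_on UNIV (gauss_density lam)"
  proof -
    have "continuous_on UNIV (\<lambda>X::complex^'n^'n. trace (matpow X 2 ** Lam lam))"
      unfolding trace_def matrix_matrix_mult_def by (simp add: numeral_2_eq_2 matrix_matrix_mult_def mat_def)
        (intro continuous_intros)
    thus ?thesis unfolding gauss_density_def by (intro continuous_intros) auto
  qed
  have "(\<integral>X. f X * gauss_density lam X \<partial>hermitian_lborel) = (\<integral>M. f (herm M) * gauss_density lam (herm M) \<partial>lborel)"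
    by (rule integral_hermitian_lborel) (intro continuous_on_mult assms cg)
  also have "\<dots> = (\<integral>M. of_real Z * (f (herm M) * of_real (gweight M)) \<partial>lborel)"
    by (simp add: Z mult_ac)
  finally have 1: "(\<integral>X. f X * gauss_density lam X \<partial>hermitian_lborel) = of_real Z * gexp (\<lambda>M. f (herm M))"
    by simp
  have "(\<integral>X. gauss_density lam X \<partial>hermitian_lborel) = (\<integral>M. of_real (Z * gweight M) \<partial>lborel)"
    unfolding integral_hermitian_lborel[OF cg] Z(2) ..
  also have "\<dots> = of_real (\<integral>M. Z * gweight M \<partial>lborel)" by (rule integral_complex_of_real)
  finally have 2: "(\<integral>X. gauss_density lam X \<partial>hermitian_lborel) = of_real Z"
    by (simp add: gweight_integral)
  show ?thesis unfolding gauss_mean_def 1 2 using Z(1) by simp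
qed

text \<open>An entry of \<open>herm M\<close> is a combination of the two independent entries \<open>M $ i $ j\<close> and
  \<open>M $ j $ i\<close>; the boolean selects one of them.\<close>

definition entry_coeff :: "bool \<Rightarrow> complex" where
  "entry_coeff y = (if y then (1 + \<i>) / 2 else (1 - \<i>) / 2)"

definition entry_index :: "bool \<Rightarrow> 'n \<times> 'n \<Rightarrow> 'n \<times> 'n" where
  "entry_index y q = (if y then q else prod.swap q)"

lemma herm_nth_sum:
  "herm M $ fst q $ snd q = (\<Sum>y\<in>UNIV. entry_coeff y * of_real (M $ fst (entry_index y q) $ snd (entry_index y q)))"
  by (simp add: herm_nth UNIV_bool entry_coeff_def entry_index_def)

lemma herm_prod_sum:
  assumes "finite S"
  shows "(\<Prod>l\<in>S. herm M $ fst (p l) $ snd (p l)) = (\<Sum>s\<in>S \<rightarrow>\<^sub>E UNIV. (\<Prod>l\<in>S. entry_coeff (s l))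
    * of_real (\<Prod>l\<in>S. M $ fst (entry_index (s l) (p l)) $ snd (entry_index (s l) (p l))))"
  unfolding herm_nth_sum by (subst prod_sum_PiE) (simp_all add: assms prod.distrib)

lemma herm_prod_integrable:
  assumes "finite S"
  shows "integrable lborel (\<lambda>M. (\<Prod>l\<in>S. herm M $ fst (p l) $ snd (p l)) * of_real (gweight M))"
  unfolding herm_prod_sum[OF assms] sum_distrib_right mult.assoc of_real_mult[symmetric]
  by (intro Bochner_Integration.integrable_sum Bochner_Integration.integrable_mult_right
      Bochner_Integration.integrable_of_real monomial_integrable assms)

lemma herm_prod_gexp:
  assumes "finite S"
  shows "gexp (\<lambda>M. \<Prod>l\<in>S. herm M $ fst (p l) $ snd (p l)) = (\<Sum>s\<in>S \<rightarrow>\<^sub>E UNIV. (\<Prod>l\<in>S. entry_coeff (s l))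
    * of_real (\<integral>M. (\<Prod>l\<in>S. M $ fst (entry_index (s l) (p l)) $ snd (entry_index (s l) (p l))) * gweight M \<partial>lborel))"
proof -
  have "gexp (\<lambda>M. \<Prod>l\<in>S. herm M $ fst (p l) $ snd (p l)) = (\<Sum>s\<in>S \<rightarrow>\<^sub>E UNIV. \<integral>M. (\<Prod>l\<in>S. entry_coeff (s l))
    * of_real ((\<Prod>l\<in>S. M $ fst (entry_index (s l) (p l)) $ snd (entry_index (s l) (p l))) * gweight M) \<partial>lborel)"
    unfolding herm_prod_sum[OF assms] sum_distrib_right mult.assoc of_real_mult[symmetric]
    by (intro Bochner_Integration.integral_sum Bochner_Integration.integrable_mult_right
      Bochner_Integration.integrable_of_real monomial_integrable assms)
  thus ?thesis by (simp only: integral_mult_right_zero integral_complex_of_real)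
qed

text \<open>The covariance of the Hermitian model: the entry (i, j) contracts only with the entry
  (j, i). Graphically, the two sides of the ribbon joining two half-edges carry one index
  each.\<close>

definition propagator :: "'n \<times> 'n \<Rightarrow> 'n \<times> 'n \<Rightarrow> complex" where
  "propagator q r = (if q = prod.swap r then of_real (2 / (lam $ fst q + lam $ snd q)) else 0)"

text \<open>Off the diagonal, \<open>r = q\<close> leaves the two terms with equal booleans, whose
  coefficients i/2 and -i/2 cancel, while \<open>r = prod.swap q\<close> leaves the two mixed ones,
  which add up to 1. On the diagonal all four occur, again with sum 1.\<close>

lemma propagator_entries:
  "(\<Sum>y\<in>UNIV. \<Sum>z\<in>UNIV. if entry_index y q = entry_index z r
      then entry_coeff y * entry_coeff z * of_real ((sd (entry_index y q))\<^sup>2) else 0) = propagator q r"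
proof -
  have s: "(sd (entry_index y q))\<^sup>2 = 2 / (lam $ fst q + lam $ snd q)" for y
    by (simp add: sd_sq entry_index_def add.commute)
  have c: "entry_coeff True * entry_coeff True = \<i> / 2" "entry_coeff False * entry_coeff False = - \<i> / 2"
    "entry_coeff True * entry_coeff False = 1 / 2" "entry_coeff False * entry_coeff True = 1 / 2"
    by (simp_all add: entry_coeff_def complex_eq_iff)
  have sw: "prod.swap q = r \<longleftrightarrow> q = prod.swap r" "prod.swap q = prod.swap r \<longleftrightarrow> q = r"
    by (cases q; cases r; auto)+
  show ?thesis
    unfolding s UNIV_bool
    by (auto simp: c entry_index_def propagator_def sw field_simps)
qed

lemma sum_PiE_remove:
  fixes F :: "('a \<Rightarrow> 'b) \<Rightarrow> 'r::comm_monoid_add"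
  assumes "b \<in> S"
  shows "(\<Sum>c\<in>S \<rightarrow>\<^sub>E T. F c) = (\<Sum>c\<in>(S - {b}) \<rightarrow>\<^sub>E T. \<Sum>y\<in>T. F (c(b := y)))"
  using sum_PiE_insert[of b "S - {b}" F T] assms by (simp add: insert_absorb)

text \<open>Every entry is expanded into its two real coordinates and \<open>monomial_wick\<close>
  is applied to each resulting monomial. For each partner \<open>b\<close> the choices
  \<open>y\<close> at \<open>a\<close> and \<open>z\<close> at \<open>b\<close> are summed first and
  assemble to the covariance; the remaining choices reassemble to the expectation without
  \<open>a\<close> and \<open>b\<close>.\<close>

lemma herm_wick_step:
  assumes fin: "finite S" and a: "a \<notin> S"
  shows "gexp (\<lambda>M. \<Prod>l\<in>insert a S. herm M $ fst (p l) $ snd (p l))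
    = (\<Sum>b\<in>S. propagator (p a) (p b) * gexp (\<lambda>M. \<Prod>l\<in>S - {b}. herm M $ fst (p l) $ snd (p l)))"
proof -
  let ?e = "\<lambda>s l. entry_index (s l) (p l)"
  let ?E = "\<lambda>S s. complex_of_real (\<integral>M. (\<Prod>l\<in>S. M $ fst (?e s l) $ snd (?e s l)) * gweight M \<partial>lborel)"
  let ?c = "\<lambda>S s. \<Prod>l\<in>S. entry_coeff (s l)"
  have cong: "?E T (s(x := y)) = ?E T s" "?c T (s(x := y)) = ?c T s" if "x \<notin> T" for T s x y
  proof -
    have "(\<Prod>l\<in>T. M $ fst (?e (s(x := y)) l) $ snd (?e (s(x := y)) l)) = (\<Prod>l\<in>T. M $ fst (?e s l) $ snd (?e s l))" for M :: "real^'n^'n"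
      by (intro prod.cong refl) (use that in auto)
    thus "?E T (s(x := y)) = ?E T s" by simp
    show "?c T (s(x := y)) = ?c T s" by (intro prod.cong refl) (use that in auto)
  qed
  have step: "?E (insert a S) s = (\<Sum>b\<in>S. if ?e s a = ?e s b then of_real ((sd (?e s a))\<^sup>2) * ?E (S - {b}) s else 0)" for s
    unfolding monomial_wick[OF fin a] of_real_sum by (intro sum.cong refl) simp
  have "gexp (\<lambda>M. \<Prod>l\<in>insert a S. herm M $ fst (p l) $ snd (p l))
    = (\<Sum>s\<in>S \<rightarrow>\<^sub>E UNIV. \<Sum>y\<in>UNIV. ?c (insert a S) (s(a := y)) * ?E (insert a S) (s(a := y)))"
    by (subst herm_prod_gexp, simp add: fin) (rule sum_PiE_insert[OF a])
  also have "\<dots> = (\<Sum>s\<in>S \<rightarrow>\<^sub>E UNIV. \<Sum>y\<in>UNIV. \<Sum>b\<in>S.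
      if entry_index y (p a) = ?e s b then entry_coeff y * ?c S s * (of_real ((sd (entry_index y (p a)))\<^sup>2) * ?E (S - {b}) s) else 0)"
  proof (intro sum.cong refl)
    fix s y
    have "?c (insert a S) (s(a := y)) = entry_coeff y * ?c S s"
      using fin a cong(2)[OF a, of s y] by (simp add: prod.insert)
    moreover have "?E (insert a S) (s(a := y)) = (\<Sum>b\<in>S. if entry_index y (p a) = ?e s b then of_real ((sd (entry_index y (p a)))\<^sup>2) * ?E (S - {b}) s else 0)"
      unfolding step
    proof (intro sum.cong refl)
      fix b assume b: "b \<in> S"
      have ab: "a \<noteq> b" "a \<notin> S - {b}" using a b by auto
      have "?e (s(a := y)) a = entry_index y (p a)" "?e (s(a := y)) b = ?e s b" using ab by auto
      thus "(if ?e (s(a := y)) a = ?e (s(a := y)) b then of_real ((sd (?e (s(a := y)) a))\<^sup>2) * ?E (S - {b}) (s(a := y)) else 0)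
        = (if entry_index y (p a) = ?e s b then of_real ((sd (entry_index y (p a)))\<^sup>2) * ?E (S - {b}) s else 0)"
        by (simp only: cong(1)[OF ab(2)])
    qed
    ultimately show "?c (insert a S) (s(a := y)) * ?E (insert a S) (s(a := y)) = (\<Sum>b\<in>S.
      if entry_index y (p a) = ?e s b then entry_coeff y * ?c S s * (of_real ((sd (entry_index y (p a)))\<^sup>2) * ?E (S - {b}) s) else 0)"
      by (simp only: sum_distrib_left if_distrib[of "(*) _"] mult_zero_right)
  qed
  also have "\<dots> = (\<Sum>b\<in>S. \<Sum>s\<in>S \<rightarrow>\<^sub>E UNIV. \<Sum>y\<in>UNIV.
      if entry_index y (p a) = ?e s b then entry_coeff y * ?c S s * (of_real ((sd (entry_index y (p a)))\<^sup>2) * ?E (S - {b}) s) else 0)"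
    by (subst sum.swap[of _ S UNIV], subst sum.swap[of _ S]) (rule refl)
  also have "\<dots> = (\<Sum>b\<in>S. propagator (p a) (p b) * gexp (\<lambda>M. \<Prod>l\<in>S - {b}. herm M $ fst (p l) $ snd (p l)))"
  proof (intro sum.cong refl)
    fix b assume b: "b \<in> S"
    have "(\<Sum>s\<in>S \<rightarrow>\<^sub>E UNIV. \<Sum>y\<in>UNIV.
      if entry_index y (p a) = ?e s b then entry_coeff y * ?c S s * (of_real ((sd (entry_index y (p a)))\<^sup>2) * ?E (S - {b}) s) else 0)
      = (\<Sum>s\<in>(S - {b}) \<rightarrow>\<^sub>E UNIV. \<Sum>z\<in>UNIV. \<Sum>y\<in>UNIV.
          (if entry_index y (p a) = entry_index z (p b) then entry_coeff y * entry_coeff z * of_real ((sd (entry_index y (p a)))\<^sup>2) else 0)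
          * (?c (S - {b}) s * ?E (S - {b}) s))"
      unfolding sum_PiE_remove[OF b]
    proof (intro sum.cong refl)
      fix s z y
      have "?c S (s(b := z)) = entry_coeff z * ?c (S - {b}) s"
        using cong(2)[of b "S - {b}" s z] by (simp add: prod.remove[OF fin b])
      moreover have "?E (S - {b}) (s(b := z)) = ?E (S - {b}) s" by (rule cong) simp
      ultimately show "(if entry_index y (p a) = ?e (s(b := z)) b then entry_coeff y * ?c S (s(b := z))
          * (of_real ((sd (entry_index y (p a)))\<^sup>2) * ?E (S - {b}) (s(b := z))) else 0)
        = (if entry_index y (p a) = entry_index z (p b) then entry_coeff y * entry_coeff z * of_real ((sd (entry_index y (p a)))\<^sup>2) else 0)
          * (?c (S - {b}) s * ?E (S - {b}) s)"
        by (cases "entry_index y (p a) = entry_index z (p b)")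
          (simp_all only: fun_upd_same if_True if_False simp_thms mult_zero_left mult_ac)
    qed
    also have "\<dots> = (\<Sum>s\<in>(S - {b}) \<rightarrow>\<^sub>E UNIV. propagator (p a) (p b) * (?c (S - {b}) s * ?E (S - {b}) s))"
      unfolding sum_distrib_right[symmetric] propagator_entries[symmetric]
      by (intro sum.cong refl arg_cong[where f = "\<lambda>x. x * _"] sum.swap)
    also have "\<dots> = propagator (p a) (p b) * gexp (\<lambda>M. \<Prod>l\<in>S - {b}. herm M $ fst (p l) $ snd (p l))"
      using fin by (subst herm_prod_gexp) (simp_all only: finite_Diff sum_distrib_left)
    finally show "(\<Sum>s\<in>S \<rightarrow>\<^sub>E UNIV. \<Sum>y\<in>UNIV.
      if entry_index y (p a) = ?e s b then entry_coeff y * ?c S s * (of_real ((sd (entry_index y (p a)))\<^sup>2) * ?E (S - {b}) s) else 0)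
      = propagator (p a) (p b) * gexp (\<lambda>M. \<Prod>l\<in>S - {b}. herm M $ fst (p l) $ snd (p l))" .
  qed
  finally show ?thesis .
qed

lemma propagator_sym: "propagator q r = propagator r q"
  by (auto simp: propagator_def add.commute)

lemma herm_wick:
  fixes S :: "'h::linorder set"
  assumes "finite S"
  shows "gexp (\<lambda>M. \<Prod>l\<in>S. herm M $ fst (p l) $ snd (p l)) = wick_sum (\<lambda>x y. propagator (p x) (p y)) S"
proof (rule wick_sum_unique[OF assms])
  show "gexp (\<lambda>M. \<Prod>l\<in>{}. herm M $ fst (p l) $ snd (p l)) = 1"
    using gweight_integral(2) by (simp add: integral_complex_of_real)
qed (rule propagator_sym, rule herm_wick_step)

end

section \<open>The perturbative series\<close>

text \<open>The polynomial functions of the entries, generated so that an induction meets one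
  additional entry at a time. Such an entry can be moved into a monomial, for which integrability is
  already known.\<close>

inductive entry_poly :: "(complex^'n^'n \<Rightarrow> complex) \<Rightarrow> bool" where
  const: "entry_poly (\<lambda>X. c)"
| add: "entry_poly F \<Longrightarrow> entry_poly G \<Longrightarrow> entry_poly (\<lambda>X. F X + G X)"
| entry: "entry_poly F \<Longrightarrow> entry_poly (\<lambda>X. X $ i $ j * F X)"

lemma entry_poly_mult:
  assumes "entry_poly F" "entry_poly G"
  shows "entry_poly (\<lambda>X. F X * G X)"
  using assms(1)
proof induction
  case (const c)
  show ?case using assms(2)
  proof induction
    case (const d)
    show ?case by (rule entry_poly.const)
  next
    case (add F G)
    thus ?case using entry_poly.add by (simp add: distrib_left)
  next
    case (entry F i j)
    thus ?case using entry_poly.entry[of "\<lambda>X. c * F X" i j] by (simp add: mult.left_commute)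
  qed
next
  case (add F G)
  thus ?case using entry_poly.add by (simp add: distrib_right)
next
  case (entry F i j)
  thus ?case using entry_poly.entry[of "\<lambda>X. F X * G X" i j] by (simp add: mult.assoc)
qed

lemma entry_poly_nth: "entry_poly (\<lambda>X. X $ i $ j)"
  using entry_poly.entry[OF entry_poly.const[of 1]] by simp

lemma entry_poly_sum: "(\<And>x. x \<in> A \<Longrightarrow> entry_poly (F x)) \<Longrightarrow> entry_poly (\<lambda>X. \<Sum>x\<in>A. F x X)"
  by (induction A rule: infinite_finite_induct) (auto intro: entry_poly.intros)

lemma entry_poly_prod: "(\<And>x. x \<in> A \<Longrightarrow> entry_poly (F x)) \<Longrightarrow> entry_poly (\<lambda>X. \<Prod>x\<in>A. F x X)"
  by (induction A rule: infinite_finite_induct) (auto intro: entry_poly.intros entry_poly_mult)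

lemma entry_poly_power: "entry_poly F \<Longrightarrow> entry_poly (\<lambda>X. F X ^ k)"
  by (induction k) (auto intro: entry_poly.intros entry_poly_mult)

lemma entry_poly_trace_matpow:
  assumes "\<And>i j. entry_poly (\<lambda>X. A X $ i $ j)"
  shows "entry_poly (\<lambda>X. trace (matpow (A X) k))"
proof -
  have "entry_poly (\<lambda>X. matpow (A X) k $ i $ j)" for i j
  proof (induction k arbitrary: i j)
    case 0
    show ?case by (simp add: entry_poly.const)
  next
    case (Suc k)
    thus ?case
      unfolding matpow.simps matrix_matrix_mult_def vec_lambda_beta
      by (intro entry_poly_sum entry_poly_mult assms)
  qed
  thus ?thesis unfolding trace_def by (intro entry_poly_sum)
qed

lemma entry_poly_continuous: "entry_poly F \<Longrightarrow> continuous_on UNIV F"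
  by (induction rule: entry_poly.induct) (auto intro!: continuous_intros)

section \<open>Coefficients of the exponentiated interaction\<close>

abbreviation kp_matrix :: "real^'n \<Rightarrow> complex^'n^'n \<Rightarrow> complex^'n^'n" where
  "kp_matrix lam X \<equiv> - (matrix_inv (Lam lam) ** X)"

lemma entry_poly_kp_matrix: "entry_poly (\<lambda>X. kp_matrix lam X $ i $ j)"
proof -
  have "(\<lambda>X. kp_matrix lam X $ i $ j) = (\<lambda>X. \<Sum>k\<in>UNIV. - (matrix_inv (Lam lam) $ i $ k) * X $ k $ j)"
    by (simp add: matrix_matrix_mult_def sum_negf)
  thus ?thesis by (simp only:) (intro entry_poly_sum entry_poly_mult entry_poly.const entry_poly_nth)
qed

abbreviation kp_weight :: "real^'n \<Rightarrow> complex^'n^'n \<Rightarrow> nat \<Rightarrow> complex fps" where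
  "kp_weight lam X k \<equiv> fps_const (trace (matpow (kp_matrix lam X) k)) * fps_X"

text \<open>Only powers of \<open>z\<close> divisible by 3 occur. In the variable
  \<open>z ^ 3\<close>, which counts vertices, the cubic term has degree 1 and the trace of length k
  has degree k, with the denominators k that the exponential formula requires.\<close>

lemma kp_interaction_compose:
  "kp_interaction lam X = (fps_const (fps_const (- trace (matpow X 3) / 6)) * fps_X
     + Abs_fps (\<lambda>k. kp_weight lam X k * fps_const (1 / of_nat k))) oo fps_X ^ 3" (is "_ = ?S oo _")
proof (rule fps_ext)
  fix n :: nat
  have fact3: "fact 3 = (6 :: complex)" by (simp add: fact_numeral)
  have c: "fps_const (a / b) * fps_X = fps_const a * fps_X * fps_const (1 / b)" for a b :: complex
    by (simp add: mult_ac fps_const_mult[symmetric] divide_inverse del: fps_const_mult)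
  show "fps_nth (kp_interaction lam X) n = fps_nth (?S oo fps_X ^ 3) n"
  proof (cases "3 dvd n")
    case True
    then obtain k where k: "n = 3 * k" by blast
    show ?thesis
      unfolding kp_interaction_nth fps_nth_compose_X_power[OF zero_less_numeral] c fact3
      by (cases "k = 0"; cases "k = 1") (simp_all add: k)
  next
    case False
    thus ?thesis by (auto simp: kp_interaction_nth fps_nth_compose_X_power)
  qed
qed

text \<open>The two parts of the interaction exponentiate separately. In degree \<open>a\<close> the
  part with Q contributes the cycle sum over \<open>fact a\<close>, and the cubic part fills the
  remaining degree with its explicit exponential series.\<close>

lemma exp_kp_interaction_nth:
  "fps_nth (exp_series oo kp_interaction lam X) n = (if 3 dvd n then
     \<Sum>a\<le>n div 3. fps_const ((-1 / 6) ^ (n div 3 - a) / (fact (n div 3 - a) * fact a) * trace (matpow X 3) ^ (n div 3 - a))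
       * cycle_sum (kp_weight lam X) {..<a} else 0)"
proof -
  let ?T = "fps_const (fps_const (- trace (matpow X 3) / 6)) * fps_X :: complex fps fps"
  let ?U = "Abs_fps (\<lambda>k. kp_weight lam X k * fps_const (1 / of_nat k))"
  have "exp_series oo kp_interaction lam X = ((exp_series oo ?T) * (exp_series oo ?U)) oo fps_X ^ 3"
    unfolding kp_interaction_compose
    by (subst exp_series_compose_assoc, simp, subst exp_series_compose_add) simp_all
  also have "\<dots> = (cycle_exp (kp_weight lam X) * Abs_fps (\<lambda>n. fps_const (1 / fact n) * fps_const (- trace (matpow X 3) / 6) ^ n)) oo fps_X ^ 3"
    unfolding exponential_formula exp_series_compose_monomial by (simp add: mult.commute)
  also have "fps_nth \<dots> n = (if 3 dvd n then
     \<Sum>a\<le>n div 3. fps_const ((-1 / 6) ^ (n div 3 - a) / (fact (n div 3 - a) * fact a) * trace (matpow X 3) ^ (n div 3 - a))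
       * cycle_sum (kp_weight lam X) {..<a} else 0)"
  proof -
    have "fps_nth (cycle_exp (kp_weight lam X)) a * (fps_const (1 / fact j) * fps_const (- t / 6) ^ j)
       = fps_const ((-1 / 6) ^ j / (fact j * fact a) * t ^ j) * cycle_sum (kp_weight lam X) {..<a}" for a j t
    proof -
      have "1 / fact a * (1 / fact j * (- t / 6) ^ j) = (-1 / 6) ^ j / (fact j * fact a) * t ^ j"
        by (simp add: power_mult_distrib[symmetric] field_simps)
      hence "fps_const (1 / fact a) * (fps_const (1 / fact j) * fps_const (- t / 6) ^ j)
          = fps_const ((-1 / 6) ^ j / (fact j * fact a) * t ^ j)"
        by (simp only: fps_const_power fps_const_mult)
      thus ?thesis by (simp add: cycle_exp_def mult_ac del: fps_const_mult fps_const_power)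
    qed
    thus ?thesis
      by (simp add: fps_nth_compose_X_power fps_mult_nth atLeast0AtMost del: fps_const_mult fps_const_power)
  qed
  finally show ?thesis .
qed

lemma cycle_sum_kp_weight:
  fixes S :: "'b set"
  shows "cycle_sum (kp_weight lam X) S = (\<Sum>p | p permutes S.
     fps_const (\<Prod>C\<in>cycles_on p S. trace (matpow (kp_matrix lam X) (card C))) * fps_X ^ card (cycles_on p S))"
proof -
  have "(\<Prod>C\<in>A. fps_const (g C)) = fps_const (\<Prod>C\<in>A. g C)" for A :: "'b set set" and g :: "_ \<Rightarrow> complex"
    by (induction A rule: infinite_finite_induct) simp_all
  thus ?thesis unfolding cycle_sum_def by (simp add: prod.distrib)
qed

context
  fixes lam :: "real^'n"
  assumes lam: "\<And>i. lam $ i > 0"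
begin

lemma entry_poly_integrable:
  assumes "entry_poly F"
  shows "integrable lborel (\<lambda>M. F (herm M) * of_real (gweight lam M))"
proof -
  \<comment> \<open>The statement carries an arbitrary extra monomial, so that a new entry of the
    polynomial can be absorbed into it under a fresh label; with natural numbers as labels a fresh
    one always exists.\<close>
  have "\<forall>S p. finite (S :: nat set) \<longrightarrow> integrable lborel (\<lambda>M. F (herm M) * ((\<Prod>l\<in>S. herm M $ fst (p l) $ snd (p l)) * of_real (gweight lam M)))"
    using assms
  proof induction
    case (const c)
    show ?case using herm_prod_integrable[OF lam] by (intro allI impI Bochner_Integration.integrable_mult_right)
  next
    case (add F G)
    thus ?case by (simp add: distrib_right)
  next
    case (entry F i j)
    show ?case
    proof (intro allI impI)
      fix S :: "nat set" and p :: "nat \<Rightarrow> 'n \<times> 'n" assume S: "finite S"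
      obtain a where a: "a \<notin> S" using S ex_new_if_finite infinite_UNIV_nat by blast
      have e: "(\<Prod>l\<in>insert a S. herm M $ fst ((p(a := (i, j))) l) $ snd ((p(a := (i, j))) l))
        = herm M $ i $ j * (\<Prod>l\<in>S. herm M $ fst (p l) $ snd (p l))" for M
      proof -
        have "(\<Prod>l\<in>S. herm M $ fst ((p(a := (i, j))) l) $ snd ((p(a := (i, j))) l)) = (\<Prod>l\<in>S. herm M $ fst (p l) $ snd (p l))"
          by (intro prod.cong refl) (use a in auto)
        thus ?thesis using S a by simp
      qed
      have "integrable lborel (\<lambda>M. F (herm M) * ((\<Prod>l\<in>insert a S. herm M $ fst ((p(a := (i, j))) l) $ snd ((p(a := (i, j))) l)) * of_real (gweight lam M)))"
        using entry.IH S by blast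
      thus "integrable lborel (\<lambda>M. herm M $ i $ j * F (herm M) * ((\<Prod>l\<in>S. herm M $ fst (p l) $ snd (p l)) * of_real (gweight lam M)))"
        unfolding e by (simp add: mult_ac)
    qed
  qed
  from this[rule_format, of "{}"] show ?thesis by simp
qed

abbreviation gmean :: "(complex^'n^'n \<Rightarrow> complex) \<Rightarrow> complex" where
  "gmean F \<equiv> gauss_mean lam F"

lemma gmean_integral: "entry_poly F \<Longrightarrow> gmean F = (\<integral>M. F (herm M) * of_real (gweight lam M) \<partial>lborel)"
  by (rule gauss_mean_gexp[OF lam entry_poly_continuous])

lemma gmean_cmult:
  assumes "entry_poly F"
  shows "gmean (\<lambda>X. c * F X) = c * gmean F"
  using assms by (simp add: gmean_integral entry_poly_mult entry_poly.const mult.assoc)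

lemma gmean_sum:
  assumes "\<And>x. x \<in> A \<Longrightarrow> entry_poly (F x)"
  shows "gmean (\<lambda>X. \<Sum>x\<in>A. F x X) = (\<Sum>x\<in>A. gmean (F x))"
proof -
  have "gmean (\<lambda>X. \<Sum>x\<in>A. F x X) = (\<integral>M. (\<Sum>x\<in>A. F x (herm M) * of_real (gweight lam M)) \<partial>lborel)"
    by (subst gmean_integral) (auto intro: entry_poly_sum assms simp: sum_distrib_right)
  also have "\<dots> = (\<Sum>x\<in>A. \<integral>M. F x (herm M) * of_real (gweight lam M) \<partial>lborel)"
    by (intro Bochner_Integration.integral_sum entry_poly_integrable assms)
  also have "\<dots> = (\<Sum>x\<in>A. gmean (F x))"
    by (intro sum.cong refl gmean_integral[symmetric] assms)
  finally show ?thesis .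
qed

lemma gmean_wick:
  fixes S :: "'h::linorder set"
  assumes "finite S"
  shows "gmean (\<lambda>X. \<Prod>l\<in>S. X $ fst (p l) $ snd (p l)) = wick_sum (\<lambda>x y. propagator lam (p x) (p y)) S"
  using herm_wick[OF lam assms] by (subst gmean_integral) (auto intro: entry_poly_prod entry_poly_nth)

text \<open>On the graph side \<open>b\<close> is the number of vertices off the boundary and \<open>a\<close> the number of
  boundary half-edges.\<close>

definition kp_term :: "nat \<Rightarrow> nat \<Rightarrow> complex fps" where
  "kp_term b a = Abs_fps (\<lambda>q. gmean (\<lambda>X. trace (matpow X 3) ^ b * fps_nth (cycle_sum (kp_weight lam X) {..<a}) q))"

lemma entry_poly_kp_term:
  "entry_poly (\<lambda>X. trace (matpow X 3) ^ b * fps_nth (cycle_sum (kp_weight lam X) S) q)"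
proof -
  have e: "fps_nth (cycle_sum (kp_weight lam X) S) q = (\<Sum>p | p permutes S.
     (\<Prod>C\<in>cycles_on p S. trace (matpow (kp_matrix lam X) (card C))) * (if q = card (cycles_on p S) then 1 else 0))" for X
    unfolding cycle_sum_kp_weight by (simp add: fps_sum_nth if_distrib cong: if_cong)
  show ?thesis
    unfolding e
    by (intro entry_poly_mult entry_poly_power entry_poly_sum entry_poly_prod entry_poly_trace_matpow
        entry_poly_nth entry_poly_kp_matrix entry_poly.const)
qed

lemma kp_tau_nth:
  "fps_nth (kp_tau lam) n = (if 3 dvd n then
     \<Sum>a\<le>n div 3. fps_const ((-1 / 6) ^ (n div 3 - a) / (fact (n div 3 - a) * fact a)) * kp_term (n div 3 - a) a else 0)"
proof (rule fps_ext)
  fix q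
  show "fps_nth (fps_nth (kp_tau lam) n) q = fps_nth (if 3 dvd n then
     \<Sum>a\<le>n div 3. fps_const ((-1 / 6) ^ (n div 3 - a) / (fact (n div 3 - a) * fact a)) * kp_term (n div 3 - a) a else 0) q"
  proof (cases "3 dvd n")
    case True
    have "fps_nth (fps_nth (kp_tau lam) n) q = gmean (\<lambda>X. \<Sum>a\<le>n div 3.
        (-1 / 6) ^ (n div 3 - a) / (fact (n div 3 - a) * fact a) *
        (trace (matpow X 3) ^ (n div 3 - a) * fps_nth (cycle_sum (kp_weight lam X) {..<a}) q))"
      using True by (simp add: kp_tau_def exp_kp_interaction_nth fps_sum_nth mult.assoc del: fps_const_mult)
    also have "\<dots> = (\<Sum>a\<le>n div 3. (-1 / 6) ^ (n div 3 - a) / (fact (n div 3 - a) * fact a) *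
        gmean (\<lambda>X. trace (matpow X 3) ^ (n div 3 - a) * fps_nth (cycle_sum (kp_weight lam X) {..<a}) q))"
      by (subst gmean_sum, rule entry_poly_mult[OF entry_poly.const entry_poly_kp_term])
        (intro sum.cong refl gmean_cmult entry_poly_kp_term)
    finally show ?thesis using True by (simp add: kp_term_def fps_sum_nth)
  next
    case False
    have "gmean (\<lambda>X. 0) = 0" by (simp add: gmean_integral entry_poly.const)
    thus ?thesis using False by (simp add: kp_tau_def exp_kp_interaction_nth)
  qed
qed

end

section \<open>Labelled trivalent graphs\<close>

lemma card_three_cycles:
  assumes s: "s \<in> three_perms H" and fin: "finite H"
  shows "card H = 3 * card (cycles_on s H)"
proof -
  have sp: "s permutes H" and c3: "\<And>C. C \<in> cycles_on s H \<Longrightarrow> card C = 3"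
    using s by (auto simp: three_perms_def)
  have "card (\<Union>(cycles_on s H)) = (\<Sum>C\<in>cycles_on s H. card C)"
  proof (rule card_Union_disjoint)
    show "pairwise disjnt (cycles_on s H)"
      using cycles_on_partition(2)[OF sp fin] by (auto simp: pairwise_def disjnt_def)
    show "finite C" if "C \<in> cycles_on s H" for C using c3[OF that] by (intro card_ge_0_finite) simp
  qed
  thus ?thesis using c3 by (simp add: cycles_on_partition(1)[OF sp fin])
qed

lemma three_permsD:
  assumes s: "s \<in> three_perms H" and fin: "finite H" and x: "x \<in> H"
  shows "s x \<noteq> x" "s (s x) \<noteq> x" "s (s (s x)) = x" "inv s x = s (s x)" "orbit s x = {x, s x, s (s x)}"
proof -
  have sp: "s permutes H" using s by (simp add: three_perms_def)
  have perm: "permutation s" using sp fin by (auto simp: permutation_permutes)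
  have c3: "card (orbit s x) = 3" using s x by (auto simp: three_perms_def cycles_on_def)
  have inj: "s y = s z \<longleftrightarrow> y = z" for y z using sp by (metis permutes_inj injD)
  have o: "x \<in> orbit s x" using perm by (rule permutation_self_in_orbit)
  have o1: "s x \<in> orbit s x" by (rule orbit.base)
  have o2: "s (s x) \<in> orbit s x" using o1 by (rule orbit.step)
  have o3: "s (s (s x)) \<in> orbit s x" using o2 by (rule orbit.step)
  show 1: "s x \<noteq> x"
  proof
    assume "s x = x"
    hence "orbit s x = {x}" by (simp add: orbit_eq_singleton_iff)
    thus False using c3 by simp
  qed
  show 2: "s (s x) \<noteq> x"
  proof
    assume e: "s (s x) = x"
    have "y \<in> {x, s x}" if "y \<in> orbit s x" for y
      using that by induction (auto simp: e)
    hence "card (orbit s x) \<le> card {x, s x}" by (intro card_mono) auto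
    also have "\<dots> \<le> 2" by (simp add: card_insert_if)
    finally show False using c3 by simp
  qed
  have d: "card {x, s x, s (s x)} = 3" using 1 2 inj by auto
  have fo: "finite (orbit s x)" using c3 by (metis card.infinite zero_neq_numeral)
  show orb: "orbit s x = {x, s x, s (s x)}"
    using o o1 o2 d c3 fo by (intro card_subset_eq[symmetric]) auto
  show 3: "s (s (s x)) = x" using o3 orb inj 1 2 by auto
  show "inv s x = s (s x)" using 3 sp by (metis permutes_inverses(2))
qed

text \<open>A trivalent ribbon graph amounts to a fixed-point-free permutation \<open>s\<close> of order three, a set \<open>B\<close>
  of boundary half-edges with at most one element per vertex, the permutation \<open>p\<close> that \<open>\<sigma>\<^sub>2\<close> induces
  on \<open>B\<close>, and a pairing of the remaining half-edges \<open>R\<close>: as \<open>\<sigma>\<^sub>1 = \<sigma>\<^sub>0 \<circ> \<sigma>\<^sub>2\<close>, a boundary half-edge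
  \<open>b\<close> is joined to \<open>s (p b)\<close>.\<close>

locale trivalent_data =
  fixes H :: "nat set" and s :: "nat \<Rightarrow> nat" and B :: "nat set"
  assumes fin: "finite H" and s: "s \<in> three_perms H" and B: "B \<subseteq> H" and sB: "\<And>x. x \<in> B \<Longrightarrow> s x \<notin> B"
begin

text \<open>The image of \<open>B\<close> under \<open>s\<close> consists of the partners of the
  boundary half-edges, so \<open>R\<close> is the set of half-edges of internal edges. The set
  \<open>H0\<close> below it keeps the half-edges at vertices that meet no boundary.\<close>

definition "R = H - B - s ` B"
definition "H0 = H - B - s ` B - (s \<circ> s) ` B"

text \<open>The colourings that respect the faces at the partners of boundary half-edges:
  \<open>sigma2\<close> sends the partner \<open>s (p b)\<close> to \<open>inv s b\<close>, which is
  \<open>s (s b)\<close>. The conditions on \<open>R\<close> involve the pairing and are imposed in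
  \<open>compat_cols\<close>, so this set can be summed over independently of the pairing.\<close>

definition cols :: "(nat \<Rightarrow> nat) \<Rightarrow> (nat \<Rightarrow> 'n) set" where
  "cols p = {c \<in> (H - B) \<rightarrow>\<^sub>E UNIV. \<forall>b\<in>B. c (s (s b)) = c (s (p b))}"

lemma sp: "s permutes H"
  using s by (simp add: three_perms_def)

lemma sH [simp]: "s x \<in> H \<longleftrightarrow> x \<in> H"
  using sp by (rule permutes_in_image)

lemma inj_s [simp]: "s x = s y \<longleftrightarrow> x = y"
  using sp by (metis permutes_inj injD)

lemma BH: "b \<in> B \<Longrightarrow> b \<in> H"
  using B by blast

lemma finB: "finite B"
  using B fin finite_subset by blast

lemma s3: "x \<in> H \<Longrightarrow> s (s (s x)) = x"
  using three_permsD[OF s fin] by blast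

lemma s3B: "x \<in> B \<Longrightarrow> s (s (s x)) = x"
  using s3 BH by blast

lemma inv_s: "x \<in> H \<Longrightarrow> inv s x = s (s x)"
  using three_permsD[OF s fin] by blast

lemma ssB: "x \<in> B \<Longrightarrow> s (s x) \<notin> B"
  using sB s3B by metis

lemma R_split: "R = (s \<circ> s) ` B \<union> H0" "(s \<circ> s) ` B \<inter> H0 = {}"
  using B sB ssB by (auto simp: R_def H0_def)

lemma F_cases:
  assumes "x \<in> H - B"
  obtains b where "b \<in> B" "x = s b" | b where "b \<in> B" "x = s (s b)" | "x \<in> H0"
  using assms unfolding H0_def by auto

lemma sH0: "s x \<in> H0 \<longleftrightarrow> x \<in> H0"
proof -
  have B1: "s x \<in> B \<longleftrightarrow> x \<in> (s \<circ> s) ` B" if "x \<in> H"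
  proof
    assume "s x \<in> B"
    hence "x = (s \<circ> s) (s x)" using s3[OF that] by simp
    thus "x \<in> (s \<circ> s) ` B" using \<open>s x \<in> B\<close> by blast
  next
    assume "x \<in> (s \<circ> s) ` B"
    thus "s x \<in> B" using s3B by auto
  qed
  have B2: "s x \<in> s ` B \<longleftrightarrow> x \<in> B" by auto
  have B3: "s x \<in> (s \<circ> s) ` B \<longleftrightarrow> x \<in> s ` B" by (auto simp: image_iff)
  show ?thesis using B1 B2 B3 by (auto simp: H0_def simp del: o_apply image_iff)
qed

text \<open>The vertices off the boundary are the cycles of \<open>s\<close> cut down to
  \<open>H0\<close>. Their number follows by counting half-edges: each element of \<open>B\<close>
  uses up a whole vertex, that is, three of them.\<close>

lemma cycles_H0:
  assumes "card H = 3 * m"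
  defines "s0 \<equiv> (\<lambda>x. if x \<in> H0 then s x else x)"
  shows "s0 permutes H0" "\<And>C. C \<in> cycles_on s0 H0 \<Longrightarrow> card C = 3" "card (cycles_on s0 H0) = m - card B"
    "card B \<le> m"
proof -
  have fin0: "finite H0" using fin by (simp add: H0_def)
  show p0: "s0 permutes H0"
  proof (rule bij_imp_permutes)
    have "inj_on s0 H0" by (rule inj_onI) (auto simp: s0_def)
    moreover have "s0 ` H0 \<subseteq> H0" by (auto simp: s0_def sH0)
    ultimately show "bij_betw s0 H0 H0" using fin0 by (simp add: bij_betw_def endo_inj_surj)
  qed (simp add: s0_def)
  show c3: "card C = 3" if C: "C \<in> cycles_on s0 H0" for C
  proof -
    obtain x where x: "x \<in> H0" "C = orbit s0 x" using C by (auto simp: cycles_on_def)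
    have "orbit s0 x = orbit s x"
      by (rule orbit_cong_on[of _ H0]) (auto simp: s0_def sH0 x(1))
    moreover have "x \<in> H" using x by (simp add: H0_def)
    hence "card (orbit s x) = 3" using s by (auto simp: three_perms_def cycles_on_def)
    ultimately show ?thesis using x by simp
  qed
  have h0: "card H0 = 3 * card (cycles_on s0 H0)"
    using p0 c3 fin0 by (intro card_three_cycles) (auto simp: three_perms_def)
  have i: "inj_on s B" "inj_on (s \<circ> s) B" by (auto simp: inj_on_def)
  have "H = B \<union> (s ` B \<union> ((s \<circ> s) ` B \<union> H0))" using B by (auto simp: H0_def)
  moreover have "card (B \<union> (s ` B \<union> ((s \<circ> s) ` B \<union> H0))) = card B + (card (s ` B) + (card ((s \<circ> s) ` B) + card H0))"
    using sB ssB finB fin0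
    by (subst card_Un_disjoint, simp, simp, force simp: H0_def, subst card_Un_disjoint, simp, simp, force simp: H0_def,
        subst card_Un_disjoint) (auto simp: H0_def)
  ultimately have "card H = 3 * card B + card H0" using card_image[OF i(1)] card_image[OF i(2)] by simp
  thus "card (cycles_on s0 H0) = m - card B" "card B \<le> m" using assms(1) h0 by auto
qed

lemma card_R:
  assumes "card H = 3 * m"
  shows "card R + 2 * card B = 3 * m"
proof -
  have "inj_on s B" by (auto simp: inj_on_def)
  hence "card (B \<union> s ` B) = 2 * card B"
    using sB finB by (subst card_Un_disjoint) (auto simp: card_image)
  moreover have "R = H - (B \<union> s ` B)" by (auto simp: R_def)
  hence "card R = card H - card (B \<union> s ` B)"
    using finB B by (simp only:) (rule card_Diff_subset, auto)
  moreover have "card (B \<union> s ` B) \<le> card H" using fin B by (intro card_mono) auto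
  ultimately show ?thesis using assms by simp
qed

text \<open>A colour \<open>i b\<close> for each boundary half-edge, placed at \<open>s b\<close>,
  forces the colour of \<open>s (s b)\<close>; the half-edges of \<open>H0\<close> are coloured
  freely. This separates the boundary sum from the sum over the other vertices.\<close>

lemma cols_bij:
  assumes p: "p permutes B"
  defines "\<Phi> \<equiv> (\<lambda>(i, d) x. if x \<in> s ` B then i (s (s x)) else if x \<in> (s \<circ> s) ` B then i (p (s x))
     else if x \<in> H0 then d x else undefined)"
  shows "bij_betw \<Phi> ((B \<rightarrow>\<^sub>E UNIV) \<times> (H0 \<rightarrow>\<^sub>E (UNIV :: 'n set))) (cols p)"
    and "b \<in> B \<Longrightarrow> \<Phi> (i, d) (s b) = i b" "b \<in> B \<Longrightarrow> \<Phi> (i, d) (s (s b)) = i (p b)"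
    "x \<in> H0 \<Longrightarrow> \<Phi> (i, d) x = d x"
proof -
  have pB: "p b \<in> B" if "b \<in> B" for b using p that by (simp add: permutes_in_image)
  show e1: "\<Phi> (i, d) (s b) = i b" if "b \<in> B" for i :: "nat \<Rightarrow> 'n" and b d
    using that by (auto simp: \<Phi>_def s3B)
  show e2: "\<Phi> (i, d) (s (s b)) = i (p b)" if "b \<in> B" for i :: "nat \<Rightarrow> 'n" and b d
    using that sB by (auto simp: \<Phi>_def s3B)
  show e3: "\<Phi> (i, d) x = d x" if "x \<in> H0" for i :: "nat \<Rightarrow> 'n" and d x
    using that by (auto simp: \<Phi>_def H0_def)
  have ext: "\<Phi> (i, d) x = undefined" if "x \<notin> H - B" for i :: "nat \<Rightarrow> 'n" and d x
    using that B sB ssB by (auto simp: \<Phi>_def H0_def)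
  show "bij_betw \<Phi> ((B \<rightarrow>\<^sub>E UNIV) \<times> (H0 \<rightarrow>\<^sub>E (UNIV :: 'n set))) (cols p)"
  proof (rule bij_betwI[where g = "\<lambda>c. (restrict (\<lambda>b. c (s b)) B, restrict c H0)"])
    show "\<Phi> \<in> (B \<rightarrow>\<^sub>E UNIV) \<times> (H0 \<rightarrow>\<^sub>E UNIV) \<rightarrow> cols p"
    proof
      fix x :: "(nat \<Rightarrow> 'n) \<times> (nat \<Rightarrow> 'n)"
      obtain i d where x: "x = (i, d)" by (cases x)
      show "\<Phi> x \<in> cols p" unfolding x cols_def
        using ext[of _ i d] e1[OF pB, of _ i d] e2[of _ i d] by (auto intro!: PiE_I)
    qed
    show "(\<lambda>c. (restrict (\<lambda>b. c (s b)) B, restrict c H0)) \<in> cols p \<rightarrow> (B \<rightarrow>\<^sub>E UNIV) \<times> (H0 \<rightarrow>\<^sub>E UNIV)"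
      by auto
  next
    fix x :: "(nat \<Rightarrow> 'n) \<times> (nat \<Rightarrow> 'n)" assume "x \<in> (B \<rightarrow>\<^sub>E UNIV) \<times> (H0 \<rightarrow>\<^sub>E (UNIV :: 'n set))"
    then obtain i d where x: "x = (i, d)" "i \<in> B \<rightarrow>\<^sub>E UNIV" "d \<in> H0 \<rightarrow>\<^sub>E UNIV" by blast
    have "restrict (\<lambda>b. \<Phi> (i, d) (s b)) B = i"
      using x(2) e1 by (auto simp: fun_eq_iff restrict_def PiE_def extensional_def)
    moreover have "restrict (\<Phi> (i, d)) H0 = d"
      using x(3) e3 by (auto simp: fun_eq_iff restrict_def PiE_def extensional_def)
    ultimately show "(restrict (\<lambda>b. \<Phi> x (s b)) B, restrict (\<Phi> x) H0) = x" using x by simp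
  next
    fix c :: "nat \<Rightarrow> 'n" assume c: "c \<in> cols p"
    show "\<Phi> (restrict (\<lambda>b. c (s b)) B, restrict c H0) = c"
    proof
      fix x
      show "\<Phi> (restrict (\<lambda>b. c (s b)) B, restrict c H0) x = c x"
      proof (cases "x \<in> H - B")
        case True
        thus ?thesis
        proof (cases rule: F_cases)
          case (1 b) thus ?thesis using e1 by simp
        next
          case (2 b) thus ?thesis using e2 pB c by (simp add: cols_def)
        next
          case 3 thus ?thesis using e3 by simp
        qed
      next
        case False
        moreover have "c x = undefined" using c False by (auto simp: cols_def PiE_def extensional_def)
        ultimately show ?thesis using ext by simp
      qed
    qed
  qed
qed

text \<open>Every 3-cycle off the boundary closes up to \<open>Tr X\<^sup>3\<close>, and every boundary of length \<open>k\<close> to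
  \<open>Tr (-\<Lambda>\<^sup>-\<^sup>1 X)\<^sup>k\<close> up to sign.\<close>

lemma sum_cols_traces:
  fixes X :: "complex^'n^'n"
  assumes p: "p permutes B" and m: "card H = 3 * m" and lam: "\<And>i. lam $ i > 0"
  shows "(\<Sum>c\<in>cols p. of_real (\<Prod>b\<in>B. inverse (lam $ c (s (p b)))) * (\<Prod>h\<in>R. X $ c h $ c (s (s h))))
    = (-1) ^ card B * (trace (matpow X 3) ^ (m - card B) * (\<Prod>C\<in>cycles_on p B. trace (matpow (kp_matrix lam X) (card C))))"
proof -
  define \<Phi> where "\<Phi> = (\<lambda>(i :: nat \<Rightarrow> 'n, d) x. if x \<in> s ` B then i (s (s x)) else if x \<in> (s \<circ> s) ` B then i (p (s x))
     else if x \<in> H0 then d x else undefined)"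
  note \<Phi>' = cols_bij[OF p, where 'n = 'n, folded \<Phi>_def]
  have pB: "p b \<in> B" if "b \<in> B" for b using p that by (simp add: permutes_in_image)
  define A where "A = kp_matrix lam X"
  have A: "A $ i $ j = - (of_real (inverse (lam $ i)) * X $ i $ j)" for i j
  proof -
    have "matrix_inv (Lam lam) = Lam (\<chi> i. inverse (lam $ i))"
      using lam by (intro matrix_inv_Lam) (metis less_irrefl)
    thus ?thesis by (simp add: A_def matrix_matrix_mult_def Lam_def if_distrib[of "\<lambda>x. x * _"] cong: if_cong)
  qed
  have "(\<Sum>c\<in>cols p. of_real (\<Prod>b\<in>B. inverse (lam $ c (s (p b)))) * (\<Prod>h\<in>R. X $ c h $ c (s (s h))))
    = (\<Sum>y\<in>(B \<rightarrow>\<^sub>E UNIV) \<times> (H0 \<rightarrow>\<^sub>E UNIV). of_real (\<Prod>b\<in>B. inverse (lam $ \<Phi> y (s (p b)))) * (\<Prod>h\<in>R. X $ \<Phi> y h $ \<Phi> y (s (s h))))"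
    by (rule sum.reindex_bij_betw[OF \<Phi>'(1), symmetric])
  also have "\<dots> = (\<Sum>(i, d)\<in>(B \<rightarrow>\<^sub>E UNIV) \<times> (H0 \<rightarrow>\<^sub>E UNIV).
      ((-1) ^ card B * (\<Prod>b\<in>B. A $ i (p b) $ i b)) * (\<Prod>h\<in>H0. X $ d (s h) $ d h))"
  proof (intro sum.cong refl, clarify)
    fix i d
    have 1: "(\<Prod>h\<in>(s \<circ> s) ` B. X $ \<Phi> (i, d) h $ \<Phi> (i, d) (s (s h))) = (\<Prod>b\<in>B. X $ i (p b) $ i b)"
      by (subst prod.reindex) (auto simp: inj_on_def s3B \<Phi>' intro!: prod.cong)
    have "(\<Prod>h\<in>H0. X $ \<Phi> (i, d) h $ \<Phi> (i, d) (s (s h))) = (\<Prod>h\<in>H0. X $ d h $ d (s (s h)))"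
      by (intro prod.cong refl) (simp add: \<Phi>' sH0)
    \<comment> \<open>Shifting by \<open>s\<close> turns the index pair at \<open>h\<close> and
      \<open>s (s h)\<close> into the one at \<open>s h\<close> and \<open>h\<close>, the shape
      required by \<open>sum_colorings_trace'\<close>.\<close>
    also have "\<dots> = (\<Prod>h\<in>H0. X $ d (s h) $ d (s (s (s h))))"
    proof -
      have "bij_betw s H0 H0" unfolding bij_betw_def
      proof
        show "inj_on s H0" by (auto simp: inj_on_def)
        have "finite H0" using fin by (simp add: H0_def)
        thus "s ` H0 = H0" by (rule endo_inj_surj) (auto simp: sH0 inj_on_def)
      qed
      thus ?thesis by (rule prod.reindex_bij_betw[symmetric])
    qed
    also have "\<dots> = (\<Prod>h\<in>H0. X $ d (s h) $ d h)"
      by (intro prod.cong refl) (simp add: s3 H0_def)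
    finally have 2: "(\<Prod>h\<in>H0. X $ \<Phi> (i, d) h $ \<Phi> (i, d) (s (s h))) = (\<Prod>h\<in>H0. X $ d (s h) $ d h)" .
    have "(\<Prod>h\<in>R. X $ \<Phi> (i, d) h $ \<Phi> (i, d) (s (s h))) = (\<Prod>b\<in>B. X $ i (p b) $ i b) * (\<Prod>h\<in>H0. X $ d (s h) $ d h)"
      unfolding R_split(1) 1[symmetric] 2[symmetric] using finB fin R_split(2)
      by (intro prod.union_disjoint) (auto simp: H0_def)
    \<comment> \<open>The boundary edge at \<open>b\<close> divides by the eigenvalue with index
      \<open>i (p b)\<close>, which is the row index of its entry of \<open>X\<close>; this makes
      the entry one of \<open>- A\<close>, hence one sign per element of \<open>B\<close>.\<close>
    moreover have "complex_of_real (\<Prod>b\<in>B. inverse (lam $ \<Phi> (i, d) (s (p b)))) * (\<Prod>b\<in>B. X $ i (p b) $ i b)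
        = (-1) ^ card B * (\<Prod>b\<in>B. A $ i (p b) $ i b)"
      unfolding of_real_prod prod.distrib[symmetric] prod_constant[symmetric]
      by (intro prod.cong refl) (simp add: \<Phi>' pB A)
    ultimately show "complex_of_real (\<Prod>b\<in>B. inverse (lam $ \<Phi> (i, d) (s (p b)))) * (\<Prod>h\<in>R. X $ \<Phi> (i, d) h $ \<Phi> (i, d) (s (s h)))
      = ((-1) ^ card B * (\<Prod>b\<in>B. A $ i (p b) $ i b)) * (\<Prod>h\<in>H0. X $ d (s h) $ d h)"
      by (simp add: mult.assoc[symmetric])
  qed
  also have "\<dots> = (\<Sum>i\<in>B \<rightarrow>\<^sub>E UNIV. (-1) ^ card B * (\<Prod>b\<in>B. A $ i (p b) $ i b)) * (\<Sum>d\<in>H0 \<rightarrow>\<^sub>E UNIV. \<Prod>h\<in>H0. X $ d (s h) $ d h)"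
    by (simp only: sum_product sum.cartesian_product)
  also have "(\<Sum>i\<in>B \<rightarrow>\<^sub>E UNIV. (-1) ^ card B * (\<Prod>b\<in>B. A $ i (p b) $ i b))
      = (-1) ^ card B * (\<Prod>C\<in>cycles_on p B. trace (matpow A (card C)))"
    unfolding sum_distrib_left[symmetric] sum_colorings_trace'[OF finB p] ..
  also have "(\<Sum>d\<in>H0 \<rightarrow>\<^sub>E UNIV. \<Prod>h\<in>H0. X $ d (s h) $ d h) = trace (matpow X 3) ^ (m - card B)"
  proof -
    let ?s0 = "\<lambda>x. if x \<in> H0 then s x else x"
    have "(\<Sum>d\<in>H0 \<rightarrow>\<^sub>E UNIV. \<Prod>h\<in>H0. X $ d (s h) $ d h) = (\<Sum>d\<in>H0 \<rightarrow>\<^sub>E UNIV. \<Prod>h\<in>H0. X $ d (?s0 h) $ d h)"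
      by (intro sum.cong prod.cong refl) simp
    also have "\<dots> = (\<Prod>C\<in>cycles_on ?s0 H0. trace (matpow X (card C)))"
      using fin cycles_H0(1)[OF m] by (intro sum_colorings_trace') (simp_all add: H0_def)
    also have "\<dots> = (\<Prod>C\<in>cycles_on ?s0 H0. trace (matpow X 3))"
      using cycles_H0(2)[OF m] by (intro prod.cong refl) simp
    also have "\<dots> = trace (matpow X 3) ^ (m - card B)"
      using cycles_H0(3)[OF m] by simp
    finally show ?thesis .
  qed
  finally show ?thesis by (simp add: A_def mult_ac)
qed

end

text \<open>\<open>kp_term\<close> uses permutations of an initial segment of the naturals. The
  cycle sum depends only on the size of the set, so the boundary half-edges themselves may take its
  place.\<close>

lemma kp_term_permutations:
  fixes B :: "nat set"
  assumes lam: "\<And>i. lam $ i > 0" and B: "finite B"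
  shows "kp_term lam b (card B) = (\<Sum>p | p permutes B.
     fps_const (gauss_mean lam (\<lambda>X. trace (matpow X 3) ^ b * (\<Prod>C\<in>cycles_on p B. trace (matpow (kp_matrix lam X) (card C)))))
       * fps_X ^ card (cycles_on p B))"
proof (rule fps_ext)
  fix q
  let ?T = "\<lambda>p X. trace (matpow X 3) ^ b * (\<Prod>C\<in>cycles_on p B. trace (matpow (kp_matrix lam X) (card C)))"
  let ?\<delta> = "\<lambda>p. (if q = card (cycles_on p B) then 1 else 0) :: complex"
  have pT: "entry_poly (?T p)" for p
    by (intro entry_poly_mult entry_poly_power entry_poly_prod entry_poly_trace_matpow
        entry_poly_nth entry_poly_kp_matrix)
  have "cycle_sum (kp_weight lam X) {..<card B} = cycle_sum (kp_weight lam X) B" for X :: "complex^'a^'a"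
    using B by (intro cycle_sum_card) auto
  hence "trace (matpow X 3) ^ b * fps_nth (cycle_sum (kp_weight lam X) {..<card B}) q
      = (\<Sum>p | p permutes B. ?\<delta> p * ?T p X)" for X
    by (simp only: cycle_sum_kp_weight fps_sum_nth sum_distrib_left) (intro sum.cong refl, simp)
  hence "fps_nth (kp_term lam b (card B)) q = gauss_mean lam (\<lambda>X. \<Sum>p | p permutes B. ?\<delta> p * ?T p X)"
    unfolding kp_term_def[OF lam] by simp
  also have "\<dots> = (\<Sum>p | p permutes B. ?\<delta> p * gauss_mean lam (?T p))"
    by (subst gmean_sum[OF lam], rule entry_poly_mult[OF entry_poly.const pT])
      (intro sum.cong refl gmean_cmult[OF lam] pT)
  finally show "fps_nth (kp_term lam b (card B)) q = fps_nth (\<Sum>p | p permutes B.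
     fps_const (gauss_mean lam (?T p)) * fps_X ^ card (cycles_on p B)) q"
    by (simp add: fps_sum_nth mult.commute if_distrib cong: if_cong)
qed

section \<open>The sum over pairings and colourings for fixed vertices and boundary
  half-edges\<close>

context trivalent_data
begin

definition compat_cols :: "(nat \<Rightarrow> nat) \<Rightarrow> (nat \<Rightarrow> nat) \<Rightarrow> (nat \<Rightarrow> 'n) set" where
  "compat_cols p t = {c \<in> cols p. \<forall>x\<in>R. c (s (s (t x))) = c x}"

lemma finR: "finite R"
  using fin by (simp add: R_def)

lemma finite_cols: "finite (cols p :: (nat \<Rightarrow> 'n::finite) set)"
  by (rule finite_subset[of _ "(H - B) \<rightarrow>\<^sub>E UNIV"]) (auto simp: cols_def fin intro!: finite_PiE)

text \<open>The half-edge \<open>x\<close> stands for the matrix entry with indices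
  \<open>c x\<close> and \<open>c (s (s x))\<close>. The two index equations in the covariance of
  \<open>x\<close> and \<open>t x\<close> are the colouring conditions at \<open>x\<close> and at
  \<open>t x\<close>, and each of the \<open>card R div 2\<close> covariances brings a factor
  2.\<close>

lemma prod_propagator:
  fixes c :: "nat \<Rightarrow> 'n::finite"
  assumes t: "t \<in> pairings R" and lam: "\<And>i. lam $ i > 0"
  shows "(\<Prod>x\<in>{x \<in> R. x < t x}. propagator lam (c x, c (s (s x))) (c (t x), c (s (s (t x)))))
    = (if \<forall>x\<in>R. c (s (s (t x))) = c x then
         of_real (2 ^ (card R div 2) * (\<Prod>x\<in>{x \<in> R. x < t x}. inverse (lam $ c x + lam $ c (t x)))) else 0)"
proof -
  have tt: "t (t x) = x" "t x \<noteq> x" if "x \<in> R" for x using t that by (auto simp: pairings_def)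
  have tR: "t x \<in> R" if "x \<in> R" for x
    using t that by (auto simp: pairings_def permutes_in_image)
  show ?thesis
  proof (cases "\<forall>x\<in>R. c (s (s (t x))) = c x")
    case True
    have "(\<Prod>x\<in>{x \<in> R. x < t x}. propagator lam (c x, c (s (s x))) (c (t x), c (s (s (t x)))))
        = (\<Prod>x\<in>{x \<in> R. x < t x}. of_real (2 * inverse (lam $ c x + lam $ c (t x))))"
    proof (intro prod.cong refl)
      fix x assume "x \<in> {x \<in> R. x < t x}"
      hence x: "x \<in> R" by simp
      have "c (s (s (t x))) = c x" "c (s (s x)) = c (t x)" using True x tR[OF x] tt[OF x] by metis+
      thus "propagator lam (c x, c (s (s x))) (c (t x), c (s (s (t x)))) = of_real (2 * inverse (lam $ c x + lam $ c (t x)))"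
        by (simp add: propagator_def[OF lam] divide_inverse)
    qed
    also have "\<dots> = of_real (2 ^ card {x \<in> R. x < t x} * (\<Prod>x\<in>{x \<in> R. x < t x}. inverse (lam $ c x + lam $ c (t x))))"
      by (simp only: of_real_prod[symmetric] prod.distrib prod_constant)
    finally show ?thesis using True pairings_card[OF t finR] by simp
  next
    case False
    then obtain x where x: "x \<in> R" "c (s (s (t x))) \<noteq> c x" by blast
    \<comment> \<open>The representative of the pair of \<open>x\<close>. A violated condition at
      \<open>x\<close> makes the covariance of that pair vanish whichever end represents it.\<close>
    define y where "y = (if x < t x then x else t x)"
    have y: "y \<in> {x \<in> R. x < t x}" using tR[OF x(1)] tt[OF x(1)] x(1) by (auto simp: y_def)
    have "propagator lam (c y, c (s (s y))) (c (t y), c (s (s (t y)))) = 0"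
      using x tt[OF x(1)] by (auto simp: y_def propagator_def[OF lam])
    hence "(\<Prod>x\<in>{x \<in> R. x < t x}. propagator lam (c x, c (s (s x))) (c (t x), c (s (s (t x))))) = 0"
      using y finR by (intro prod_zero) auto
    thus ?thesis using False by auto
  qed
qed

text \<open>The weight of the corresponding graph before division by automorphisms:
  \<open>card R div 2\<close> internal edges, \<open>card B\<close> boundary edges and
  \<open>m\<close> vertices.\<close>

definition data_weight :: "real^'n \<Rightarrow> nat \<Rightarrow> (nat \<Rightarrow> nat) \<Rightarrow> (nat \<Rightarrow> nat) \<Rightarrow> (nat \<Rightarrow> 'n) \<Rightarrow> complex fps" where
  "data_weight lam m p t c = fps_const (of_real (2 powi (int (card R div 2 + card B) - int m) *
     ((\<Prod>b\<in>B. inverse (lam $ c (s (p b)))) * (\<Prod>x\<in>{x \<in> R. x < t x}. inverse (lam $ c x + lam $ c (t x))))))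
     * fps_X ^ card (cycles_on p B)"

lemma sum_data_weight:
  assumes m: "card H = 3 * m" and lam: "\<And>i. lam $ i > 0"
  shows "(\<Sum>p | p permutes B. \<Sum>t\<in>pairings R. \<Sum>c\<in>compat_cols p t. data_weight lam m p t c)
    = fps_const ((-1 / 2) ^ (m - card B)) * kp_term lam (m - card B) (card B)"
proof -
  define a where "a = card B"
  have am: "a \<le> m" using cycles_H0(4)[OF m] by (simp add: a_def)
  define r where "r = card R div 2"
  \<comment> \<open>The \<open>2 ^ r\<close> belongs to the \<open>r\<close> covariances; one factor
    1/2 remains for each of the \<open>m - a\<close> vertices off the boundary.\<close>
  have pow: "2 powi (int (r + a) - int m) = (1 / 2) ^ (m - a) * (2 :: real) ^ r"
  proof -
    have "(2 :: real) powi (int (r + a) - int m) = 2 powi int r * 2 powi (- int (m - a))"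
      using am by (subst power_int_add[symmetric]) (simp_all add: of_nat_diff algebra_simps)
    thus ?thesis by (simp add: power_int_minus power_divide inverse_eq_divide)
  qed
  define T where "T = (\<lambda>p X. trace (matpow X 3) ^ (m - a) * (\<Prod>C\<in>cycles_on p B. trace (matpow (kp_matrix lam X) (card C))))"
  have pT: "entry_poly (T p)" for p unfolding T_def
    by (intro entry_poly_mult entry_poly_power entry_poly_prod entry_poly_trace_matpow
        entry_poly_nth entry_poly_kp_matrix)
  have inner: "(\<Sum>t\<in>pairings R. \<Sum>c\<in>compat_cols p t. data_weight lam m p t c)
    = fps_const ((1 / 2) ^ (m - a) * (-1) ^ a) * (fps_const (gauss_mean lam (T p)) * fps_X ^ card (cycles_on p B))"
    if p: "p permutes B" for p
  proof -
    let ?b = "\<lambda>c. \<Prod>b\<in>B. inverse (lam $ c (s (p b)))"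
    let ?i = "\<lambda>t c. \<Prod>x\<in>{x \<in> R. x < t x}. inverse (lam $ c x + lam $ c (t x))"
    let ?K = "\<lambda>c x y. propagator lam (c x, c (s (s x))) (c y, c (s (s y)))"
    have "(\<Sum>t\<in>pairings R. \<Sum>c\<in>compat_cols p t. of_real (2 powi (int (r + a) - int m) * (?b c * ?i t c)))
      = (\<Sum>t\<in>pairings R. \<Sum>c\<in>cols p. (1 / 2) ^ (m - a) * (of_real (?b c) * (\<Prod>x\<in>{x \<in> R. x < t x}. ?K c x (t x))))"
    proof (rule sum.cong[OF refl])
      fix t assume t: "t \<in> pairings R"
      have "(\<Sum>c\<in>compat_cols p t. of_real (2 powi (int (r + a) - int m) * (?b c * ?i t c)))
        = (\<Sum>c\<in>cols p. if \<forall>x\<in>R. c (s (s (t x))) = c x then of_real (2 powi (int (r + a) - int m) * (?b c * ?i t c)) else (0::complex))"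
        unfolding compat_cols_def by (rule sum.inter_filter[OF finite_cols])
      also have "\<dots> = (\<Sum>c\<in>cols p. (1 / 2) ^ (m - a) * (of_real (?b c) * (\<Prod>x\<in>{x \<in> R. x < t x}. ?K c x (t x))))"
        unfolding prod_propagator[OF t lam] pow r_def[symmetric]
        by (intro sum.cong refl) (simp add: mult_ac)
      finally show "(\<Sum>c\<in>compat_cols p t. of_real (2 powi (int (r + a) - int m) * (?b c * ?i t c)))
        = (\<Sum>c\<in>cols p. (1 / 2) ^ (m - a) * (of_real (?b c) * (\<Prod>x\<in>{x \<in> R. x < t x}. ?K c x (t x))))" .
    qed
    \<comment> \<open>The conditions on \<open>R\<close> are now encoded in vanishing covariances,
      so the set of colourings no longer depends on \<open>t\<close>. The sums can be exchanged, and
      for each colouring the pairings form a Wick sum.\<close>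
    also have "\<dots> = (1 / 2) ^ (m - a) * (\<Sum>c\<in>cols p. of_real (?b c) * wick_sum (?K c) R)"
      unfolding wick_sum_def sum_distrib_left by (rule sum.swap)
    also have "(\<Sum>c\<in>cols p. of_real (?b c) * wick_sum (?K c) R)
      = (\<Sum>c\<in>cols p. gauss_mean lam (\<lambda>X. of_real (?b c) * (\<Prod>h\<in>R. X $ c h $ c (s (s h)))))"
    proof (intro sum.cong refl)
      fix c :: "nat \<Rightarrow> 'a"
      show "of_real (?b c) * wick_sum (?K c) R = gauss_mean lam (\<lambda>X. of_real (?b c) * (\<Prod>h\<in>R. X $ c h $ c (s (s h))))"
        using gmean_wick[OF lam finR, of "\<lambda>x. (c x, c (s (s x)))"]
        by (subst gmean_cmult[OF lam]) (auto intro: entry_poly_prod entry_poly_nth)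
    qed
    also have "\<dots> = gauss_mean lam (\<lambda>X. \<Sum>c\<in>cols p. of_real (?b c) * (\<Prod>h\<in>R. X $ c h $ c (s (s h))))"
      by (rule gmean_sum[OF lam, symmetric])
        (intro entry_poly_mult entry_poly.const entry_poly_prod entry_poly_nth)
    also have "\<dots> = gauss_mean lam (\<lambda>X. (-1) ^ a * T p X)"
      unfolding sum_cols_traces[OF p m lam] T_def a_def ..
    also have "\<dots> = (-1) ^ a * gauss_mean lam (T p)"
      by (rule gmean_cmult[OF lam pT])
    finally have "(\<Sum>t\<in>pairings R. \<Sum>c\<in>compat_cols p t. of_real (2 powi (int (r + a) - int m) * (?b c * ?i t c)))
      = (1 / 2) ^ (m - a) * ((-1) ^ a * gauss_mean lam (T p))" .
    moreover have "(\<Sum>t\<in>pairings R. \<Sum>c\<in>compat_cols p t. data_weight lam m p t c)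
      = fps_const (\<Sum>t\<in>pairings R. \<Sum>c\<in>compat_cols p t. of_real (2 powi (int (r + a) - int m) * (?b c * ?i t c)))
        * fps_X ^ card (cycles_on p B)"
    proof -
      have fs: "fps_const (\<Sum>x\<in>A. f x) = (\<Sum>x\<in>A. fps_const (f x))" for A and f :: "_ \<Rightarrow> complex"
        by (induction A rule: infinite_finite_induct) (simp_all add: fps_const_add[symmetric] del: fps_const_add)
      show ?thesis by (simp only: data_weight_def fs sum_distrib_right r_def a_def)
    qed
    ultimately show ?thesis by (simp add: mult.assoc)
  qed
  have total: "(\<Sum>p | p permutes B. \<Sum>t\<in>pairings R. \<Sum>c\<in>compat_cols p t. data_weight lam m p t c)
    = fps_const ((1 / 2) ^ (m - a) * (-1) ^ a) * kp_term lam (m - a) a"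
    unfolding a_def kp_term_permutations[OF lam finB] sum_distrib_left
    by (intro sum.cong refl) (use inner in \<open>simp add: T_def a_def\<close>)
  show ?thesis
  \<comment> \<open>The traces came with the sign (-1)^a, while the claim has (-1)^(m - a). For even
    \<open>m\<close> these agree; for odd \<open>m\<close> the set \<open>R\<close> has odd size and
    admits no pairing, which forces the expectation, and thus both sides, to vanish.\<close>
  proof (cases "even m")
    case True
    hence "(-1) ^ a = ((-1) ^ (m - a) :: complex)" using am by (simp add: minus_one_power_iff)
    hence "(1 / 2) ^ (m - a) * (-1) ^ a = ((-1 / 2) ^ (m - a) :: complex)"
      by (simp add: power_mult_distrib[symmetric] mult.commute)
    thus ?thesis unfolding total by (simp add: a_def)
  next
    case False
    have "pairings R = {}"
    proof (rule ccontr)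
      assume "pairings R \<noteq> {}"
      then obtain t where "t \<in> pairings R" by blast
      hence "even (card R)" using pairings_card finR by fastforce
      hence "even (card R + 2 * card B)" by simp
      thus False unfolding card_R[OF m] using False by simp
    qed
    hence "fps_const ((1 / 2) ^ (m - a) * (-1) ^ a) * kp_term lam (m - a) a = 0"
      unfolding total[symmetric] by simp
    hence "kp_term lam (m - a) a = 0" by (simp add: fps_const_eq_0_iff)
    thus ?thesis unfolding total by (simp add: a_def)
  qed
qed

end

section \<open>Counting the sets of boundary half-edges\<close>

definition boundary_sets :: "'h set \<Rightarrow> ('h \<Rightarrow> 'h) \<Rightarrow> 'h set set" where
  "boundary_sets H s = {B. B \<subseteq> H \<and> (\<forall>x\<in>B. s x \<notin> B)}"

text \<open>Of any two points of a 3-cycle one is the successor of the other, so a set without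
  successors of its own points contains at most one of them.\<close>

lemma boundary_set_Int_orbit:
  assumes "finite H" "s \<in> three_perms H" and B: "B \<in> boundary_sets H s" and x: "x \<in> B"
  shows "B \<inter> orbit s x = {x}"
proof -
  have xH: "x \<in> H" using B x by (auto simp: boundary_sets_def)
  have nB: "s y \<notin> B" if "y \<in> B" for y using B that by (auto simp: boundary_sets_def)
  have "s x \<notin> B" using nB[OF x] .
  moreover have "s (s x) \<notin> B" using nB[of "s (s x)"] x three_permsD(3)[OF assms(2,1) xH] by auto
  ultimately show ?thesis using x three_permsD(5)[OF assms(2,1) xH] by auto
qed

text \<open>A boundary set is a choice of one point in each of the 3-cycles that it meets.\<close>

lemma boundary_sets_bij:
  assumes fin: "finite H" and s: "s \<in> three_perms H"
  shows "bij_betw (\<lambda>(V, g). g ` V) (SIGMA V:Pow (cycles_on s H). PiE V (\<lambda>C. C)) (boundary_sets H s)"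
proof (rule bij_betwI[where g = "\<lambda>B. (orbit s ` B, \<lambda>C\<in>orbit s ` B. THE x. x \<in> B \<inter> C)"])
  have sp: "s permutes H" using s by (simp add: three_perms_def)
  note part = cycles_on_partition[OF sp fin]
  have sC: "s x \<in> C" if "C \<in> cycles_on s H" "x \<in> C" for x C
    using part(2)[OF that] by (metis orbit.base)
  have sx: "s x \<noteq> x" if "x \<in> H" for x using three_permsD[OF s fin that] by blast
  show adm: "(\<lambda>(V, g). g ` V) \<in> (SIGMA V:Pow (cycles_on s H). PiE V (\<lambda>C. C)) \<rightarrow> boundary_sets H s"
  proof safe
    fix V g assume V: "V \<subseteq> cycles_on s H" and g: "g \<in> PiE V (\<lambda>C. C)"
    have gC: "g C \<in> C" if "C \<in> V" for C using g that by auto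
    have "g C \<in> H" if "C \<in> V" for C using gC[OF that] V that part(1) by blast
    moreover have "s (g C) \<noteq> g D" if "C \<in> V" "D \<in> V" for C D
    proof
      assume e: "s (g C) = g D"
      have "g D \<in> C" using sC[of C "g C"] gC[OF that(1)] V that e by auto
      moreover have "C \<in> cycles_on s H" "D \<in> cycles_on s H" using V that by auto
      ultimately have "C = D" using part(2)[of C "g D"] part(2)[of D "g D"] gC[OF that(2)] by metis
      thus False using e sx[of "g C"] \<open>\<And>C. C \<in> V \<Longrightarrow> g C \<in> H\<close> that by metis
    qed
    ultimately show "g ` V \<in> boundary_sets H s" by (auto simp: boundary_sets_def)
  qed
  show "(\<lambda>B. (orbit s ` B, \<lambda>C\<in>orbit s ` B. THE x. x \<in> B \<inter> C)) \<in> boundary_sets H s \<rightarrow>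
      (SIGMA V:Pow (cycles_on s H). PiE V (\<lambda>C. C))"
  proof
    fix B assume B: "B \<in> boundary_sets H s"
    have "(THE x. x \<in> B \<inter> C) \<in> C" if C: "C \<in> orbit s ` B" for C
    proof -
      obtain x where x: "x \<in> B" "C = orbit s x" using C by blast
      have "x \<in> orbit s x" using boundary_set_Int_orbit[OF fin s B x(1)] by blast
      thus ?thesis unfolding x(2) boundary_set_Int_orbit[OF fin s B x(1)] by simp
    qed
    moreover have "orbit s ` B \<subseteq> cycles_on s H" using B by (auto simp: boundary_sets_def cycles_on_def)
    ultimately show "(orbit s ` B, \<lambda>C\<in>orbit s ` B. THE x. x \<in> B \<inter> C) \<in> (SIGMA V:Pow (cycles_on s H). PiE V (\<lambda>C. C))"
      by auto
  qed
  fix y assume y: "y \<in> (SIGMA V:Pow (cycles_on s H). PiE V (\<lambda>C. C))"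
  then obtain V g where Vg: "y = (V, g)" "V \<subseteq> cycles_on s H" "g \<in> PiE V (\<lambda>C. C)" by blast
  have o: "orbit s (g C) = C" if "C \<in> V" for C
  proof -
    have "g C \<in> C" using Vg that by auto
    thus ?thesis using part(2)[of C "g C"] Vg(2) that by auto
  qed
  have B: "g ` V \<in> boundary_sets H s" using funcset_mem[OF adm y] Vg(1) by simp
  have "orbit s ` g ` V = V" using o by (auto simp: image_image)
  moreover have "(\<lambda>C\<in>V. THE x. x \<in> g ` V \<inter> C) = g"
  proof
    fix C
    show "(\<lambda>C\<in>V. THE x. x \<in> g ` V \<inter> C) C = g C"
    proof (cases "C \<in> V")
      case True
      have "g ` V \<inter> C = {g C}" using boundary_set_Int_orbit[OF fin s B, of "g C"] True o[OF True] by simp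
      hence "(THE x. x \<in> g ` V \<inter> C) = g C" by (simp only: singleton_iff the_eq_trivial)
      thus ?thesis using True by (simp only: restrict_apply if_True)
    next
      case False
      thus ?thesis using PiE_arb[OF Vg(3) False] by simp
    qed
  qed
  ultimately show "(orbit s ` (case y of (V, g) \<Rightarrow> g ` V), \<lambda>C\<in>orbit s ` (case y of (V, g) \<Rightarrow> g ` V). THE x. x \<in> (case y of (V, g) \<Rightarrow> g ` V) \<inter> C) = y"
    using Vg(1) by simp
next
  fix B assume B: "B \<in> boundary_sets H s"
  have "(THE y. y \<in> B \<inter> orbit s x) = x" if x: "x \<in> B" for x
  proof -
    show ?thesis unfolding boundary_set_Int_orbit[OF fin s B x] by simp
  qed
  thus "(case (orbit s ` B, \<lambda>C\<in>orbit s ` B. THE x. x \<in> B \<inter> C) of (V, g) \<Rightarrow> g ` V) = B"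
    by (simp add: image_image)
qed

lemma sum_boundary_sets:
  fixes f :: "nat \<Rightarrow> 'r::comm_semiring_1"
  assumes fin: "finite H" and s: "s \<in> three_perms H" and m: "card H = 3 * m"
  shows "(\<Sum>B\<in>boundary_sets H s. f (card B)) = (\<Sum>a\<le>m. of_nat (m choose a) * 3 ^ a * f a)"
proof -
  let ?V = "cycles_on s H"
  have sp: "s permutes H" using s by (simp add: three_perms_def)
  note part = cycles_on_partition[OF sp fin]
  have c3: "card C = 3" if "C \<in> ?V" for C using s that by (simp add: three_perms_def)
  have mV: "card ?V = m" using m card_three_cycles[OF s fin] by simp
  have "(\<Sum>B\<in>boundary_sets H s. f (card B)) = (\<Sum>(V, g)\<in>(SIGMA V:Pow ?V. PiE V (\<lambda>C. C)). f (card (g ` V)))"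
    by (subst sum.reindex_bij_betw[OF boundary_sets_bij[OF fin s], symmetric]) (simp add: case_prod_beta)
  also have "\<dots> = (\<Sum>(V, g)\<in>(SIGMA V:Pow ?V. PiE V (\<lambda>C. C)). f (card V))"
  proof (intro sum.cong refl, clarify)
    fix V g assume V: "V \<subseteq> ?V" and g: "g \<in> PiE V (\<lambda>C. C)"
    have "inj_on g V"
    proof (rule inj_onI)
      fix C D assume CD: "C \<in> V" "D \<in> V" "g C = g D"
      have gC: "g C \<in> C" "g C \<in> D"
        using PiE_mem[OF g CD(1)] PiE_mem[OF g CD(2)] unfolding CD(3) by this+
      have CV: "C \<in> ?V" "D \<in> ?V" using V CD(1,2) by auto
      show "C = D" using part(2)[OF CV(1) gC(1)] part(2)[OF CV(2) gC(2)] by (rule trans[OF _ sym])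
    qed
    thus "f (card (g ` V)) = f (card V)" by (simp add: card_image)
  qed
  also have "\<dots> = (\<Sum>V\<in>Pow ?V. \<Sum>g\<in>PiE V (\<lambda>C. C). f (card V))"
  proof (rule sum.Sigma[symmetric])
    show "finite (Pow ?V)" using part(3) by simp
    show "\<forall>V\<in>Pow ?V. finite (PiE V (\<lambda>C. C))"
    proof
      fix V assume V: "V \<in> Pow ?V"
      hence "finite V" using part(3) finite_subset by blast
      moreover have "finite C" if "C \<in> V" for C
        using c3[of C] that V by (intro card_ge_0_finite) auto
      ultimately show "finite (PiE V (\<lambda>C. C))" by (intro finite_PiE) auto
    qed
  qed
  also have "\<dots> = (\<Sum>V\<in>Pow ?V. 3 ^ card V * f (card V))"
  proof (intro sum.cong refl)
    fix V assume V: "V \<in> Pow ?V"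
    hence "finite V" using part(3) finite_subset by blast
    hence "card (PiE V (\<lambda>C. C)) = 3 ^ card V" using V c3 by (simp add: card_PiE subset_iff)
    thus "(\<Sum>g\<in>PiE V (\<lambda>C. C). f (card V)) = 3 ^ card V * f (card V)" by simp
  qed
  also have "\<dots> = (\<Sum>a\<le>m. \<Sum>V\<in>{V \<in> Pow ?V. card V = a}. 3 ^ card V * f (card V))"
    using part(3) mV by (intro sum.group[symmetric]) (auto intro: card_mono)
  also have "\<dots> = (\<Sum>a\<le>m. of_nat (m choose a) * 3 ^ a * f a)"
  proof (intro sum.cong refl)
    fix a
    have "(\<Sum>V\<in>{V \<in> Pow ?V. card V = a}. 3 ^ card V * f (card V)) = (\<Sum>V\<in>{V \<in> Pow ?V. card V = a}. 3 ^ a * f a)"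
      by (intro sum.cong) auto
    thus "(\<Sum>V\<in>{V \<in> Pow ?V. card V = a}. 3 ^ card V * f (card V)) = of_nat (m choose a) * 3 ^ a * f a"
      using n_subsets[OF part(3), of a] mV by (simp add: mult.assoc)
  qed
  finally show ?thesis .
qed

section \<open>The graph built from the data\<close>

lemma orbit_involution:
  assumes "f (f x) = x"
  shows "orbit f x = {x, f x}"
proof
  show "orbit f x \<subseteq> {x, f x}"
  proof
    fix y assume "y \<in> orbit f x"
    thus "y \<in> {x, f x}" by induction (use assms in auto)
  qed
  have "f x \<in> orbit f x" by (rule orbit.base)
  moreover from this have "f (f x) \<in> orbit f x" by (rule orbit.step)
  ultimately show "{x, f x} \<subseteq> orbit f x" using assms by auto
qed

text \<open>On \<open>B\<close> the involution is dictated by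
  \<open>sigma1 = sigma0 \<circ> sigma2\<close>. The second branch inverts the first: at
  \<open>s (p b)\<close> it applies \<open>s\<close> twice more, which returns to
  \<open>p b\<close>, and then \<open>inv p\<close>.\<close>

definition data_graph :: "nat set \<Rightarrow> (nat \<Rightarrow> nat) \<Rightarrow> nat set \<Rightarrow> (nat \<Rightarrow> nat) \<Rightarrow> (nat \<Rightarrow> nat) \<Rightarrow> nat ribbon_graph" where
  "data_graph H s B p t =
    (let s1 = (\<lambda>x. if x \<in> B then s (p x) else if x \<in> s ` B then inv p (s (s x)) else t x)
     in \<lparr>half_edges = H, sigma0 = s, sigma1 = s1, sigma2 = inv s \<circ> s1, bdry = B\<rparr>)"

locale trivalent_graph_data = trivalent_data +
  fixes p t :: "nat \<Rightarrow> nat"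
  assumes p: "p permutes B" and t: "t \<in> pairings R"
begin

abbreviation "G \<equiv> data_graph H s B p t"

definition s1 :: "nat \<Rightarrow> nat" where
  "s1 = (\<lambda>x. if x \<in> B then s (p x) else if x \<in> s ` B then inv p (s (s x)) else t x)"

lemma G_simps [simp]:
  "half_edges G = H" "sigma0 G = s" "sigma1 G = s1" "sigma2 G = inv s \<circ> s1" "bdry G = B"
  by (simp_all add: data_graph_def s1_def Let_def)

lemma pB: "p b \<in> B \<longleftrightarrow> b \<in> B"
  using p by (rule permutes_in_image)

lemma ipB: "inv p b \<in> B \<longleftrightarrow> b \<in> B"
  using permutes_inv[OF p] by (rule permutes_in_image)

lemma tp: "t permutes R"
  using t by (simp add: pairings_def)

lemma tR: "t x \<in> R \<longleftrightarrow> x \<in> R"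
  using tp by (rule permutes_in_image)

lemma tt: "x \<in> R \<Longrightarrow> t (t x) = x" "x \<in> R \<Longrightarrow> t x \<noteq> x"
  using t by (auto simp: pairings_def)

lemma s1_B: "b \<in> B \<Longrightarrow> s1 b = s (p b)"
  by (simp add: s1_def)

lemma s1_sB: "b \<in> B \<Longrightarrow> s1 (s (p b)) = b"
  using sB[of "p b"] pB[of b] permutes_inverses(2)[OF p] by (auto simp: s1_def s3B)

lemma s1_R: "x \<in> R \<Longrightarrow> s1 x = t x"
  by (auto simp: s1_def R_def)

lemma H_cases:
  assumes "x \<in> H"
  obtains "x \<in> B" | b where "b \<in> B" "x = s (p b)" | "x \<in> R"
proof -
  consider "x \<in> B" | "x \<in> s ` B" | "x \<in> R" using assms by (auto simp: R_def)
  thus thesis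
  proof cases
    case 2
    then obtain y where "y \<in> B" "x = s y" by blast
    thus thesis using that(2)[of "inv p y"] permutes_inverses(1)[OF p] ipB by simp
  qed (use that in auto)
qed

lemma RH: "x \<in> R \<Longrightarrow> x \<in> H"
  by (simp add: R_def)

lemma s1_H: "x \<in> H \<Longrightarrow> s1 x \<in> H \<and> s1 (s1 x) = x \<and> s1 x \<noteq> x"
proof (erule H_cases)
  assume x: "x \<in> B"
  thus ?thesis using s1_B[OF x] s1_sB[OF x] sB[of "p x"] pB[of x] BH by auto
next
  fix b assume b: "b \<in> B" "x = s (p b)"
  thus ?thesis using s1_B[OF b(1)] s1_sB[OF b(1)] sB[of "p b"] pB[of b] BH by auto
next
  assume x: "x \<in> R"
  thus ?thesis using s1_R[OF x] s1_R[of "t x"] tt[OF x] tR RH by simp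
qed

lemma s1_outside: "x \<notin> H \<Longrightarrow> s1 x = x"
proof -
  assume x: "x \<notin> H"
  have "x \<notin> s ` B" using x BH by auto
  moreover have "x \<notin> B" "x \<notin> R" using x BH RH by auto
  ultimately show ?thesis using tp by (simp add: s1_def permutes_not_in)
qed

lemma s1_permutes: "s1 permutes H"
  unfolding permutes_def using s1_H s1_outside by metis

lemma s2_B: "b \<in> B \<Longrightarrow> (inv s \<circ> s1) b = p b"
  using permutes_inverses(2)[OF sp] by (simp add: s1_B)

lemma ribbon: "is_ribbon_graph G"
proof -
  have "card C = 3" if "C \<in> cycles_on s H" for C using s that by (simp add: three_perms_def)
  moreover have "inv s \<circ> s1 permutes H" using s1_permutes sp by (intro permutes_compose permutes_inv)
  moreover have "(inv s \<circ> s1) b \<in> B" "s1 b \<notin> B" if "b \<in> B" for b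
    using s2_B[OF that] s1_B[OF that] sB pB that by auto
  ultimately show ?thesis
    unfolding is_ribbon_graph_def G_simps using fin sp s1_permutes s1_H B by auto
qed

lemma trivalent_G: "trivalent G"
  using s by (simp add: trivalent_def vertices_def three_perms_def)

lemma coloring: "is_coloring G c \<longleftrightarrow> c \<in> compat_cols p t"
proof -
  have F: "face_half_edges G = H - B" by (simp add: face_half_edges_def)
  have "(\<forall>x\<in>H - B. c ((inv s \<circ> s1) x) = c x) \<longleftrightarrow>
    (\<forall>b\<in>B. c (s (s b)) = c (s (p b))) \<and> (\<forall>x\<in>R. c (s (s (t x))) = c x)" (is "?L \<longleftrightarrow> ?M")
  proof
    assume L: ?L
    have "c (s (s b)) = c (s (p b))" if b: "b \<in> B" for b
    proof -
      have "s (p b) \<in> H - B" using b pB BH sB by auto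
      with L have "c ((inv s \<circ> s1) (s (p b))) = c (s (p b))" by (rule bspec)
      thus ?thesis using s1_sB[OF b] inv_s[OF BH[OF b]] by simp
    qed
    moreover have "c (s (s (t x))) = c x" if x: "x \<in> R" for x
    proof -
      have "x \<in> H - B" using x by (simp add: R_def)
      with L have "c ((inv s \<circ> s1) x) = c x" by (rule bspec)
      thus ?thesis using s1_R[OF x] inv_s[of "t x"] tR x RH by simp
    qed
    ultimately show ?M by blast
  next
    assume M: ?M
    show ?L
    proof
      fix x assume x: "x \<in> H - B"
      hence "x \<in> H" by simp
      thus "c ((inv s \<circ> s1) x) = c x"
      proof (cases rule: H_cases)
        case 1
        thus ?thesis using x by simp
      next
        case (2 b)
        thus ?thesis using M s1_sB[OF 2(1)] inv_s[OF BH[OF 2(1)]] by simp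
      next
        case 3
        thus ?thesis using M s1_R[OF 3] inv_s[of "t x"] tR RH by simp
      qed
    qed
  qed
  thus ?thesis unfolding is_coloring_def F compat_cols_def cols_def by (auto simp: PiE_def)
qed

lemma edges_G: "edges G = (\<lambda>x. {x, t x}) ` {x \<in> R. x < t x} \<union> (\<lambda>b. {b, s (p b)}) ` B"
proof -
  have o: "orbit s1 x = {x, s1 x}" if "x \<in> H" for x
    using s1_H[OF that] by (intro orbit_involution) simp
  have "edges G = (\<lambda>x. {x, s1 x}) ` H" using o by (simp add: edges_def cycles_on_def)
  also have "\<dots> = (\<lambda>x. {x, t x}) ` {x \<in> R. x < t x} \<union> (\<lambda>b. {b, s (p b)}) ` B"
  proof (intro equalityI subsetI)
    fix e assume "e \<in> (\<lambda>x. {x, s1 x}) ` H"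
    then obtain x where x: "x \<in> H" "e = {x, s1 x}" by blast
    from x(1) show "e \<in> (\<lambda>x. {x, t x}) ` {x \<in> R. x < t x} \<union> (\<lambda>b. {b, s (p b)}) ` B"
    proof (cases rule: H_cases)
      case 1
      thus ?thesis using x s1_B by auto
    next
      case (2 b)
      hence "e = {b, s (p b)}" using x s1_sB by auto
      thus ?thesis using 2 by blast
    next
      case 3
      hence e: "e = {x, t x}" "e = {t x, t (t x)}" using x s1_R tt by auto
      have "x < t x \<or> t x < t (t x)" using tt[OF 3] by auto
      thus ?thesis using e 3 tR by blast
    qed
  next
    fix e assume "e \<in> (\<lambda>x. {x, t x}) ` {x \<in> R. x < t x} \<union> (\<lambda>b. {b, s (p b)}) ` B"
    then consider x where "x \<in> R" "e = {x, t x}" | b where "b \<in> B" "e = {b, s (p b)}" by blast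
    thus "e \<in> (\<lambda>x. {x, s1 x}) ` H"
    proof cases
      case 1
      hence "e = {x, s1 x}" "x \<in> H" using s1_R RH by auto
      thus ?thesis by blast
    next
      case 2
      hence "e = {b, s1 b}" "b \<in> H" using s1_B BH by auto
      thus ?thesis by blast
    qed
  qed
  finally show ?thesis .
qed

lemma edges_disj: "(\<lambda>x. {x, t x}) ` {x \<in> R. x < t x} \<inter> (\<lambda>b. {b, s (p b)}) ` B = {}"
proof -
  have "s (p b) \<notin> R" "b \<notin> R" if "b \<in> B" for b using that pB by (auto simp: R_def)
  thus ?thesis by (auto simp: doubleton_eq_iff)
qed

lemma edges_inj: "inj_on (\<lambda>x. {x, t x}) {x \<in> R. x < t x}" "inj_on (\<lambda>b. {b, s (p b)}) B"
proof -
  show "inj_on (\<lambda>x. {x, t x}) {x \<in> R. x < t x}"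
    by (rule inj_onI) (auto simp: doubleton_eq_iff)
  show "inj_on (\<lambda>b. {b, s (p b)}) B"
    by (rule inj_onI) (use sB pB in \<open>auto simp: doubleton_eq_iff\<close>)
qed

lemma prod_edges:
  fixes w :: "nat set \<Rightarrow> 'r::comm_monoid_mult"
  shows "(\<Prod>e\<in>edges G. w e) = (\<Prod>b\<in>B. w {b, s (p b)}) * (\<Prod>x\<in>{x \<in> R. x < t x}. w {x, t x})"
  unfolding edges_G using finB finR edges_disj edges_inj
  by (subst prod.union_disjoint) (simp_all add: prod.reindex mult.commute)

lemma card_edges: "card (edges G) = card R div 2 + card B"
  unfolding edges_G using finB finR edges_disj edges_inj pairings_card[OF t finR]
  by (subst card_Un_disjoint) (simp_all add: card_image)

lemma edge_lambda_G:
  "b \<in> B \<Longrightarrow> edge_lambda lam (G, c) {b, s (p b)} = lam $ c (s (p b))"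
  "x \<in> R \<Longrightarrow> edge_lambda lam (G, c) {x, t x} = lam $ c x + lam $ c (t x)"
proof -
  assume b: "b \<in> B"
  have pb: "s (p b) \<in> H" "s (p b) \<notin> B" using b pB BH sB by auto
  hence "(THE x. x \<in> {b, s (p b)} \<inter> face_half_edges G) = s (p b)"
    using b by (intro the_equality) (auto simp: face_half_edges_def)
  thus "edge_lambda lam (G, c) {b, s (p b)} = lam $ c (s (p b))"
    using b by (simp add: edge_lambda_def)
next
  assume x: "x \<in> R"
  hence "{x, t x} \<inter> B = {}" using tR[of x] by (auto simp: R_def)
  thus "edge_lambda lam (G, c) {x, t x} = lam $ c x + lam $ c (t x)"
    using tt(2)[OF x] by (simp add: edge_lambda_def)
qed

lemma boundaries_G: "boundaries G = cycles_on p B"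
proof -
  have s2p: "inv s \<circ> s1 permutes H" using ribbon by (simp add: is_ribbon_graph_def)
  have o: "orbit (inv s \<circ> s1) x = orbit p x" if "x \<in> B" for x
    by (rule orbit_cong_on[of _ B]) (use that s2_B pB in auto)
  have self: "x \<in> orbit (inv s \<circ> s1) x" for x
    using s2p fin by (intro permutation_self_in_orbit) (auto simp: permutation_permutes)
  show ?thesis
  proof (intro equalityI subsetI)
    fix C assume "C \<in> boundaries G"
    then obtain x where x: "x \<in> H" "C = orbit (inv s \<circ> s1) x" "C \<subseteq> B"
      by (auto simp: boundaries_def cycles_on_def)
    hence "x \<in> B" using self by blast
    thus "C \<in> cycles_on p B" using x o by (auto simp: cycles_on_def)
  next
    fix C assume "C \<in> cycles_on p B"
    then obtain x where x: "x \<in> B" "C = orbit p x" by (auto simp: cycles_on_def)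
    have "C \<subseteq> B" unfolding x(2) using p x(1) by (rule permutes_orbit_subset)
    moreover have "C = orbit (inv s \<circ> s1) x" using x o by simp
    ultimately show "C \<in> boundaries G" using x BH by (auto simp: boundaries_def cycles_on_def)
  qed
qed

lemma card_vertices: "card H = 3 * m \<Longrightarrow> card (vertices G) = m"
  using card_three_cycles[OF s fin] by (simp add: vertices_def)

lemma weight_G:
  assumes m: "card H = 3 * m"
  shows "fps_const (of_real (2 powi (int (card (edges G)) - int (card (vertices G)))
        * (\<Prod>e\<in>edges G. inverse (edge_lambda lam (G, c) e)))) * fps_X ^ card (boundaries G)
    = data_weight lam m p t c"
proof -
  have "(\<Prod>b\<in>B. inverse (edge_lambda lam (G, c) {b, s (p b)})) = (\<Prod>b\<in>B. inverse (lam $ c (s (p b))))"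
    by (intro prod.cong refl) (simp add: edge_lambda_G)
  moreover have "(\<Prod>x\<in>{x \<in> R. x < t x}. inverse (edge_lambda lam (G, c) {x, t x}))
      = (\<Prod>x\<in>{x \<in> R. x < t x}. inverse (lam $ c x + lam $ c (t x)))"
    by (intro prod.cong refl) (simp add: edge_lambda_G)
  ultimately show ?thesis
    unfolding data_weight_def prod_edges card_edges boundaries_G card_vertices[OF m] by simp
qed

end

section \<open>Recovering the data from a labelled graph\<close>

definition labelled_graphs :: "nat set \<Rightarrow> (nat, 'n) colored_graph set" where
  "labelled_graphs H = {g \<in> trivalent_colored_graphs. half_edges (fst g) = H}"

definition graph_data ::
  "nat set \<Rightarrow> ((nat \<Rightarrow> nat) \<times> nat set \<times> (nat \<Rightarrow> nat) \<times> (nat \<Rightarrow> nat) \<times> (nat \<Rightarrow> 'n)) set" where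
  "graph_data H = (SIGMA s:three_perms H. SIGMA B:boundary_sets H s. SIGMA p:{p. p permutes B}.
     SIGMA t:pairings (trivalent_data.R H s B). trivalent_data.compat_cols H s B p t)"

locale labelled_graph =
  fixes G :: "nat ribbon_graph" and H :: "nat set"
  assumes G: "is_ribbon_graph G" "trivalent G" "half_edges G = H"
begin

abbreviation "s \<equiv> sigma0 G"
abbreviation "B \<equiv> bdry G"
definition "p = (\<lambda>x. if x \<in> B then sigma2 G x else x)"
definition "t = (\<lambda>x. if x \<in> trivalent_data.R H s B then sigma1 G x else x)"

lemma perms: "finite H" "s permutes H" "sigma1 G permutes H" "sigma2 G permutes H"
  and s1: "x \<in> H \<Longrightarrow> sigma1 G (sigma1 G x) = x" "x \<in> H \<Longrightarrow> sigma1 G x \<noteq> x"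
  and s2: "sigma2 G x = inv s (sigma1 G x)" and BH: "B \<subseteq> H"
  and s2B: "x \<in> B \<Longrightarrow> sigma2 G x \<in> B" and s1B: "x \<in> B \<Longrightarrow> sigma1 G x \<notin> B"
  using G by (auto simp: is_ribbon_graph_def)

lemma s_s2: "s (sigma2 G x) = sigma1 G x"
  unfolding s2 using perms(2) by (rule permutes_inverses)

lemma s2_inj: "sigma2 G x = sigma2 G y \<longleftrightarrow> x = y"
  using perms(4) by (metis permutes_inj injD)

lemma finB: "finite B"
  using BH perms(1) by (rule finite_subset)

lemma s2_surj:
  assumes "x \<in> B"
  obtains y where "y \<in> B" "sigma2 G y = x"
proof -
  have "sigma2 G ` B = B"
    using finB s2B by (intro endo_inj_surj) (auto simp: inj_on_def s2_inj)
  hence "x \<in> sigma2 G ` B" using assms by (simp only:)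
  then obtain y where "x = sigma2 G y" "y \<in> B" by (rule imageE)
  thus thesis using that[of y] by simp
qed

text \<open>As \<open>sigma2\<close> permutes the finite set \<open>B\<close>, \<open>x\<close> is
  \<open>sigma2 G y\<close> for some \<open>y\<close> in \<open>B\<close>, and then
  \<open>s x = sigma1 G y\<close>, which the ribbon graph axioms keep out of \<open>B\<close>. This
  is the origin of the bound of one boundary half-edge per trivalent vertex.\<close>

lemma sB: "x \<in> B \<Longrightarrow> s x \<notin> B"
  using s2_surj s_s2 s1B by metis

sublocale trivalent_data H s B
proof
  show "s \<in> three_perms H" using G perms(2) by (auto simp: three_perms_def trivalent_def vertices_def)
qed (use perms(1) BH sB in auto)

lemma s1H: "sigma1 G x \<in> H \<longleftrightarrow> x \<in> H"
  using perms(3) by (rule permutes_in_image)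

text \<open>The involution exchanges \<open>B\<close> with its image under \<open>s\<close>, so it
  preserves what is left.\<close>

lemma s1R:
  assumes x: "x \<in> R"
  shows "sigma1 G x \<in> R"
proof -
  have xH: "x \<in> H" "x \<notin> B" "x \<notin> s ` B" using x by (auto simp: R_def)
  have "sigma1 G x \<notin> B"
  proof
    assume b: "sigma1 G x \<in> B"
    have "x = s (sigma2 G (sigma1 G x))" unfolding s_s2 using s1(1)[OF xH(1)] by simp
    thus False using xH(3) s2B[OF b] by blast
  qed
  moreover have "sigma1 G x \<notin> s ` B"
  proof
    assume "sigma1 G x \<in> s ` B"
    then obtain b where b: "b \<in> B" "sigma1 G x = s b" by blast
    have "sigma2 G x = b" unfolding s2 b(2) using perms(2) by (rule permutes_inverses)
    moreover obtain y where "y \<in> B" "sigma2 G y = b" using s2_surj[OF b(1)] .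
    ultimately show False using s2_inj xH(2) by metis
  qed
  ultimately show ?thesis using xH s1H by (simp add: R_def)
qed

lemma p_permutes: "p permutes B"
proof (rule bij_imp_permutes)
  have "inj_on p B" by (rule inj_onI) (auto simp: p_def s2_inj)
  moreover have "p ` B \<subseteq> B" using s2B by (auto simp: p_def)
  ultimately show "bij_betw p B B" using finB by (simp add: bij_betw_def endo_inj_surj)
qed (simp add: p_def)

lemma t_pairing: "t \<in> pairings R"
proof -
  have tR: "t x \<in> R" "t (t x) = x" "t x \<noteq> x" if x: "x \<in> R" for x
  proof -
    have "x \<in> H" using x by (simp add: R_def)
    thus "t x \<in> R" "t (t x) = x" "t x \<noteq> x"
      using x s1R[OF x] s1[of x] by (simp_all add: t_def)
  qed
  have "bij_betw t R R" by (rule bij_betwI[of _ _ _ t]) (use tR in auto)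
  hence "t permutes R" by (rule bij_imp_permutes) (simp add: t_def)
  thus ?thesis using tR by (simp add: pairings_def)
qed

sublocale trivalent_graph_data H s B p t
  using p_permutes t_pairing by unfold_locales

lemma data_graph_eq: "data_graph H s B p t = G"
proof -
  have "s1 x = sigma1 G x" for x
  proof (cases "x \<in> H")
    case True
    thus ?thesis
    proof (cases rule: H_cases)
      case 1
      hence "p x = sigma2 G x" by (simp add: p_def)
      thus ?thesis using s_s2[of x] s1_B[OF 1] by simp
    next
      case (2 b)
      have "sigma1 G b = x" using 2 s_s2[of b] by (simp add: p_def)
      hence "sigma1 G x = b" using s1(1)[of b] 2 BH by auto
      thus ?thesis using 2 s1_sB by simp
    next
      case 3
      hence "t x = sigma1 G x" by (simp add: t_def)
      thus ?thesis using s1_R[OF 3] by simp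
    qed
  next
    case False
    thus ?thesis using perms(3) by (simp add: s1_outside permutes_not_in)
  qed
  hence "s1 = sigma1 G" by blast
  thus ?thesis using G_simps G(3) s2
    by (intro ribbon_graph.equality) (auto simp: fun_eq_iff)
qed

end

lemma trivalent_data_boundary_sets:
  "trivalent_data H s B \<longleftrightarrow> finite H \<and> s \<in> three_perms H \<and> B \<in> boundary_sets H s"
  by (auto simp: trivalent_data_def boundary_sets_def)

lemma labelled_graphs_bij:
  assumes fin: "finite H"
  shows "bij_betw (\<lambda>(s, B, p, t, c). (data_graph H s B p t, c)) (graph_data H)
    (labelled_graphs H :: (nat, 'n) colored_graph set)"
proof (rule bij_betwI[where g = "\<lambda>(G, c). (sigma0 G, bdry G, labelled_graph.p G, labelled_graph.t G H, c)"])
  have D: "trivalent_graph_data H s B p t \<and> c \<in> trivalent_data.compat_cols H s B p t"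
    if "(s, B, p, t, c) \<in> graph_data H" for s B p t and c :: "nat \<Rightarrow> 'n"
    using that fin
    by (auto simp: graph_data_def trivalent_graph_data_def trivalent_graph_data_axioms_def trivalent_data_boundary_sets)
  show 1: "(\<lambda>(s, B, p, t, c). (data_graph H s B p t, c)) \<in> graph_data H \<rightarrow> (labelled_graphs H :: (nat, 'n) colored_graph set)"
  proof safe
    fix s B p t and c :: "nat \<Rightarrow> 'n" assume d: "(s, B, p, t, c) \<in> graph_data H"
    interpret trivalent_graph_data H s B p t using D[OF d] by simp
    show "(data_graph H s B p t, c) \<in> labelled_graphs H"
      using D[OF d] ribbon trivalent_G by (simp add: labelled_graphs_def trivalent_colored_graphs_def coloring)
  qed
  have L: "labelled_graph G H \<and> is_coloring G c" if "(G, c) \<in> labelled_graphs H" for G and c :: "nat \<Rightarrow> 'n"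
    using that by (auto simp: labelled_graphs_def trivalent_colored_graphs_def labelled_graph_def)
  show "(\<lambda>(G, c). (sigma0 G, bdry G, labelled_graph.p G, labelled_graph.t G H, c))
      \<in> (labelled_graphs H :: (nat, 'n) colored_graph set) \<rightarrow> graph_data H"
  proof safe
    fix G and c :: "nat \<Rightarrow> 'n" assume g: "(G, c) \<in> labelled_graphs H"
    interpret labelled_graph G H using L[OF g] by simp
    have "c \<in> compat_cols p t" using coloring[of c] L[OF g] data_graph_eq by simp
    moreover have "B \<in> boundary_sets H s"
      using trivalent_data_boundary_sets[of H s B] trivalent_data_axioms by simp
    ultimately show "(s, B, p, t, c) \<in> graph_data H"
      using trivalent_data_axioms p_permutes t_pairing
      by (simp add: graph_data_def trivalent_data_boundary_sets)
  qed
  show "(case (case x of (s, B, p, t, c) \<Rightarrow> (data_graph H s B p t, c)) of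
      (G, c) \<Rightarrow> (sigma0 G, bdry G, labelled_graph.p G, labelled_graph.t G H, c)) = x"
    if x: "x \<in> graph_data H" for x :: "_ \<times> _ \<times> _ \<times> _ \<times> (nat \<Rightarrow> 'n)"
  proof -
    obtain s B p t c where xe: "x = (s, B, p, t, c)" by (cases x)
    interpret trivalent_graph_data H s B p t using D x unfolding xe by blast
    interpret L: labelled_graph "data_graph H s B p t" H
      using ribbon trivalent_G by unfold_locales simp_all
    have "L.p = p"
      unfolding L.p_def fun_eq_iff using s2_B permutes_not_in[OF p] by simp
    moreover have "L.t = t"
      unfolding L.t_def fun_eq_iff using s1_R permutes_not_in[OF tp] by simp
    ultimately show ?thesis by (simp add: xe)
  qed
  show "(case (case y of (G, c) \<Rightarrow> (sigma0 G, bdry G, labelled_graph.p G, labelled_graph.t G H, c)) of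
      (s, B, p, t, c) \<Rightarrow> (data_graph H s B p t, c)) = y"
    if "y \<in> labelled_graphs H" for y :: "(nat, 'n) colored_graph"
    using that L labelled_graph.data_graph_eq by (cases y) auto
qed

section \<open>Relabelling and isomorphism classes\<close>

text \<open>Transport along a bijection of all natural numbers, not just of the half-edges. This
  makes relabelling a group action, with \<open>inv f\<close> available everywhere, and conjugated
  permutations stay the identity off the new half-edges.\<close>

definition relabel :: "(nat \<Rightarrow> nat) \<Rightarrow> (nat, 'n) colored_graph \<Rightarrow> (nat, 'n) colored_graph" where
  "relabel f = (\<lambda>(G, c).
     (\<lparr>half_edges = f ` half_edges G, sigma0 = f \<circ> sigma0 G \<circ> inv f, sigma1 = f \<circ> sigma1 G \<circ> inv f,
       sigma2 = f \<circ> sigma2 G \<circ> inv f, bdry = f ` bdry G\<rparr>,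
      restrict (c \<circ> inv f) (f ` face_half_edges G)))"

lemma relabel_simps [simp]:
  "half_edges (fst (relabel f g)) = f ` half_edges (fst g)"
  "sigma0 (fst (relabel f g)) = f \<circ> sigma0 (fst g) \<circ> inv f"
  "sigma1 (fst (relabel f g)) = f \<circ> sigma1 (fst g) \<circ> inv f"
  "sigma2 (fst (relabel f g)) = f \<circ> sigma2 (fst g) \<circ> inv f"
  "bdry (fst (relabel f g)) = f ` bdry (fst g)"
  "snd (relabel f g) = restrict (snd g \<circ> inv f) (f ` face_half_edges (fst g))"
  by (simp_all add: relabel_def case_prod_beta)

lemma relabel_face:
  "inj f \<Longrightarrow> face_half_edges (fst (relabel f g)) = f ` face_half_edges (fst g)"
  by (simp add: face_half_edges_def image_set_diff)

lemma colored_graph_eqI: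
  assumes "half_edges (fst g) = half_edges (fst g')" "sigma0 (fst g) = sigma0 (fst g')"
    "sigma1 (fst g) = sigma1 (fst g')" "sigma2 (fst g) = sigma2 (fst g')" "bdry (fst g) = bdry (fst g')"
    "snd g = snd g'"
  shows "g = (g' :: ('h, 'n) colored_graph)"
  using assms by (intro prod_eqI ribbon_graph.equality) auto

lemma relabel_relabel:
  assumes "bij f" "bij h"
  shows "relabel f (relabel h g) = relabel (f \<circ> h) g"
proof (rule colored_graph_eqI)
  have i: "inv (f \<circ> h) = inv h \<circ> inv f" using assms by (simp add: o_inv_distrib)
  have "inj f" "inj h" using assms by (auto simp: bij_def)
  thus "snd (relabel f (relabel h g)) = snd (relabel (f \<circ> h) g)"
    by (auto simp: relabel_face i fun_eq_iff image_image restrict_def)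
qed (use assms in \<open>simp_all add: o_inv_distrib image_comp o_assoc\<close>)

lemma orbit_conj:
  assumes "bij f"
  shows "orbit (f \<circ> q \<circ> inv f) (f x) = f ` orbit q x"
proof (intro equalityI subsetI)
  have fi: "inv f (f y) = y" for y using assms by (simp add: bij_def)
  fix y assume "y \<in> orbit (f \<circ> q \<circ> inv f) (f x)"
  thus "y \<in> f ` orbit q x"
  proof induction
    case base
    show ?case by (simp add: fi orbit.base)
  next
    case (step y)
    then obtain z where "z \<in> orbit q x" "y = f z" by blast
    thus ?case by (auto simp: fi intro: orbit.step)
  qed
next
  have fi: "inv f (f y) = y" for y using assms by (simp add: bij_def)
  fix y assume "y \<in> f ` orbit q x"
  then obtain z where z: "z \<in> orbit q x" "y = f z" by blast
  have "f z \<in> orbit (f \<circ> q \<circ> inv f) (f x)" using z(1)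
  proof induction
    case base
    have "f (q x) = (f \<circ> q \<circ> inv f) (f x)" by (simp add: fi)
    thus ?case by (metis orbit.base)
  next
    case (step y)
    have "f (q y) = (f \<circ> q \<circ> inv f) (f y)" by (simp add: fi)
    thus ?case using step by (metis orbit.step)
  qed
  thus "y \<in> orbit (f \<circ> q \<circ> inv f) (f x)" using z by simp
qed

lemma cycles_on_conj: "bij f \<Longrightarrow> cycles_on (f \<circ> q \<circ> inv f) (f ` S) = (`) f ` cycles_on q S"
  unfolding cycles_on_def image_image by (intro image_cong refl orbit_conj)

lemma permutes_conj:
  assumes "bij f" "q permutes S"
  shows "f \<circ> q \<circ> inv f permutes f ` S"
proof (rule bij_imp_permutes)
  have inj: "inj f" using assms(1) by (simp add: bij_def)
  have "bij_betw (inv f) (f ` S) S" using inj by (simp add: bij_betw_def inj_on_def image_image)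
  moreover have "bij_betw q S S" using assms(2) by (rule permutes_imp_bij)
  moreover have "bij_betw f S (f ` S)" using inj by (simp add: bij_betw_def inj_on_def)
  ultimately show "bij_betw (f \<circ> q \<circ> inv f) (f ` S) (f ` S)" by (metis bij_betw_trans)
next
  fix x assume "x \<notin> f ` S"
  hence "inv f x \<notin> S" using assms(1) by (metis bij_inv_eq_iff imageI)
  hence "q (inv f x) = inv f x" using assms(2) by (simp add: permutes_not_in)
  thus "(f \<circ> q \<circ> inv f) x = x" using assms(1) by (simp add: bij_is_surj surj_f_inv_f)
qed

lemma card_image_image: "inj f \<Longrightarrow> card ((`) f ` A) = card A"
  by (intro card_image inj_onI) (simp add: inj_image_eq_iff)

lemma relabel_trivalent:
  assumes f: "bij f" and g: "g \<in> trivalent_colored_graphs"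
  shows "relabel f g \<in> trivalent_colored_graphs"
proof -
  obtain G c where Gc: "g = (G, c)" by (cases g)
  have inj: "inj f" and fi: "inv f (f y) = y" for y using f by (auto simp: bij_def)
  have G: "is_ribbon_graph G" "trivalent G" "is_coloring G c"
    using g by (auto simp: Gc trivalent_colored_graphs_def)
  let ?G = "fst (relabel f g)" and ?c = "snd (relabel f g)"
  note [simp] = Gc
  have s0: "bij (sigma0 G)" using G(1) by (auto simp: is_ribbon_graph_def intro: permutes_bij)
  have s2: "sigma2 G = inv (sigma0 G) \<circ> sigma1 G" using G(1) by (simp add: is_ribbon_graph_def)
  have "inv (f \<circ> sigma0 G \<circ> inv f) = f \<circ> inv (sigma0 G) \<circ> inv f"
    using f s0 by (simp add: o_inv_distrib bij_comp bij_imp_bij_inv inv_inv_eq o_assoc)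
  hence s2': "sigma2 ?G = inv (sigma0 ?G) \<circ> sigma1 ?G"
    by (simp add: s2 fun_eq_iff fi)
  have "card C \<noteq> 1 \<and> card C \<noteq> 2" if "C \<in> cycles_on (sigma0 ?G) (half_edges ?G)" for C
    using that G(1) f card_image[OF inj_on_subset[OF inj subset_UNIV]]
    by (auto simp: cycles_on_conj is_ribbon_graph_def simp del: o_apply)
  moreover have "sigma0 ?G permutes half_edges ?G" "sigma1 ?G permutes half_edges ?G" "sigma2 ?G permutes half_edges ?G"
  proof -
    have "sigma0 G permutes half_edges G" "sigma1 G permutes half_edges G" "sigma2 G permutes half_edges G"
      using G(1) unfolding is_ribbon_graph_def by blast+
    from this[THEN permutes_conj[OF f]]
    show "sigma0 ?G permutes half_edges ?G" "sigma1 ?G permutes half_edges ?G" "sigma2 ?G permutes half_edges ?G"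
      by (simp_all only: relabel_simps Gc fst_conv)
  qed
  moreover have "\<forall>x\<in>bdry ?G. sigma2 ?G x \<in> bdry ?G \<and> sigma1 ?G x \<notin> bdry ?G"
  proof
    fix x assume "x \<in> bdry ?G"
    then obtain y where y: "y \<in> bdry G" "x = f y" by auto
    hence "sigma2 G y \<in> bdry G" "sigma1 G y \<notin> bdry G"
      using G(1) unfolding is_ribbon_graph_def by blast+
    thus "sigma2 ?G x \<in> bdry ?G \<and> sigma1 ?G x \<notin> bdry ?G"
      by (simp add: y(2) fi inj_image_mem_iff[OF inj])
  qed
  moreover have "\<forall>x\<in>half_edges ?G. sigma1 ?G (sigma1 ?G x) = x \<and> sigma1 ?G x \<noteq> x"
    using G(1) by (auto simp: is_ribbon_graph_def fi inj_eq[OF inj])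
  moreover have "finite (half_edges ?G)" "bdry ?G \<subseteq> half_edges ?G"
    using G(1) by (auto simp: is_ribbon_graph_def)
  ultimately have "is_ribbon_graph ?G"
    unfolding is_ribbon_graph_def using s2' by blast
  moreover have "trivalent ?G"
    using G(2) f card_image[OF inj_on_subset[OF inj subset_UNIV]]
    by (auto simp: trivalent_def vertices_def cycles_on_conj simp del: o_apply)
  moreover have "is_coloring ?G ?c"
  proof -
    \<comment> \<open>\<open>sigma2\<close> is injective and maps the finite set
      \<open>bdry G\<close> onto itself, so it cannot lead from a face into the boundary.\<close>
    have s2F: "sigma2 G x \<in> face_half_edges G" if "x \<in> face_half_edges G" for x
    proof -
      have p: "sigma2 G permutes half_edges G" and B: "bdry G \<subseteq> half_edges G" "finite (half_edges G)"
        and s2B: "\<And>x. x \<in> bdry G \<Longrightarrow> sigma2 G x \<in> bdry G"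
        using G(1) unfolding is_ribbon_graph_def by blast+
      have eq: "sigma2 G y = sigma2 G z \<longleftrightarrow> y = z" for y z using p by (metis permutes_inj injD)
      have "sigma2 G ` bdry G = bdry G"
        using finite_subset[OF B] s2B by (intro endo_inj_surj) (auto simp: inj_on_def eq)
      note im = this
      have "sigma2 G x \<notin> bdry G"
      proof
        assume "sigma2 G x \<in> bdry G"
        hence "sigma2 G x \<in> sigma2 G ` bdry G" by (simp only: im)
        then obtain y where "sigma2 G x = sigma2 G y" "y \<in> bdry G" by (rule imageE)
        thus False using that eq by (simp add: face_half_edges_def)
      qed
      moreover have "sigma2 G x \<in> half_edges G"
        using that permutes_in_image[OF p] by (simp add: face_half_edges_def)
      ultimately show ?thesis by (simp add: face_half_edges_def)
    qed
    show ?thesis unfolding is_coloring_def relabel_face[OF inj]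
      using G(3) s2F by (auto simp: is_coloring_def fi)
  qed
  ultimately show ?thesis by (simp add: trivalent_colored_graphs_def case_prod_beta)
qed

lemma colored_iso_relabel:
  assumes f: "bij f"
  shows "is_colored_iso f g (relabel f g)"
proof -
  have inj: "inj f" and fi: "inv f (f y) = y" for y using f by (auto simp: bij_def)
  have "bij_betw f A (f ` A)" for A using inj_on_subset[OF inj subset_UNIV] by (simp add: bij_betw_def)
  thus ?thesis
    unfolding is_colored_iso_def case_prod_beta relabel_simps by (simp add: fi)
qed

lemma colored_isoD:
  assumes "is_colored_iso f g g'"
  shows "bij_betw f (half_edges (fst g)) (half_edges (fst g'))"
    "x \<in> half_edges (fst g) \<Longrightarrow> f (sigma0 (fst g) x) = sigma0 (fst g') (f x)"
    "x \<in> half_edges (fst g) \<Longrightarrow> f (sigma1 (fst g) x) = sigma1 (fst g') (f x)"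
    "f ` bdry (fst g) = bdry (fst g')"
    "x \<in> face_half_edges (fst g) \<Longrightarrow> snd g' (f x) = snd g x"
  using assms by (auto simp: is_colored_iso_def case_prod_beta)

lemma trivalent_colored_graphsD:
  assumes "g \<in> trivalent_colored_graphs"
  shows "is_ribbon_graph (fst g)" "trivalent (fst g)" "is_coloring (fst g) (snd g)"
    "finite (half_edges (fst g))" "sigma0 (fst g) permutes half_edges (fst g)"
    "sigma1 (fst g) permutes half_edges (fst g)" "sigma2 (fst g) = inv (sigma0 (fst g)) \<circ> sigma1 (fst g)"
    "snd g \<in> extensional (face_half_edges (fst g))"
  using assms by (auto simp: trivalent_colored_graphs_def is_ribbon_graph_def is_coloring_def)

text \<open>The encoding leaves no freedom beyond the half-edges: permutations are the identity
  outside, colourings are extensional, and \<open>sigma2\<close> is determined by the other two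
  permutations. An isomorphism is therefore an actual equality after relabelling.\<close>

lemma relabel_eqI:
  assumes f: "bij f" and g: "g \<in> trivalent_colored_graphs" and g': "g' \<in> trivalent_colored_graphs"
    and iso: "is_colored_iso f g g'"
  shows "relabel f g = g'"
proof -
  note D = trivalent_colored_graphsD[OF g] and D' = trivalent_colored_graphsD[OF g']
    and R = trivalent_colored_graphsD[OF relabel_trivalent[OF f g]]
  note I = colored_isoD[OF iso]
  have inj: "inj f" and fi: "inv f (f y) = y" for y using f by (auto simp: bij_def)
  have H: "half_edges (fst (relabel f g)) = half_edges (fst g')" using I(1) by (simp add: bij_betw_def)
  have B: "bdry (fst (relabel f g)) = bdry (fst g')" using I(4) by simp
  have F: "face_half_edges (fst g') = f ` face_half_edges (fst g)"
    unfolding relabel_face[OF inj, symmetric] by (simp only: face_half_edges_def H B)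
  have s0: "sigma0 (fst (relabel f g)) = sigma0 (fst g')"
  proof
    fix x
    show "sigma0 (fst (relabel f g)) x = sigma0 (fst g') x"
    proof (cases "x \<in> half_edges (fst g')")
      case True
      then obtain y where "y \<in> half_edges (fst g)" "x = f y" using I(1) by (auto simp: bij_betw_def)
      thus ?thesis using I(2) by (simp add: fi)
    next
      case False
      show ?thesis unfolding permutes_not_in[OF D'(5) False]
        by (rule permutes_not_in[OF R(5)]) (simp only: H False not_False_eq_True)
    qed
  qed
  have s1: "sigma1 (fst (relabel f g)) = sigma1 (fst g')"
  proof
    fix x
    show "sigma1 (fst (relabel f g)) x = sigma1 (fst g') x"
    proof (cases "x \<in> half_edges (fst g')")
      case True
      then obtain y where "y \<in> half_edges (fst g)" "x = f y" using I(1) by (auto simp: bij_betw_def)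
      thus ?thesis using I(3) by (simp add: fi)
    next
      case False
      show ?thesis unfolding permutes_not_in[OF D'(6) False]
        by (rule permutes_not_in[OF R(6)]) (simp only: H False not_False_eq_True)
    qed
  qed
  have c: "snd (relabel f g) = snd g'"
  proof
    fix x
    show "snd (relabel f g) x = snd g' x"
    proof (cases "x \<in> f ` face_half_edges (fst g)")
      case True
      thus ?thesis using I(5) by (auto simp: fi)
    next
      case False
      thus ?thesis using D'(8) unfolding F by (simp add: extensional_def)
    qed
  qed
  show ?thesis
    by (rule colored_graph_eqI[OF H s0 s1 _ B c]) (simp only: R(7) D'(7) s0 s1)
qed

lemma relabel_eq_iff:
  assumes "bij f" "g \<in> trivalent_colored_graphs" "g' \<in> trivalent_colored_graphs"
  shows "relabel f g = g' \<longleftrightarrow> is_colored_iso f g g'"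
  using relabel_eqI[OF assms] colored_iso_relabel[OF assms(1), of g] by auto

lemma relabel_id: "g \<in> trivalent_colored_graphs \<Longrightarrow> relabel id g = g"
  by (rule relabel_eqI) (auto simp: is_colored_iso_def)

lemma colored_iso_cong:
  assumes "\<And>x. x \<in> half_edges (fst g) \<Longrightarrow> f x = h x" and g: "g \<in> trivalent_colored_graphs"
  shows "is_colored_iso f g g' \<longleftrightarrow> is_colored_iso h g g'"
proof -
  have B: "bdry (fst g) \<subseteq> half_edges (fst g)"
    using trivalent_colored_graphsD(1)[OF g] by (simp add: is_ribbon_graph_def)
  have s: "sigma0 (fst g) x \<in> half_edges (fst g) \<and> sigma1 (fst g) x \<in> half_edges (fst g)" if "x \<in> half_edges (fst g)" for x
    using that trivalent_colored_graphsD(5,6)[OF g] by (simp add: permutes_in_image)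
  have "bij_betw f (half_edges (fst g)) S \<longleftrightarrow> bij_betw h (half_edges (fst g)) S" for S
    by (rule bij_betw_cong) (rule assms(1))
  moreover have "f ` bdry (fst g) = h ` bdry (fst g)" using B assms(1) by (intro image_cong) auto
  ultimately show ?thesis
    unfolding is_colored_iso_def case_prod_beta
    using assms(1) s by (auto simp: face_half_edges_def)
qed

text \<open>Finite sets of naturals have infinite complements, which are matched by their
  enumerations.\<close>

lemma bij_extend_nat:
  fixes f :: "nat \<Rightarrow> nat"
  assumes "finite H" "bij_betw f H H'"
  obtains h where "bij h" "\<And>x. x \<in> H \<Longrightarrow> h x = f x"
proof -
  have fin': "finite H'" using assms bij_betw_finite by blast
  have inf: "infinite (- H)" "infinite (- H')" using assms(1) fin' by (auto simp: finite_compl)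
  let ?k = "enumerate (- H') \<circ> inv_into UNIV (enumerate (- H))"
  have k: "bij_betw ?k (- H) (- H')"
    using bij_betw_inv_into[OF bij_enumerate[OF inf(1)]] bij_enumerate[OF inf(2)] by (rule bij_betw_trans)
  have "bij_betw (\<lambda>x. if x \<in> H then f x else ?k x) (H \<union> - H) (H' \<union> - H')"
    by (rule bij_betw_disjoint_Un[OF assms(2) k]) auto
  hence "bij (\<lambda>x. if x \<in> H then f x else ?k x)" by simp
  thus thesis using that by simp
qed

text \<open>Isomorphism classes become orbits of the relabelling action; the equivalence axioms and
  the orbit count both rest on this form.\<close>

lemma colored_iso_rel_relabel:
  "(g, g') \<in> colored_iso_rel \<longleftrightarrow> g \<in> trivalent_colored_graphs \<and> (\<exists>f. bij f \<and> relabel f g = g')"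
proof
  assume "(g, g') \<in> colored_iso_rel"
  then obtain f where g: "g \<in> trivalent_colored_graphs" "g' \<in> trivalent_colored_graphs" "is_colored_iso f g g'"
    by (auto simp: colored_iso_rel_def)
  obtain h where h: "bij h" "\<And>x. x \<in> half_edges (fst g) \<Longrightarrow> h x = f x"
    using bij_extend_nat[OF trivalent_colored_graphsD(4)[OF g(1)] colored_isoD(1)[OF g(3)]] by blast
  have "is_colored_iso h g g'" using colored_iso_cong[OF h(2) g(1)] g(3) by simp
  thus "g \<in> trivalent_colored_graphs \<and> (\<exists>f. bij f \<and> relabel f g = g')"
    using relabel_eqI[OF h(1) g(1,2)] g(1) h(1) by blast
next
  assume "g \<in> trivalent_colored_graphs \<and> (\<exists>f. bij f \<and> relabel f g = g')"
  then obtain f where "g \<in> trivalent_colored_graphs" "bij f" "relabel f g = g'" by blast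
  thus "(g, g') \<in> colored_iso_rel"
    using relabel_trivalent[of f g] colored_iso_relabel[of f g] unfolding colored_iso_rel_def by blast
qed

lemma equiv_colored_iso_rel: "equiv (trivalent_colored_graphs :: (nat, 'n) colored_graph set) colored_iso_rel" (is "equiv ?T ?r")
proof (rule equivI)
  show "?r \<subseteq> ?T \<times> ?T"
    by (auto simp: colored_iso_rel_def)
  show "refl_on ?T ?r"
    using relabel_id bij_id by (auto simp: refl_on_def colored_iso_rel_relabel)
  show "sym ?r"
  proof (rule symI)
    fix g g' :: "(nat, 'n) colored_graph" assume "(g, g') \<in> colored_iso_rel"
    then obtain f where f: "g \<in> trivalent_colored_graphs" "bij f" "relabel f g = g'"
      by (auto simp: colored_iso_rel_relabel)
    have "relabel (inv f) g' = relabel (inv f \<circ> f) g"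
      using f(2) unfolding f(3)[symmetric] by (intro relabel_relabel bij_imp_bij_inv)
    also have "\<dots> = g" using f by (simp add: relabel_id bij_def inv_o_cancel)
    finally show "(g', g) \<in> colored_iso_rel"
      using relabel_trivalent[OF f(2,1)] bij_imp_bij_inv[OF f(2)] unfolding f(3) colored_iso_rel_relabel by blast
  qed
  show "trans ?r"
  proof (rule transI)
    fix g1 g2 g3 :: "(nat, 'n) colored_graph"
    assume "(g1, g2) \<in> colored_iso_rel" "(g2, g3) \<in> colored_iso_rel"
    then obtain f h where fh: "g1 \<in> trivalent_colored_graphs" "bij f" "relabel f g1 = g2" "bij h" "relabel h g2 = g3"
      by (auto simp: colored_iso_rel_relabel)
    have "relabel (h \<circ> f) g1 = g3" using fh by (simp add: relabel_relabel[symmetric])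
    thus "(g1, g3) \<in> colored_iso_rel" using fh by (auto simp: colored_iso_rel_relabel intro: bij_comp)
  qed
qed

section \<open>Automorphisms as stabilisers and invariance of the weights\<close>

lemma colored_Aut_relabel:
  assumes "g \<in> trivalent_colored_graphs"
  shows "colored_Aut g = {f. f permutes half_edges (fst g) \<and> relabel f g = g}"
  unfolding colored_Aut_def using relabel_eq_iff[OF permutes_bij assms assms] by blast

lemma finite_colored_Aut: "g \<in> trivalent_colored_graphs \<Longrightarrow> finite (colored_Aut g)"
  by (rule finite_subset[OF _ finite_permutations[OF trivalent_colored_graphsD(4)]])
    (auto simp: colored_Aut_def)

lemma card_colored_Aut_pos: "g \<in> trivalent_colored_graphs \<Longrightarrow> card (colored_Aut g) > 0"
proof -
  assume g: "g \<in> trivalent_colored_graphs"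
  have "id \<in> colored_Aut g" using relabel_id[OF g] by (simp add: colored_Aut_relabel[OF g])
  thus ?thesis using finite_colored_Aut[OF g] by (auto simp: card_gt_0_iff)
qed

text \<open>Conjugation by \<open>f\<close> embeds one group into the other. Used for
  \<open>f\<close> and for \<open>inv f\<close>, the resulting inequality gives equality.\<close>

lemma card_Aut_relabel:
  assumes f: "bij f" and g: "g \<in> trivalent_colored_graphs"
  shows "card (colored_Aut (relabel f g)) = card (colored_Aut g)"
proof -
  have le: "card (colored_Aut g) \<le> card (colored_Aut (relabel f g))"
    if f: "bij f" and g: "g \<in> trivalent_colored_graphs" for f and g :: "(nat, 'b) colored_graph"
  proof (rule card_inj_on_le[of "\<lambda>h. f \<circ> h \<circ> inv f"])
    have fi: "inv f (f y) = y" for y using f by (simp add: bij_def)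
    show "inj_on (\<lambda>h. f \<circ> h \<circ> inv f) (colored_Aut g)"
    proof (rule inj_onI)
      fix h k assume e: "f \<circ> h \<circ> inv f = f \<circ> k \<circ> inv f"
      have "h x = k x" for x
        using fun_cong[OF e, of "f x"] f by (simp add: fi bij_def inj_eq)
      thus "h = k" by blast
    qed
    show "(\<lambda>h. f \<circ> h \<circ> inv f) ` colored_Aut g \<subseteq> colored_Aut (relabel f g)"
    proof
      fix k assume "k \<in> (\<lambda>h. f \<circ> h \<circ> inv f) ` colored_Aut g"
      then obtain h where h: "k = f \<circ> h \<circ> inv f" "h permutes half_edges (fst g)" "relabel h g = g"
        using colored_Aut_relabel[OF g] by auto
      have bh: "bij h" using h(2) by (rule permutes_bij)
      have "relabel k (relabel f g) = relabel (k \<circ> f) g"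
        using f bh unfolding h(1) by (intro relabel_relabel bij_comp bij_imp_bij_inv)
      also have "k \<circ> f = f \<circ> h" by (simp add: h(1) fun_eq_iff fi)
      also have "relabel (f \<circ> h) g = relabel f g" using relabel_relabel[OF f bh, of g] h(3) by simp
      finally show "k \<in> colored_Aut (relabel f g)"
        unfolding colored_Aut_relabel[OF relabel_trivalent[OF f g]]
        using permutes_conj[OF f h(2)] unfolding h(1)[symmetric] by simp
    qed
    show "finite (colored_Aut (relabel f g))"
      using finite_colored_Aut[OF relabel_trivalent[OF f g]] .
  qed
  have "relabel (inv f) (relabel f g) = g"
    using f g relabel_relabel[OF bij_imp_bij_inv[OF f] f, of g]
    by (simp add: relabel_id bij_def inv_o_cancel)
  thus ?thesis
    using le[OF f g] le[OF bij_imp_bij_inv[OF f] relabel_trivalent[OF f g]] by simp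
qed

text \<open>The contribution of a single labelled graph. The automorphism factor appears only when
  labelled graphs are gathered into isomorphism classes.\<close>

definition bare_weight :: "real^'n \<Rightarrow> (nat, 'n) colored_graph \<Rightarrow> complex fps" where
  "bare_weight lam g = fps_const (of_real (2 powi (int (card (edges (fst g))) - int (card (vertices (fst g))))
        * (\<Prod>e\<in>edges (fst g). inverse (edge_lambda lam g e)))) * fps_X ^ card (boundaries (fst g))"

lemma graph_weight_bare:
  assumes "g \<in> trivalent_colored_graphs"
  shows "of_nat (card (colored_Aut g)) * graph_weight lam g = bare_weight lam g"
proof -
  have "real (card (colored_Aut g)) \<noteq> 0" using card_colored_Aut_pos[OF assms] by simp
  hence "of_nat (card (colored_Aut g)) * (of_real (x / real (card (colored_Aut g)) * y) :: complex) = of_real (x * y)" for x y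
    by (simp add: field_simps)
  thus ?thesis
    by (simp add: graph_weight_def bare_weight_def fps_of_nat[symmetric] mult.assoc[symmetric] del: fps_of_nat of_real_mult of_real_divide)
qed

lemma edge_lambda_relabel:
  assumes f: "bij f" and g: "g \<in> trivalent_colored_graphs" and e: "e \<in> edges (fst g)"
  shows "edge_lambda lam (relabel f g) (f ` e) = edge_lambda lam g e"
proof -
  have inj: "inj f" and fi: "inv f (f y) = y" for y using f by (auto simp: bij_def)
  obtain G c where Gc: "g = (G, c)" by (cases g)
  obtain G' c' where Gc': "relabel f g = (G', c')" by (cases "relabel f g")
  have B': "bdry G' = f ` bdry G" and c': "c' = restrict (c \<circ> inv f) (f ` face_half_edges G)"
    using relabel_simps(5,6)[of f "(G, c)"] unfolding Gc'[unfolded Gc] by simp_all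
  have F': "face_half_edges G' = f ` face_half_edges G" using relabel_face[OF inj, of "(G, c)"] unfolding Gc'[unfolded Gc] by simp
  have cf: "c' (f x) = c x" if "x \<in> face_half_edges G" for x using that by (simp add: c' fi)
  have r: "is_ribbon_graph G" using g by (simp add: Gc trivalent_colored_graphs_def)
  obtain x where x: "x \<in> half_edges G" "e = orbit (sigma1 G) x" using e by (auto simp: edges_def cycles_on_def Gc)
  have ss: "sigma1 G (sigma1 G x) = x" "sigma1 G x \<in> half_edges G"
    using r x(1) by (auto simp: is_ribbon_graph_def permutes_in_image)
  have ex: "e = {x, sigma1 G x}" using orbit_involution[of "sigma1 G" x] ss x(2) by simp
  have nb: "sigma1 G y \<notin> bdry G" if "y \<in> bdry G" for y using r that by (auto simp: is_ribbon_graph_def)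
  have disj: "f ` e \<inter> f ` bdry G = {} \<longleftrightarrow> e \<inter> bdry G = {}" using inj by (auto simp: inj_def)
  show ?thesis
  proof (cases "e \<inter> bdry G = {}")
    case True
    have "y \<in> face_half_edges G" if "y \<in> e" for y
      using that True ex x(1) ss(2) by (auto simp: face_half_edges_def)
    hence "(\<Sum>y\<in>f ` e. lam $ c' y) = (\<Sum>y\<in>e. lam $ c y)"
      using inj by (subst sum.reindex) (auto simp: inj_on_def inj_def cf intro!: sum.cong)
    thus ?thesis using True disj unfolding Gc' unfolding Gc edge_lambda_def by (simp add: B')
  next
    case False
    \<comment> \<open>The description by \<open>THE\<close> can be transported along
      \<open>f\<close> once it is known to be unique: a boundary edge has exactly one half-edge on a
      face, because both cannot lie on the boundary.\<close>
    have "\<exists>y. e \<inter> face_half_edges G = {y}"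
    proof (cases "x \<in> bdry G")
      case True
      have "e \<inter> face_half_edges G = {sigma1 G x}" using True nb[OF True] ss ex by (auto simp: face_half_edges_def)
      thus ?thesis by blast
    next
      case F: False
      hence "sigma1 G x \<in> bdry G" using False ex by auto
      hence "e \<inter> face_half_edges G = {x}" using F x(1) ex by (auto simp: face_half_edges_def)
      thus ?thesis by blast
    qed
    then obtain y where y: "e \<inter> face_half_edges G = {y}" by blast
    have "f ` e \<inter> face_half_edges G' = {f y}"
      unfolding F' image_Int[OF inj, symmetric] y by simp
    hence "(THE z. z \<in> f ` e \<inter> face_half_edges G') = f y" by (simp only: singleton_iff the_eq_trivial)
    moreover have "(THE z. z \<in> e \<inter> face_half_edges G) = y" unfolding y by (simp only: singleton_iff the_eq_trivial)
    moreover have "c' (f y) = c y" using y by (intro cf) blast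
    ultimately show ?thesis using False disj unfolding Gc' unfolding Gc edge_lambda_def by (simp only: prod.case B' if_False)
  qed
qed

lemma bare_weight_relabel:
  assumes f: "bij f" and g: "g \<in> trivalent_colored_graphs"
  shows "bare_weight lam (relabel f g) = bare_weight lam g"
proof -
  have inj: "inj f" using f by (simp add: bij_def)
  have E: "edges (fst (relabel f g)) = (`) f ` edges (fst g)"
    using f by (simp add: edges_def cycles_on_conj del: o_apply)
  have V: "vertices (fst (relabel f g)) = (`) f ` vertices (fst g)"
    using f by (simp add: vertices_def cycles_on_conj del: o_apply)
  have Bd: "boundaries (fst (relabel f g)) = (`) f ` boundaries (fst g)"
    using f inj by (auto simp: boundaries_def cycles_on_conj inj_image_subset_iff simp del: o_apply)
  have "(\<Prod>e\<in>edges (fst (relabel f g)). inverse (edge_lambda lam (relabel f g) e))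
      = (\<Prod>e\<in>edges (fst g). inverse (edge_lambda lam (relabel f g) (f ` e)))"
    unfolding E using inj by (subst prod.reindex) (auto simp: inj_on_def inj_image_eq_iff)
  also have "\<dots> = (\<Prod>e\<in>edges (fst g). inverse (edge_lambda lam g e))"
    by (intro prod.cong refl) (simp add: edge_lambda_relabel[OF f g])
  finally show ?thesis
    unfolding bare_weight_def by (simp add: E V Bd card_image_image[OF inj])
qed

lemma graph_weight_relabel:
  assumes f: "bij f" and g: "g \<in> trivalent_colored_graphs"
  shows "graph_weight lam (relabel f g) = graph_weight lam g"
proof -
  have "of_nat (card (colored_Aut g)) * graph_weight lam (relabel f g) = of_nat (card (colored_Aut g)) * graph_weight lam g"
    using graph_weight_bare[OF g, of lam] graph_weight_bare[OF relabel_trivalent[OF f g], of lam]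
    by (simp add: card_Aut_relabel[OF f g] bare_weight_relabel[OF f g])
  thus ?thesis using card_colored_Aut_pos[OF g] by (simp add: mult_left_cancel)
qed

text \<open>The orbit-stabiliser theorem for the permutations of \<open>H\<close>: the relabellings
  of \<open>g0\<close> that yield a given graph form a coset of its automorphism group.\<close>

lemma card_labelled_isomorphic:
  fixes g0 :: "(nat, 'n) colored_graph"
  assumes g0: "g0 \<in> labelled_graphs H" and fin: "finite H"
  shows "card {g \<in> labelled_graphs H. (g0, g) \<in> colored_iso_rel} * card (colored_Aut g0) = fact (card H)"
proof -
  let ?O = "{g \<in> labelled_graphs H. (g0, g) \<in> colored_iso_rel}"
  let ?P = "{f. f permutes H}"
  have T: "g0 \<in> trivalent_colored_graphs" and H: "half_edges (fst g0) = H"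
    using g0 by (auto simp: labelled_graphs_def)
  have im: "?O = (\<lambda>f. relabel f g0) ` ?P"
  proof (intro equalityI subsetI)
    fix g assume g: "g \<in> ?O"
    then obtain f where f: "bij f" "relabel f g0 = g" by (auto simp: colored_iso_rel_relabel)
    have "f ` H = H" using relabel_simps(1)[of f g0] g f(2) H by (simp add: labelled_graphs_def)
    hence bH: "bij_betw f H H" using f(1) by (simp add: bij_betw_def bij_def inj_on_def)
    \<comment> \<open>The bijection \<open>f\<close> of the naturals preserves \<open>H\<close>.
      Replacing it by the identity outside gives a permutation of \<open>H\<close> with the same
      effect on \<open>g0\<close>, since isomorphisms only see half-edges.\<close>
    define h where "h = (\<lambda>x. if x \<in> H then f x else x)"
    have "bij_betw h H H" using bH by (subst bij_betw_cong[of H h f]) (simp_all add: h_def)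
    hence h: "h permutes H" by (rule bij_imp_permutes) (simp add: h_def)
    have gT: "g \<in> trivalent_colored_graphs" using g by (simp add: labelled_graphs_def)
    have "is_colored_iso f g0 g" using relabel_eq_iff[OF f(1) T gT] f(2) by simp
    hence "is_colored_iso h g0 g" using colored_iso_cong[OF _ T, of f h] H by (simp add: h_def)
    hence "relabel h g0 = g" by (rule relabel_eqI[OF permutes_bij[OF h] T gT])
    thus "g \<in> (\<lambda>f. relabel f g0) ` ?P" using h by blast
  next
    fix g assume "g \<in> (\<lambda>f. relabel f g0) ` ?P"
    then obtain f where f: "f permutes H" "g = relabel f g0" by blast
    have "half_edges (fst g) = H" using f H permutes_image[OF f(1)] by simp
    thus "g \<in> ?O" using relabel_trivalent[OF permutes_bij[OF f(1)] T] f T permutes_bij[OF f(1)]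
      by (auto simp: labelled_graphs_def colored_iso_rel_relabel)
  qed
  have fiber: "card {f \<in> ?P. relabel f g0 = g} = card (colored_Aut g0)" if g: "g \<in> ?O" for g
  proof -
    obtain f where f: "f permutes H" "relabel f g0 = g" using g im by auto
    have bf: "bij f" using f(1) by (rule permutes_bij)
    have "{h \<in> ?P. relabel h g0 = g} = (\<lambda>k. f \<circ> k) ` colored_Aut g0"
    proof (intro equalityI subsetI)
      fix h assume "h \<in> {h \<in> ?P. relabel h g0 = g}"
      hence h: "h permutes H" "relabel h g0 = g" by auto
      have "relabel (inv f \<circ> h) g0 = relabel (inv f) (relabel f g0)"
        using relabel_relabel[OF bij_imp_bij_inv[OF bf] permutes_bij[OF h(1)], of g0] h(2) f(2) by simp
      also have "\<dots> = relabel (inv f \<circ> f) g0" by (rule relabel_relabel[OF bij_imp_bij_inv[OF bf] bf])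
      also have "\<dots> = g0" using bf relabel_id[OF T] by (simp add: bij_def)
      finally have "inv f \<circ> h \<in> colored_Aut g0"
        unfolding colored_Aut_relabel[OF T] using permutes_compose[OF h(1) permutes_inv[OF f(1)]] H by simp
      moreover have "h = f \<circ> (inv f \<circ> h)" using permutes_inverses(1)[OF f(1)] by (simp add: fun_eq_iff)
      ultimately show "h \<in> (\<lambda>k. f \<circ> k) ` colored_Aut g0" by blast
    next
      fix h assume "h \<in> (\<lambda>k. f \<circ> k) ` colored_Aut g0"
      then obtain k where k: "h = f \<circ> k" "k permutes H" "relabel k g0 = g0"
        using colored_Aut_relabel[OF T] H by auto
      have "relabel h g0 = g" using relabel_relabel[OF bf permutes_bij[OF k(2)], of g0] k(1,3) f(2) by simp
      thus "h \<in> {h \<in> ?P. relabel h g0 = g}" using permutes_compose[OF k(2) f(1)] k(1) by simp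
    qed
    moreover have "inj_on (\<lambda>k. f \<circ> k) (colored_Aut g0)"
      using bf by (intro inj_onI) (simp add: fun_eq_iff bij_def inj_eq)
    ultimately show ?thesis by (simp add: card_image)
  qed
  have finP: "finite ?P" using fin by (rule finite_permutations)
  have "fact (card H) = card ?P" using fin by (simp add: card_permutations)
  also have "\<dots> = (\<Sum>f\<in>?P. 1)" by simp
  also have "\<dots> = (\<Sum>g\<in>?O. \<Sum>f\<in>{f \<in> ?P. relabel f g0 = g}. 1)"
    unfolding im by (rule sum.image_gen[OF finP])
  also have "\<dots> = (\<Sum>g\<in>?O. card (colored_Aut g0))"
    using fiber by (intro sum.cong refl) simp
  finally show ?thesis by simp
qed

section \<open>Summation over labelled graphs and passage to isomorphism classes\<close>

lemma labelled_graph_card_edges: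
  assumes g: "g \<in> labelled_graphs H"
  shows "2 * card (edges (fst g)) = card H" "card H = 3 * card (vertices (fst g))"
proof -
  interpret L: labelled_graph "fst g" H
    using g by unfold_locales (auto simp: labelled_graphs_def trivalent_colored_graphs_def)
  have H: "card H = 3 * card (cycles_on L.s H)" by (rule card_three_cycles[OF L.s L.fin])
  thus "card H = 3 * card (vertices (fst g))" using L.G(3) by (simp add: vertices_def)
  have "card L.R div 2 * 2 = card L.R" using pairings_card[OF L.t_pairing L.finR] by simp
  thus "2 * card (edges (fst g)) = card H"
    using L.card_R[OF H] L.card_edges unfolding L.data_graph_eq H by simp
qed

lemma finite_graph_data:
  assumes "finite H"
  shows "finite (graph_data H :: (_ \<times> _ \<times> _ \<times> _ \<times> (nat \<Rightarrow> 'n::finite)) set)"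
  unfolding graph_data_def
proof (intro finite_SigmaI)
  show "finite (three_perms H)"
    by (rule finite_subset[OF _ finite_permutations[OF assms]]) (auto simp: three_perms_def)
next
  fix s assume "s \<in> three_perms H"
  show "finite (boundary_sets H s)"
    by (rule finite_subset[of _ "Pow H"]) (use assms in \<open>auto simp: boundary_sets_def\<close>)
next
  fix s B assume B: "s \<in> three_perms H" "B \<in> boundary_sets H s"
  interpret trivalent_data H s B using B assms by (simp add: trivalent_data_boundary_sets)
  show "finite {p. p permutes B}" by (rule finite_permutations[OF finB])
  show "finite (pairings R)" by (rule finite_pairings[OF finR])
  fix p t show "finite (compat_cols p t :: (nat \<Rightarrow> 'n) set)"
    by (rule finite_subset[OF _ finite_cols[of p]]) (auto simp: compat_cols_def)
qed

lemma sum_bare_weight_labelled: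
  fixes lam :: "real^'n"
  assumes lam: "\<And>i. lam $ i > 0" and fin: "finite H" and m: "card H = 3 * m"
  shows "(\<Sum>g\<in>labelled_graphs H. bare_weight lam g)
    = of_nat (card (three_perms H)) * (\<Sum>a\<le>m. of_nat (m choose a) * 3 ^ a * (fps_const ((-1 / 2) ^ (m - a)) * kp_term lam (m - a) a))"
proof -
  have fd: "finite (graph_data H :: (_ \<times> _ \<times> _ \<times> _ \<times> (nat \<Rightarrow> 'n)) set)" using fin by (rule finite_graph_data)
  have "(\<Sum>g\<in>labelled_graphs H. bare_weight lam g)
    = (\<Sum>x\<in>graph_data H. bare_weight lam (case x of (s, B, p, t, c) \<Rightarrow> (data_graph H s B p t, c)))"
    by (rule sum.reindex_bij_betw[OF labelled_graphs_bij[OF fin], symmetric])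
  also have "\<dots> = (\<Sum>(s, B, p, t, c)\<in>graph_data H. trivalent_data.data_weight H s B lam m p t c)"
  proof (intro sum.cong refl, clarify)
    fix s B p t and c :: "nat \<Rightarrow> 'n" assume d: "(s, B, p, t, c) \<in> graph_data H"
    interpret trivalent_graph_data H s B p t
      using d fin by (auto simp: graph_data_def trivalent_graph_data_def trivalent_graph_data_axioms_def trivalent_data_boundary_sets)
    show "bare_weight lam (data_graph H s B p t, c) = data_weight lam m p t c"
      unfolding bare_weight_def fst_conv by (rule weight_G[OF m])
  qed
  also have "\<dots> = (\<Sum>s\<in>three_perms H. \<Sum>B\<in>boundary_sets H s. \<Sum>p | p permutes B.
      \<Sum>t\<in>pairings (trivalent_data.R H s B). \<Sum>c\<in>trivalent_data.compat_cols H s B p t. trivalent_data.data_weight H s B lam m p t c)"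
  proof -
    have 1: "finite (three_perms H)"
      by (rule finite_subset[OF _ finite_permutations[OF fin]]) (auto simp: three_perms_def)
    have 2: "finite (boundary_sets H s)" for s
      by (rule finite_subset[of _ "Pow H"]) (use fin in \<open>auto simp: boundary_sets_def\<close>)
    have D: "trivalent_data H s B" if "s \<in> three_perms H" "B \<in> boundary_sets H s" for s B
      using that fin by (simp add: trivalent_data_boundary_sets)
    note 3 = finite_permutations[OF trivalent_data.finB[OF D]]
    note 4 = finite_pairings[OF trivalent_data.finR[OF D]]
    have 5: "finite (trivalent_data.compat_cols H s B p t :: (nat \<Rightarrow> 'n) set)"
      if "s \<in> three_perms H" "B \<in> boundary_sets H s" for s B p t
      by (rule finite_subset[OF _ trivalent_data.finite_cols[OF D[OF that], of p]])
        (auto simp: trivalent_data.compat_cols_def[OF D[OF that]])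
    show ?thesis
      unfolding graph_data_def
      by (subst sum.Sigma[symmetric], use 1 2 3 4 5 in \<open>auto intro!: finite_SigmaI\<close>)
        (intro sum.cong refl, subst sum.Sigma[symmetric], use 2 3 4 5 in \<open>auto intro!: finite_SigmaI\<close>,
         intro sum.cong refl, subst sum.Sigma[symmetric], use 3 4 5 in \<open>auto intro!: finite_SigmaI\<close>,
         intro sum.cong refl, subst sum.Sigma[symmetric], use 4 5 in \<open>auto intro!: finite_SigmaI\<close>)
  qed
  also have "\<dots> = (\<Sum>s\<in>three_perms H. \<Sum>B\<in>boundary_sets H s. fps_const ((-1 / 2) ^ (m - card B)) * kp_term lam (m - card B) (card B))"
  proof (rule sum.cong[OF refl], rule sum.cong[OF refl])
    fix s B assume sB: "s \<in> three_perms H" "B \<in> boundary_sets H s"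
    interpret trivalent_data H s B using sB fin by (simp add: trivalent_data_boundary_sets)
    show "(\<Sum>p | p permutes B. \<Sum>t\<in>pairings R. \<Sum>c\<in>compat_cols p t. data_weight lam m p t c)
      = fps_const ((-1 / 2) ^ (m - card B)) * kp_term lam (m - card B) (card B)"
      by (rule sum_data_weight[OF m lam])
  qed
  also have "\<dots> = (\<Sum>s\<in>three_perms H. \<Sum>a\<le>m. of_nat (m choose a) * 3 ^ a * (fps_const ((-1 / 2) ^ (m - a)) * kp_term lam (m - a) a))"
    by (rule sum.cong[OF refl], rule sum_boundary_sets[OF fin _ m])
  finally show ?thesis by simp
qed

lemma fact_mult_kp_tau_nth:
  fixes lam :: "real^'n"
  assumes lam: "\<And>i. lam $ i > 0"
  shows "fact n * fps_nth (kp_tau lam) n = (\<Sum>g\<in>labelled_graphs {..<n}. bare_weight lam g)"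
proof (cases "3 dvd n")
  case True
  define m where "m = n div 3"
  have n: "n = 3 * m" using True by (simp add: m_def)
  have c: "card {..<n} = 3 * m" by (simp add: n)
  let ?N = "of_nat (card (three_perms {..<n})) :: complex"
  have N: "?N * 3 ^ m * fact m = fact n"
    using card_three_perms[OF _ c] by (simp add: n)
  \<comment> \<open>This compares n! = N 3^m m! and m! = (m choose a) a! (m - a)!. Splitting 3^m as
    3^a 3^(m - a), the first factor counts the positions of the boundary half-edges and the second
    turns -1/6 into -1/2.\<close>
  have co: "fact n * ((-1 / 6) ^ (m - a) / (fact (m - a) * fact a)) = ?N * (of_nat (m choose a) * 3 ^ a * (-1 / 2) ^ (m - a))"
    if a: "a \<le> m" for a
  proof -
    have b: "of_nat (m choose a) * (fact a * fact (m - a)) = (fact m :: complex)"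
      using binomial_fact[OF a, where 'a = complex] by simp
    have "(3 :: complex) ^ m = 3 ^ a * 3 ^ (m - a)" using a by (simp add: power_add[symmetric])
    moreover have "(-1 / 2 :: complex) ^ (m - a) = 3 ^ (m - a) * (-1 / 6) ^ (m - a)"
      by (simp add: power_mult_distrib[symmetric])
    ultimately show ?thesis unfolding N[symmetric] b[symmetric] by (simp add: field_simps)
  qed
  have "fact n * fps_nth (kp_tau lam) n
      = (\<Sum>a\<le>m. fps_const (fact n * ((-1 / 6) ^ (m - a) / (fact (m - a) * fact a))) * kp_term lam (m - a) a)"
  proof -
    have "(fact n :: complex fps) = fps_const (fact n)" by (metis of_nat_fact fps_of_nat)
    thus ?thesis unfolding kp_tau_nth[OF lam] using True
      by (simp only: if_True m_def[symmetric] sum_distrib_left mult.assoc[symmetric] fps_const_mult)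
  qed
  also have "\<dots> = (\<Sum>a\<le>m. of_nat (card (three_perms {..<n})) * (of_nat (m choose a) * 3 ^ a * (fps_const ((-1 / 2) ^ (m - a)) * kp_term lam (m - a) a)))"
  proof (intro sum.cong refl)
    fix a assume "a \<in> {..m}"
    hence a: "a \<le> m" by simp
    have 3: "(3 ^ a :: complex fps) = fps_const (3 ^ a)"
      by (metis fps_const_power numeral_fps_const)
    show "fps_const (fact n * ((-1 / 6) ^ (m - a) / (fact (m - a) * fact a))) * kp_term lam (m - a) a
      = of_nat (card (three_perms {..<n})) * (of_nat (m choose a) * 3 ^ a * (fps_const ((-1 / 2) ^ (m - a)) * kp_term lam (m - a) a))"
      unfolding co[OF a] 3 fps_of_nat[symmetric] by (simp only: mult.assoc[symmetric] fps_const_mult)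
  qed
  also have "\<dots> = (\<Sum>g\<in>labelled_graphs {..<n}. bare_weight lam g)"
    unfolding sum_bare_weight_labelled[OF lam finite_lessThan c] sum_distrib_left ..
  finally show ?thesis .
next
  case False
  \<comment> \<open>A trivalent graph has three half-edges per vertex, so both sides vanish when 3
    does not divide \<open>n\<close>.\<close>
  have "labelled_graphs {..<n} = ({} :: (nat, 'n) colored_graph set)"
    using labelled_graph_card_edges(2)[of _ "{..<n}"] False by (metis card_lessThan dvd_triv_left equals0I)
  thus ?thesis using False by (simp add: kp_tau_nth[OF lam])
qed

lemma sum_iso_classes:
  fixes lam :: "real^'n"
  defines "Q \<equiv> \<lambda>n. {g \<in> trivalent_colored_graphs. 2 * card (edges (fst g)) = n} // (colored_iso_rel :: ((nat, 'n) colored_graph \<times> _) set)"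
  shows "(\<Sum>g\<in>labelled_graphs {..<n}. bare_weight lam g) = fact n * (\<Sum>C\<in>Q n. graph_weight lam (SOME g. g \<in> C))"
proof -
  let ?L = "labelled_graphs {..<n} :: (nat, 'n) colored_graph set"
  let ?cls = "\<lambda>g. colored_iso_rel `` {g} :: (nat, 'n) colored_graph set"
  note eqv = equiv_colored_iso_rel[where 'n = 'n]
  have T: "g \<in> trivalent_colored_graphs" if "g \<in> ?L" for g using that by (simp add: labelled_graphs_def)
  have finL: "finite ?L"
    using bij_betw_finite[OF labelled_graphs_bij[of "{..<n}", where 'n = 'n]] finite_graph_data[of "{..<n}", where 'n = 'n] by simp
  \<comment> \<open>A graph with \<open>n / 2\<close> edges has \<open>n\<close> half-edges and can
    be relabelled onto the initial segment, so every class in degree \<open>n\<close> has a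
    representative there.\<close>
  have Q: "Q n = ?cls ` ?L"
  proof (intro equalityI subsetI)
    fix C assume "C \<in> Q n"
    then obtain g where g: "g \<in> trivalent_colored_graphs" "2 * card (edges (fst g)) = n" "C = ?cls g"
      unfolding Q_def by (auto elim: quotientE)
    let ?H = "half_edges (fst g)"
    have "g \<in> labelled_graphs ?H" using g by (simp add: labelled_graphs_def)
    from labelled_graph_card_edges(1)[OF this] have "card ?H = card {..<n}" using g(2) by simp
    then obtain f where "bij_betw f ?H {..<n}"
      using finite_same_card_bij[OF trivalent_colored_graphsD(4)[OF g(1)]] by blast
    then obtain h where h: "bij h" "\<And>x. x \<in> ?H \<Longrightarrow> h x = f x"
      using bij_extend_nat[OF trivalent_colored_graphsD(4)[OF g(1)]] by blast
    have "h ` ?H = f ` ?H" using h(2) by (intro image_cong) auto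
    hence "half_edges (fst (relabel h g)) = {..<n}"
      using \<open>bij_betw f ?H {..<n}\<close> by (simp add: bij_betw_def)
    hence L: "relabel h g \<in> ?L" using relabel_trivalent[OF h(1) g(1)] by (simp add: labelled_graphs_def)
    have "(g, relabel h g) \<in> colored_iso_rel" using g(1) h(1) by (auto simp: colored_iso_rel_relabel)
    hence "C = ?cls (relabel h g)" unfolding g(3) by (rule equiv_class_eq[OF eqv])
    thus "C \<in> ?cls ` ?L" using L by blast
  next
    fix C assume "C \<in> ?cls ` ?L"
    then obtain g where g: "g \<in> ?L" "C = ?cls g" by blast
    show "C \<in> Q n" unfolding Q_def g(2)
      using T[OF g(1)] labelled_graph_card_edges(1)[OF g(1)] by (intro quotientI) simp
  qed
  have cls_eq: "{g \<in> ?L. ?cls g = ?cls g0} = {g \<in> ?L. (g0, g) \<in> colored_iso_rel}" if g0: "g0 \<in> ?L" for g0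
  proof (rule Collect_cong, rule conj_cong[OF refl])
    fix g assume "g \<in> ?L"
    from eq_equiv_class_iff[OF eqv T[OF g0] T[OF this]]
    show "?cls g = ?cls g0 \<longleftrightarrow> (g0, g) \<in> colored_iso_rel" by (simp only: eq_commute)
  qed
  have "(\<Sum>g\<in>?L. bare_weight lam g) = (\<Sum>C\<in>Q n. \<Sum>g\<in>{g \<in> ?L. ?cls g = C}. bare_weight lam g)"
    unfolding Q by (rule sum.image_gen[OF finL])
  also have "\<dots> = (\<Sum>C\<in>Q n. fact n * graph_weight lam (SOME g. g \<in> C))"
  proof (rule sum.cong[OF refl])
    fix C assume "C \<in> Q n"
    then obtain g0 where g0: "g0 \<in> ?L" "C = ?cls g0" unfolding Q by blast
    have "g0 \<in> C" unfolding g0(2) using T[OF g0(1)] by (rule equiv_class_self[OF eqv])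
    \<comment> \<open>The chosen representative may have other half-edges than
      \<open>{..<n}\<close>; the invariance of \<open>graph_weight\<close> under relabelling
      replaces it by \<open>g0\<close>.\<close>
    hence "(SOME g. g \<in> C) \<in> C" by (rule someI)
    hence "(g0, SOME g. g \<in> C) \<in> colored_iso_rel" unfolding g0(2) by blast
    then obtain f where f: "bij f" "relabel f g0 = (SOME g. g \<in> C)" by (auto simp: colored_iso_rel_relabel)
    have w: "graph_weight lam (SOME g. g \<in> C) = graph_weight lam g0"
      unfolding f(2)[symmetric] by (rule graph_weight_relabel[OF f(1) T[OF g0(1)]])
    let ?O = "{g \<in> ?L. (g0, g) \<in> colored_iso_rel}"
    have "(\<Sum>g\<in>{g \<in> ?L. ?cls g = C}. bare_weight lam g) = (\<Sum>g\<in>?O. bare_weight lam g0)"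
      unfolding g0(2) cls_eq[OF g0(1)]
    proof (rule sum.cong[OF refl])
      fix g assume "g \<in> ?O"
      then obtain f where f: "bij f" "relabel f g0 = g" by (auto simp: colored_iso_rel_relabel)
      show "bare_weight lam g = bare_weight lam g0"
        unfolding f(2)[symmetric] by (rule bare_weight_relabel[OF f(1) T[OF g0(1)]])
    qed
    also have "\<dots> = of_nat (card ?O * card (colored_Aut g0)) * graph_weight lam g0"
      unfolding graph_weight_bare[OF T[OF g0(1)], symmetric] by (simp add: mult.assoc)
    also have "\<dots> = fact n * graph_weight lam g0"
      unfolding card_labelled_isomorphic[OF g0(1) finite_lessThan] by (simp only: card_lessThan of_nat_fact)
    finally show "(\<Sum>g\<in>{g \<in> ?L. ?cls g = C}. bare_weight lam g) = fact n * graph_weight lam (SOME g. g \<in> C)"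
      unfolding w .
  qed
  finally show ?thesis by (simp add: sum_distrib_left)
qed

theorem proposition3p1:
  fixes lam :: "real^'n"
  assumes "\<And>i. lam $ i > 0"
  shows "kp_tau lam = Abs_fps (\<lambda>n.
    \<Sum>C \<in> {g \<in> trivalent_colored_graphs. 2 * card (edges (fst g)) = n} // colored_iso_rel.
      graph_weight lam (SOME g. g \<in> C))"
proof (rule fps_ext)
  fix n
  \<comment> \<open>Both sides are compared with the weight \<open>fact n\<close>, the number of
    relabellings of \<open>n\<close> half-edges, which is then cancelled.\<close>
  have "fact n * fps_nth (kp_tau lam) n
    = fact n * (\<Sum>C \<in> {g \<in> trivalent_colored_graphs. 2 * card (edges (fst g)) = n} // colored_iso_rel.
      graph_weight lam (SOME g. g \<in> C))"
    unfolding fact_mult_kp_tau_nth[OF assms] by (rule sum_iso_classes)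
  thus "fps_nth (kp_tau lam) n = fps_nth (Abs_fps (\<lambda>n.
    \<Sum>C \<in> {g \<in> trivalent_colored_graphs. 2 * card (edges (fst g)) = n} // colored_iso_rel.
      graph_weight lam (SOME g. g \<in> C))) n"
    by (simp add: mult_left_cancel)
qed

end
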